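(* Let $\Theta\subset\mathbb{R}^d$ be open, convex and bounded, and let $X_0,X_1,\ldots$ satisfy $$X_j=S(\vartheta,X_{j-1})+\varepsilon_j,\qquad j\ge 1,$$ where $(\varepsilon_j)_{j\ge1}$ are i.i.d. with known density $g$ and $\vartheta\in\Theta$ is unknown. Let $\ell(\vartheta,x,x')=\ln g\big(x'-S(\vartheta,x)\big)$ and let $\mathbb{I}(\vartheta)=\mathbf{E}_\vartheta\big[\dot\ell(\vartheta,X_0,X_1)\dot\ell(\vartheta,X_0,X_1)^{\mathbb{T}}\big]$ be the Fisher information matrix. Assume Conditions $\mathcal{R}$ (stated in the context) hold. Let $\frac12<\delta<1$, $N=[n^\delta]$, and let $\bar\vartheta_N$ be a preliminary estimator, i.e. a function of $X_0,\ldots,X_N$, such that $\sqrt{N}(\bar\vartheta_N-\vartheta)$ is tight uniformly on compacts $\mathbb{K}\subset\Theta$. For $s\in[\tau_\delta,1]$, $\tau_\delta=n^{-1+\delta}$, put $k=[sn]$, $$\Delta_k(\vartheta,X^k_N)=\frac{1}{\sqrt{k}}\sum_{j=N+1}^{k}\dot\ell(\vartheta,X_{j-1},X_j),$$ and define the one-step MLE-process $$\vartheta^\star_{s,n}=\bar\vartheta_N+\frac{1}{\sqrt{k}}\,\mathbb{I}(\bar\vartheta_N)^{-1}\Delta_k(\bar\vartheta_N,X^k_N).$$ Then for every $s\in(0,1]$, as $n\to\infty$, $$\sqrt{k}\,(\vartheta^\star_{s,n}-\vartheta)\Longrightarrow\mathcal{N}\big(0,\mathbb{I}(\vartheta)^{-1}\big),$$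 and this estimator-process is asymptotically efficient for bounded loss functions, i.e. for every $\vartheta_0\in\Theta$ and every bounded loss function $W$, $$\lim_{\rho\to0}\lim_{n\to\infty}\sup_{|\vartheta-\vartheta_0|<\rho}\mathbf{E}_\vartheta W\big(\sqrt{k}(\vartheta^\star_{s,n}-\vartheta)\big)=\mathbf{E}\,W\big(\zeta\,\mathbb{I}(\vartheta_0)^{-1/2}\big),$$ where $\zeta\sim\mathcal{N}(0,\mathbb{J})$ with $\mathbb{J}$ the $d\times d$ identity matrix.
   Context: $[a]$ denotes the integer part of $a$; a dot denotes differentiation with respect to $\vartheta$, $\mathbb{T}$ denotes transpose, and $\mathbf{P}_\vartheta,\mathbf{E}_\vartheta$ refer to the law of the process under parameter $\vartheta$. A family of random variables $\eta_n(\vartheta)$ is tight uniformly on compacts $\mathbb{K}\subset\Theta$ if for every $\varepsilon>0$ and every compact $\mathbb{K}$ there exists $C>0$ with $\sup_{\vartheta\in\mathbb{K}}\mathbf{P}_\vartheta(|\eta_n(\vartheta)|>C)\le\varepsilon$ for all $n$. A loss function $W:\mathbb{R}^d\to[0,\infty)$ is understood in the usual sense of Ibragimov–Has'minskii (e.g. $W(0)=0$, symmetric, continuous, with convex sublevel sets). Conditions $\mathcal{R}$: (1) The time series $(X_j)_{j\ge0}$ is strictly stationary and has a unique invariant distribution with density $\pi(\vartheta,x)$. (2) The preliminary estimator has the tightness property stated in the claim. (3) $S(\vartheta,x)$ is three times continuously differentiable in $\vartheta$, $g>0$ and $g\in\mathcal{C}^3$; the derivatives $\partial^i\ell(\vartheta,x,x')/\partial\vartheta^i$,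 $i=1,2,3$, satisfy $\sup_{\vartheta\in\Theta}\|\partial^i\ell(\vartheta,x,x')/\partial\vartheta^i\|\le R_i(x,x')$ with $\mathbf{E}_\vartheta|R_i(X_{j-1},X_j)|^2<C$, the constant $C>0$ not depending on $\vartheta$. (4) The law of large numbers $\frac1n\sum_{j=1}^n\dot\ell(\vartheta,X_{j-1},X_j)\dot\ell(\vartheta,X_{j-1},X_j)^{\mathbb{T}}\to\mathbb{I}(\vartheta)$ holds; the central limit theorem $\frac1{\sqrt n}\sum_{j=1}^n\dot\ell(\vartheta,X_{j-1},X_j)\Rightarrow\mathcal{N}(0,\mathbb{I}(\vartheta))$ holds; and the family $\frac1{\sqrt n}\sum_{j=1}^n[\ddot\ell(\vartheta,X_{j-1},X_j)+\mathbb{I}(\vartheta)]$ is tight uniformly on compacts $\mathbb{K}\subset\Theta$. (5) $\mathbb{I}$ is Lipschitz, $|\mathbb{I}(\vartheta_1)-\mathbb{I}(\vartheta_2)|\le L|\vartheta_1-\vartheta_2|$, and uniformly non-degenerate and bounded: $0<\inf_{\vartheta\in\Theta}\inf_{|\lambda|=1}\lambda^{\mathbb{T}}\mathbb{I}(\vartheta)\lambda$ and $\sup_{\vartheta\in\Theta}\sup_{|\lambda|=1}\lambda^{\mathbb{T}}\mathbb{I}(\vartheta)\lambda<\infty$, $\lambda\in\mathbb{R}^d$. *)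

theory Defs
  imports "HOL-Analysis.Analysis" "HOL-Probability.Probability"
begin

definition grad :: "(real^'d \<Rightarrow> real) \<Rightarrow> real^'d \<Rightarrow> real^'d" where
  "grad f t = (\<chi> i. frechet_derivative f (at t) (axis i 1))"

definition hess :: "(real^'d \<Rightarrow> real) \<Rightarrow> real^'d \<Rightarrow> real^'d^'d" where
  "hess f t = (\<chi> i. grad (\<lambda>s. grad f s $ i) t)"

definition d3 :: "(real^'d \<Rightarrow> real) \<Rightarrow> real^'d \<Rightarrow> real^'d^'d^'d" where
  "d3 f t = (\<chi> i. hess (\<lambda>s. grad f s $ i) t)"

definition C3_on :: "(real^'d) set \<Rightarrow> (real^'d \<Rightarrow> real) \<Rightarrow> bool" where
  "C3_on U f \<longleftrightarrow>
     (\<forall>t\<in>U. f differentiable (at t)) \<and>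
     (\<forall>i. \<forall>t\<in>U. (\<lambda>s. grad f s $ i) differentiable (at t)) \<and>
     (\<forall>i j. \<forall>t\<in>U. (\<lambda>s. hess f s $ i $ j) differentiable (at t)) \<and>
     continuous_on U (d3 f)"

definition C3_real :: "(real \<Rightarrow> real) \<Rightarrow> bool" where
  "C3_real g \<longleftrightarrow>
     (\<forall>x. g differentiable (at x)) \<and>
     (\<forall>x. deriv g differentiable (at x)) \<and>
     (\<forall>x. (deriv ^^ 2) g differentiable (at x)) \<and>
     continuous_on UNIV ((deriv ^^ 3) g)"

definition ell :: "(real^'d \<Rightarrow> real \<Rightarrow> real) \<Rightarrow> (real \<Rightarrow> real) \<Rightarrow> real^'d \<Rightarrow> real \<Rightarrow> real \<Rightarrow> real" where
  "ell S g \<theta> x x' = ln (g (x' - S \<theta> x))"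

definition dell :: "(real^'d \<Rightarrow> real \<Rightarrow> real) \<Rightarrow> (real \<Rightarrow> real) \<Rightarrow> real^'d \<Rightarrow> real \<Rightarrow> real \<Rightarrow> real^'d" where
  "dell S g \<theta> x x' = grad (\<lambda>t. ell S g t x x') \<theta>"

definition ddell :: "(real^'d \<Rightarrow> real \<Rightarrow> real) \<Rightarrow> (real \<Rightarrow> real) \<Rightarrow> real^'d \<Rightarrow> real \<Rightarrow> real \<Rightarrow> real^'d^'d" where
  "ddell S g \<theta> x x' = hess (\<lambda>t. ell S g t x x') \<theta>"

definition dddell :: "(real^'d \<Rightarrow> real \<Rightarrow> real) \<Rightarrow> (real \<Rightarrow> real) \<Rightarrow> real^'d \<Rightarrow> real \<Rightarrow> real \<Rightarrow> real^'d^'d^'d" where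
  "dddell S g \<theta> x x' = d3 (\<lambda>t. ell S g t x x') \<theta>"

definition outer :: "real^'d \<Rightarrow> real^'d^'d" where
  "outer v = (\<chi> i j. v $ i * v $ j)"

definition fisher :: "(real^'d \<Rightarrow> real \<Rightarrow> real) \<Rightarrow> (real \<Rightarrow> real) \<Rightarrow> (real^'d \<Rightarrow> 'w measure)
     \<Rightarrow> (nat \<Rightarrow> 'w \<Rightarrow> real) \<Rightarrow> real^'d \<Rightarrow> real^'d^'d" where
  "fisher S g P X \<theta> = (LINT \<omega>|P \<theta>. outer (dell S g \<theta> (X 0 \<omega>) (X 1 \<omega>)))"

definition invariant_distr :: "(real^'d \<Rightarrow> real \<Rightarrow> real) \<Rightarrow> (real \<Rightarrow> real) \<Rightarrow> real^'d \<Rightarrow> real measure \<Rightarrow> bool" where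
  "invariant_distr S g \<theta> \<mu> \<longleftrightarrow> prob_space \<mu> \<and> sets \<mu> = sets borel \<and>
     distr (\<mu> \<Otimes>\<^sub>M density lborel (\<lambda>e. ennreal (g e))) borel (\<lambda>(y, e). S \<theta> y + e) = \<mu>"

definition weak_conv_vec :: "(nat \<Rightarrow> 'a::euclidean_space measure) \<Rightarrow> 'a measure \<Rightarrow> bool" where
  "weak_conv_vec \<mu>s \<mu> \<longleftrightarrow>
     (\<forall>f :: 'a \<Rightarrow> real. continuous_on UNIV f \<and> bounded (range f) \<longrightarrow>
        (\<lambda>n. \<integral>x. f x \<partial>\<mu>s n) \<longlonglongrightarrow> (\<integral>x. f x \<partial>\<mu>))"

definition std_gauss :: "(real^'d) measure" where
  "std_gauss = density lborel (\<lambda>x. ennreal (\<Prod>i\<in>UNIV. std_normal_density (x $ i)))"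

definition matrix_sqrt :: "real^'d^'d \<Rightarrow> real^'d^'d" where
  "matrix_sqrt A = (THE B. transpose B = B \<and> (\<forall>x. 0 \<le> x \<bullet> (B *v x)) \<and> B ** B = A)"

definition normal_vec :: "real^'d^'d \<Rightarrow> (real^'d) measure" where
  "normal_vec \<Sigma> = distr std_gauss borel (\<lambda>z. matrix_sqrt \<Sigma> *v z)"

definition tight_uc :: "'t::topological_space set \<Rightarrow> ('t \<Rightarrow> 'w measure)
     \<Rightarrow> (nat \<Rightarrow> 't \<Rightarrow> 'w \<Rightarrow> 'v::real_normed_vector) \<Rightarrow> bool" where
  "tight_uc \<Theta> P \<eta> \<longleftrightarrow>
     (\<forall>K. compact K \<and> K \<subseteq> \<Theta> \<longrightarrow>
        (\<forall>\<epsilon>>0. \<exists>C>0. \<forall>n. \<forall>\<theta>\<in>K.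
            measure (P \<theta>) {\<omega> \<in> space (P \<theta>). norm (\<eta> n \<theta> \<omega>) > C} \<le> \<epsilon>))"

definition conv_in_prob :: "'w measure \<Rightarrow> (nat \<Rightarrow> 'w \<Rightarrow> 'v::real_normed_vector) \<Rightarrow> 'v \<Rightarrow> bool" where
  "conv_in_prob M Y c \<longleftrightarrow>
     (\<forall>\<epsilon>>0. (\<lambda>n. measure M {\<omega> \<in> space M. norm (Y n \<omega> - c) > \<epsilon>}) \<longlonglongrightarrow> 0)"

text \<open>Loss function in the sense of Ibragimov--Has'minskii, bounded.\<close>
definition bounded_loss :: "(real^'d \<Rightarrow> real) \<Rightarrow> bool" where
  "bounded_loss W \<longleftrightarrow> W 0 = 0 \<and> (\<forall>u. W u \<ge> 0) \<and> (\<forall>u. W (- u) = W u) \<and>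
     continuous_on UNIV W \<and> (\<forall>c. convex {u. W u < c}) \<and> bounded (range W)"

definition Nsz :: "real \<Rightarrow> nat \<Rightarrow> nat" where
  "Nsz \<delta> n = nat \<lfloor>real n powr \<delta>\<rfloor>"

definition ksz :: "real \<Rightarrow> nat \<Rightarrow> nat" where
  "ksz s n = nat \<lfloor>s * real n\<rfloor>"

definition Delta :: "(real^'d \<Rightarrow> real \<Rightarrow> real) \<Rightarrow> (real \<Rightarrow> real) \<Rightarrow> nat \<Rightarrow> nat
     \<Rightarrow> real^'d \<Rightarrow> (nat \<Rightarrow> real) \<Rightarrow> real^'d" where
  "Delta S g N k \<theta> x = (1 / sqrt (real k)) *\<^sub>R (\<Sum>j\<in>{N+1..k}. dell S g \<theta> (x (j - 1)) (x j))"

text \<open>One-step MLE-process theta*_{s,n}; the preliminary estimator is est N applied to the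
  trajectory (it depends only on X_0..X_N).\<close>
definition onestep :: "(real^'d \<Rightarrow> real \<Rightarrow> real) \<Rightarrow> (real \<Rightarrow> real) \<Rightarrow> (real^'d \<Rightarrow> 'w measure)
     \<Rightarrow> (nat \<Rightarrow> 'w \<Rightarrow> real) \<Rightarrow> (nat \<Rightarrow> (nat \<Rightarrow> real) \<Rightarrow> real^'d) \<Rightarrow> real \<Rightarrow> real \<Rightarrow> nat
     \<Rightarrow> 'w \<Rightarrow> real^'d" where
  "onestep S g P X est \<delta> s n \<omega> =
     (let N = Nsz \<delta> n; k = ksz s n; x = (\<lambda>j. X j \<omega>); tb = est N x in
      tb + (1 / sqrt (real k)) *\<^sub>R (matrix_inv (fisher S g P X tb) *v Delta S g N k tb x))"

end

theory Submission
  imports Defs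
begin

text \<open>
  Write \<open>\<psi> = g' / g\<close> and \<open>h\<close> for the gradient of \<open>S\<close> in the parameter. The score of one transition is
  \<open>- \<psi>(\<epsilon>\<^sub>j) h(\<theta>, X\<^sub>j\<^sub>-\<^sub>1)\<close>, a martingale difference, and a one-step expansion gives
  \<open>\<surd>k (\<theta>\<^sup>* - \<theta>) = I(\<theta>)\<^sup>-\<^sup>1 k\<^sup>-\<^sup>1\<^sup>/\<^sup>2 (\<Sum>\<^sub>j\<^sub>\<le>\<^sub>k score) + O\<^sub>P(\<surd>k / N + \<surd>(N / k))\<close>, with \<open>\<surd>k / N \<rightarrow> 0\<close>
  because \<open>\<delta> > 1/2\<close>.

  A central limit theorem at each single parameter does not control the supremum over a ball; a central
  limit theorem along arbitrary sequences \<open>\<theta>\<^sub>n \<rightarrow> \<theta>\<^sub>0\<close> is therefore derived from the martingale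
  structure. The conditional variance \<open>J h h\<^sup>T\<close> of the score is
  minus the conditional mean of the Hessian of the log-likelihood, so the uniform tightness of the
  Hessian sums yields the law of large numbers for the conditional variances, and Jensen's inequality
  turns the second moment bound for the Hessian into a fourth moment bound for \<open>h\<close>. Convergence along all
  sequences \<open>\<theta>\<^sub>n \<rightarrow> \<theta>\<^sub>0\<close> and all index sequences \<open>m\<^sub>n \<rightarrow> \<infinity>\<close> amounts to locally uniform convergence to a continuous
  limit, from which the limits of the suprema follow.
\<close>

section \<open>Gradients, Hessians and the score\<close>

text \<open>The obstacle is uniformity in the parameter with few moments: neither a Lindeberg
  condition nor a moment of the noise score is given directly. The way out is that each score
  factors into a function of the noise and a function of the previous state, and that the noise law
  is the same for every parameter. Nondegeneracy of the Fisher information together with the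
  dominated second moments forces \<open>score\<close> and \<open>dscore\<close> to be square
  integrable under the noise. One expansion of the characteristic function of \<open>score\<close>,
  with error \<eta> t^2 + C t^4, then serves all parameters; the quartic part is where the fourth
  moment is spent. No conditioning on the estimator is used: the score at the estimator is expanded
  around the true parameter, and the third-derivative bound controls the quadratic remainder for all
  values of the estimator at once. Before normalisation by the square root of k this remainder has
  size k / N; the omitted first N summands account for the other rate.\<close>

lemma grad_has_derivative:
  assumes "f differentiable (at t)"
  shows "(f has_derivative (\<lambda>v. grad f t \<bullet> v)) (at t)"
proof -
  let ?f' = "frechet_derivative f (at t)"
  have f': "(f has_derivative ?f') (at t)" using assms by (simp add: frechet_derivative_works)
  then interpret linear ?f' by (rule has_derivative_linear)
  have "?f' v = grad f t \<bullet> v" for v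
  proof -
    have "?f' v = ?f' (\<Sum>i\<in>UNIV. v $ i *s axis i 1)" by (simp add: basis_expansion)
    also have "\<dots> = (\<Sum>i\<in>UNIV. v $ i * ?f' (axis i 1))"
      by (simp add: sum scale scalar_mult_eq_scaleR)
    also have "\<dots> = grad f t \<bullet> v" by (simp add: grad_def inner_vec_def mult.commute)
    finally show ?thesis .
  qed
  then have "?f' = (\<lambda>v. grad f t \<bullet> v)" by auto
  with f' show ?thesis by simp
qed

lemma grad_eqI:
  assumes "(f has_derivative (\<lambda>v. a \<bullet> v)) (at t)"
  shows "grad f t = a"
proof -
  have "f differentiable (at t)" using assms by (auto simp: differentiable_def)
  then have "(\<lambda>v. grad f t \<bullet> v) = (\<lambda>v. a \<bullet> v)"
    using has_derivative_unique[OF grad_has_derivative assms] by simp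
  then have "grad f t \<bullet> v = a \<bullet> v" for v by metis
  then show ?thesis by (metis vector_eq_rdot inner_commute)
qed

lemma hess_nth: "hess f t $ i $ j = grad (\<lambda>s. grad f s $ i) t $ j"
  by (simp add: hess_def)

lemma d3_nth: "d3 f t $ i $ j = grad (\<lambda>s. hess f s $ i $ j) t"
  by (simp add: d3_def hess_def)

lemma differentiable_cong_open:
  assumes "open U" "t \<in> U" "\<And>s. s \<in> U \<Longrightarrow> f s = f' s" "f differentiable (at t)"
  shows "f' differentiable (at t)"
  using assms has_derivative_transform_within_open[of f _ t UNIV U f'] unfolding differentiable_def
  by metis

text \<open>The type \<open>real^'n^'m\<close> carries the Frobenius norm, so Cauchy-Schwarz on each
  row already bounds the operator norm by it.\<close>

lemma norm_matrix_vector_mult_le: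
  fixes A :: "real^'n^'m"
  shows "norm (A *v x) \<le> norm A * norm x"
proof -
  have "norm (A *v x) \<le> L2_set (\<lambda>i. norm (A $ i) * norm x) UNIV"
    unfolding norm_vec_def[of "A *v x"]
    by (rule L2_set_mono) (auto simp: matrix_vector_mult_def inner_vec_def[symmetric]
        intro: Cauchy_Schwarz_ineq2[of "A $ i" x for i, unfolded inner_vec_def, simplified])
  also have "\<dots> = norm A * norm x"
    by (simp add: L2_set_left_distrib norm_vec_def[of A])
  finally show ?thesis .
qed

lemma grad_has_derivative_hess:
  assumes "\<And>i. (\<lambda>s. grad f s $ i) differentiable (at t)"
  shows "(grad f has_derivative (\<lambda>v. hess f t *v v)) (at t)"
proof -
  have "((\<lambda>s. grad f s $ i) has_derivative (\<lambda>v. hess f t $ i \<bullet> v)) (at t)" for i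
    using grad_has_derivative[OF assms[of i]] by (simp add: hess_def)
  then have "((\<lambda>s. grad f s \<bullet> axis i 1) has_derivative (\<lambda>v. (hess f t *v v) \<bullet> axis i 1)) (at t)" for i
    by (simp add: inner_axis matrix_vector_mul_component)
  then show ?thesis
    by (subst has_derivative_componentwise_within) (auto simp: Basis_vec_def)
qed

lemma hess_has_derivative_d3:
  fixes f :: "real^'d \<Rightarrow> real"
  assumes "\<And>i j. (\<lambda>s. hess f s $ i $ j) differentiable (at t)"
  shows "(hess f has_derivative (\<lambda>v. \<chi> i. d3 f t $ i *v v)) (at t)"
proof -
  have "((\<lambda>s. hess f s $ i $ j) has_derivative (\<lambda>v. d3 f t $ i $ j \<bullet> v)) (at t)" for i j
    using grad_has_derivative[OF assms[of i j]] by (simp add: d3_nth)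
  then have "((\<lambda>s. hess f s \<bullet> axis i (axis j 1)) has_derivative
      (\<lambda>v. (\<chi> i. d3 f t $ i *v v) \<bullet> axis i (axis j 1))) (at t)" for i j
    by (simp add: inner_axis matrix_vector_mul_component)
  then show ?thesis
    by (subst has_derivative_componentwise_within) (auto simp: Basis_vec_def)
qed

text \<open>The bound on \<open>d3\<close> makes the Hessian Lipschitz on the convex set. The mean
  value inequality for the gradient minus its linearisation along the segment then costs one more
  factor norm (b - a). The constant B in place of B / 2 is harmless: only the order of the remainder
  matters later.\<close>

lemma grad_taylor:
  fixes f :: "real^'d \<Rightarrow> real"
  assumes U: "open U" "convex U"
    and f: "\<And>i t. t \<in> U \<Longrightarrow> (\<lambda>s. grad f s $ i) differentiable (at t)"
      "\<And>i j t. t \<in> U \<Longrightarrow> (\<lambda>s. hess f s $ i $ j) differentiable (at t)"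
    and B: "\<And>t. t \<in> U \<Longrightarrow> norm (d3 f t) \<le> B"
    and a: "a \<in> U" and b: "b \<in> U"
  shows "norm (grad f b - grad f a - hess f a *v (b - a)) \<le> B * (norm (b - a))\<^sup>2"
proof -
  have B0: "0 \<le> B" using B[OF a] norm_ge_zero order_trans by blast
  have d3: "onorm (\<lambda>v. \<chi> i. d3 f t $ i *v v) \<le> B" if "t \<in> U" for t
  proof (rule onorm_le)
    fix v :: "real^'d"
    have "norm (\<chi> i. d3 f t $ i *v v) \<le> L2_set (\<lambda>i. norm (d3 f t $ i) * norm v) UNIV"
      unfolding norm_vec_def[of "\<chi> i. d3 f t $ i *v v"]
      by (rule L2_set_mono) (auto simp: norm_matrix_vector_mult_le)
    also have "\<dots> = norm (d3 f t) * norm v"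
      by (simp add: L2_set_left_distrib norm_vec_def[of "d3 f t"])
    also have "\<dots> \<le> B * norm v" using B[OF that] by (simp add: mult_right_mono)
    finally show "norm (\<chi> i. d3 f t $ i *v v) \<le> B * norm v" .
  qed
  have hl: "norm (hess f x - hess f y) \<le> B * norm (x - y)" if "x \<in> U" "y \<in> U" for x y
    by (rule differentiable_bound[OF U(2) _ d3 that], rule has_derivative_at_withinI,
        rule hess_has_derivative_d3, rule f(2))
  have seg: "closed_segment a b \<subseteq> U" using U a b by (simp add: closed_segment_subset)
  have "norm (grad f b - grad f a - hess f a *v (b - a)) \<le> norm (b - a) * (B * norm (b - a))"
  proof (rule differentiable_bound_linearization[of a b "closed_segment a b" "grad f"
        "\<lambda>t v. hess f t *v v" a "B * norm (b - a)"])
    show "a + t *\<^sub>R (b - a) \<in> closed_segment a b" if "t \<in> {0..1}" for t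
    proof -
      have "a + t *\<^sub>R (b - a) = (1 - t) *\<^sub>R a + t *\<^sub>R b" by (simp add: algebra_simps)
      with that show ?thesis unfolding closed_segment_def by force
    qed
    show "(grad f has_derivative (\<lambda>v. hess f x *v v)) (at x within closed_segment a b)"
      if "x \<in> closed_segment a b" for x
      by (rule has_derivative_at_withinI, rule grad_has_derivative_hess, rule f) (use that seg in auto)
    show "onorm ((\<lambda>v. hess f x *v v) - (\<lambda>v. hess f a *v v)) \<le> B * norm (b - a)"
      if x: "x \<in> closed_segment a b" for x
    proof (rule onorm_le)
      fix v :: "real^'d"
      have "norm (((\<lambda>v. hess f x *v v) - (\<lambda>v. hess f a *v v)) v) = norm ((hess f x - hess f a) *v v)"
        by (simp add: matrix_vector_mult_diff_rdistrib)
      also have "\<dots> \<le> norm (hess f x - hess f a) * norm v" by (rule norm_matrix_vector_mult_le)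
      also have "\<dots> \<le> (B * norm (x - a)) * norm v"
        using hl[of x a] x seg a by (intro mult_right_mono) auto
      also have "\<dots> \<le> (B * norm (b - a)) * norm v"
        using segment_bound1[OF x] B0 by (intro mult_right_mono mult_left_mono) auto
      finally show "norm (((\<lambda>v. hess f x *v v) - (\<lambda>v. hess f a *v v)) v) \<le> B * norm (b - a) * norm v" .
    qed
  qed auto
  then show ?thesis by (simp add: power2_eq_square ac_simps)
qed

section \<open>Derivatives of the log-density and the factorised score\<close>

definition score :: "(real \<Rightarrow> real) \<Rightarrow> real \<Rightarrow> real" where
  "score g e = deriv g e / g e"

lemma C3_real_derivs:
  assumes "C3_real g"
  shows "(g has_real_derivative deriv g x) (at x)"
    "(deriv g has_real_derivative deriv (deriv g) x) (at x)"
    "(deriv (deriv g) has_real_derivative deriv (deriv (deriv g)) x) (at x)"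
  using assms unfolding C3_real_def
  by (auto simp: numeral_2_eq_2 DERIV_deriv_iff_real_differentiable)

text \<open>The second derivative of ln g, written so that
  \<open>(dscore g e + (score g e)\<^sup>2) * g e\<close> is the second derivative of g. In this
  form its mean under the noise is found by integrating a derivative.\<close>

definition dscore :: "(real \<Rightarrow> real) \<Rightarrow> real \<Rightarrow> real" where
  "dscore g e = deriv (deriv g) e / g e - (score g e)\<^sup>2"

lemma score_deriv:
  assumes "C3_real g" "\<And>x. g x > 0"
  shows "((\<lambda>e. ln (g e)) has_real_derivative score g x) (at x)"
    "(score g has_real_derivative dscore g x) (at x)"
    "\<exists>D. (dscore g has_real_derivative D) (at x)"
proof -
  note D = C3_real_derivs[OF assms(1)]
  have g: "g x \<noteq> 0" for x using assms(2)[of x] by simp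
  show "((\<lambda>e. ln (g e)) has_real_derivative score g x) (at x)"
    unfolding score_def by (auto intro!: derivative_eq_intros D simp: assms(2) g)
  show s: "(score g has_real_derivative dscore g x) (at x)"
    unfolding score_def[abs_def] dscore_def by (auto intro!: derivative_eq_intros D simp: assms(2) g)
      (simp add: field_simps power2_eq_square g)
  have "((\<lambda>e. deriv (deriv g) e / g e - (score g e)\<^sup>2) has_real_derivative
      (deriv (deriv (deriv g)) x * g x - deriv (deriv g) x * deriv g x) / (g x * g x)
       - 2 * (score g x * dscore g x)) (at x)"
    using DERIV_diff[OF DERIV_divide[OF D(3)[of x] D(1)[of x] g] DERIV_power[OF s, of 2]]
    by (simp add: ac_simps)
  then show "\<exists>D. (dscore g has_real_derivative D) (at x)"
    unfolding dscore_def[abs_def] by (rule exI)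
qed

lemma score_measurable:
  assumes "C3_real g" "\<And>x. g x > 0"
  shows "score g \<in> borel_measurable borel" "dscore g \<in> borel_measurable borel"
proof -
  note D = score_deriv[OF assms]
  show "score g \<in> borel_measurable borel"
    by (intro borel_measurable_continuous_onI continuous_at_imp_continuous_on ballI) (rule DERIV_isCont[OF D(2)])
  have "isCont (dscore g) x" for x using D(3)[of x] DERIV_isCont by blast
  then show "dscore g \<in> borel_measurable borel"
    by (intro borel_measurable_continuous_onI continuous_at_imp_continuous_on) auto
qed

text \<open>Chain rule through the residual x' - S t x. At the true parameter the residual is the
  innovation, so the noise enters through the scalars \<open>score\<close> and \<open>dscore\<close>
  and the previous state through the gradient and Hessian of S. Every moment computation below rests
  on this separation. The third derivative itself is not computed; differentiability of the Hessian
  is enough for the Taylor bound.\<close>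

lemma ell_smooth:
  fixes S :: "real^'d \<Rightarrow> real \<Rightarrow> real"
  assumes U: "open U" and S: "C3_on U (\<lambda>\<theta>. S \<theta> x)"
    and g: "C3_real g" "\<And>x. g x > 0" and t: "t \<in> U"
  shows "dell S g t x x' = - score g (x' - S t x) *\<^sub>R grad (\<lambda>\<theta>. S \<theta> x) t"
    "ddell S g t x x' = dscore g (x' - S t x) *\<^sub>R outer (grad (\<lambda>\<theta>. S \<theta> x) t)
       - score g (x' - S t x) *\<^sub>R hess (\<lambda>\<theta>. S \<theta> x) t"
    "(\<lambda>s. grad (\<lambda>\<theta>. ell S g \<theta> x x') s $ i) differentiable (at t)"
    "(\<lambda>s. hess (\<lambda>\<theta>. ell S g \<theta> x x') s $ i $ j) differentiable (at t)"
proof -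
  let ?S = "\<lambda>\<theta>. S \<theta> x" and ?f = "\<lambda>\<theta>. ell S g \<theta> x x'" and ?e = "\<lambda>\<theta>. x' - S \<theta> x"
  have S1: "(?S has_derivative (\<lambda>v. grad ?S t \<bullet> v)) (at t)" if "t \<in> U" for t
    using S that by (auto simp: C3_on_def intro!: grad_has_derivative)
  have S2: "((\<lambda>s. grad ?S s $ i) has_derivative (\<lambda>v. hess ?S t $ i \<bullet> v)) (at t)" if "t \<in> U" for t i
    using S that grad_has_derivative[of "\<lambda>s. grad ?S s $ i" t] by (auto simp: C3_on_def hess_def)
  have S3: "(\<lambda>s. hess ?S s $ i $ j) differentiable (at t)" if "t \<in> U" for t i j
    using S that by (auto simp: C3_on_def)
  note g' = score_deriv[OF g]
  have comp: "((\<lambda>s. F (?e s)) has_derivative (\<lambda>v. - (F' * (grad ?S t \<bullet> v)))) (at t)"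
    if "t \<in> U" "(F has_real_derivative F') (at (?e t))" for F F' t
  proof -
    have "(?e has_derivative (\<lambda>v. - (grad ?S t \<bullet> v))) (at t)"
      using S1[OF that(1)] by (auto intro!: derivative_eq_intros)
    from has_derivative_compose[OF this that(2)[unfolded has_field_derivative_def]]
    show ?thesis by simp
  qed
  have d: "grad ?f t = - score g (?e t) *\<^sub>R grad ?S t" if "t \<in> U" for t
    by (rule grad_eqI) (use comp[OF that g'(1)] in \<open>simp add: ell_def\<close>)
  show "dell S g t x x' = - score g (x' - S t x) *\<^sub>R grad ?S t"
    unfolding dell_def using d[OF t] by simp
  have d1: "((\<lambda>s. - score g (?e s) * (grad ?S s $ i)) has_derivative
      (\<lambda>v. (dscore g (?e t) * grad ?S t $ i) *\<^sub>R grad ?S t \<bullet> v - score g (?e t) *\<^sub>R hess ?S t $ i \<bullet> v)) (at t)"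
    if "t \<in> U" for t i
    by (rule derivative_eq_intros comp[OF that g'(2)] S2 that refl)+ (simp add: fun_eq_iff)
  have ddf: "((\<lambda>s. grad ?f s $ i) has_derivative
      (\<lambda>v. ((dscore g (?e t) * grad ?S t $ i) *\<^sub>R grad ?S t - score g (?e t) *\<^sub>R hess ?S t $ i) \<bullet> v)) (at t)"
    if "t \<in> U" for t i
    using has_derivative_transform_within_open[OF d1[OF that] U that, where g = "\<lambda>s. grad ?f s $ i"] d
    by (simp add: inner_diff_left)
  show "(\<lambda>s. grad ?f s $ i) differentiable (at t)" by (rule differentiableI, rule ddf[OF t])
  have dd: "hess ?f t $ i = (dscore g (?e t) * grad ?S t $ i) *\<^sub>R grad ?S t - score g (?e t) *\<^sub>R hess ?S t $ i"
    if "t \<in> U" for t i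
    using grad_eqI[OF ddf[OF that, of i]] by (simp add: hess_def)
  show "ddell S g t x x' = dscore g (x' - S t x) *\<^sub>R outer (grad ?S t) - score g (x' - S t x) *\<^sub>R hess ?S t"
    unfolding ddell_def by (simp add: vec_eq_iff dd[OF t] outer_def)
  obtain D where D: "(dscore g has_real_derivative D) (at (?e t))" using g'(3)[of "?e t"] by (rule exE)
  have q1: "(\<lambda>s. dscore g (?e s)) differentiable (at t)"
    by (rule differentiableI, rule comp[OF t D])
  have q2: "(\<lambda>s. score g (?e s)) differentiable (at t)"
    by (rule differentiableI, rule comp[OF t g'(2)])
  have q3: "(\<lambda>s. grad ?S s $ i) differentiable (at t)" for i
    by (rule differentiableI, rule S2[OF t])
  have q4: "(\<lambda>s. dscore g (?e s) * grad ?S s $ i * grad ?S s $ j - score g (?e s) * hess ?S s $ i $ j)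
     differentiable (at t)"
    by (rule differentiable_diff[OF differentiable_mult[OF differentiable_mult[OF q1 q3] q3]
          differentiable_mult[OF q2 S3[OF t]]])
  show "(\<lambda>s. hess ?f s $ i $ j) differentiable (at t)"
    by (rule differentiable_cong_open[OF U t _ q4]) (simp add: dd)
qed

lemma dell_taylor:
  fixes S :: "real^'d \<Rightarrow> real \<Rightarrow> real"
  assumes U: "open U" "convex U" and S: "C3_on U (\<lambda>\<theta>. S \<theta> x)"
    and g: "C3_real g" "\<And>x. g x > 0"
    and B: "\<And>t. t \<in> U \<Longrightarrow> norm (dddell S g t x x') \<le> B"
    and a: "a \<in> U" and b: "b \<in> U"
  shows "norm (dell S g b x x' - dell S g a x x' - ddell S g a x x' *v (b - a)) \<le> B * (norm (b - a))\<^sup>2"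
  unfolding dell_def ddell_def
proof (rule grad_taylor[OF U _ _ _ a b])
  fix t assume t: "t \<in> U"
  note E = ell_smooth[where S = S and x = x and g = g and x' = x', OF U(1) S g t]
  show "(\<lambda>s. grad (\<lambda>\<theta>. ell S g \<theta> x x') s $ i) differentiable (at t)" for i
    by (rule E)
  show "(\<lambda>s. hess (\<lambda>\<theta>. ell S g \<theta> x x') s $ i $ j) differentiable (at t)" for i j
    by (rule E)
  show "norm (d3 (\<lambda>\<theta>. ell S g \<theta> x x') t) \<le> B" using B[OF t] by (simp add: dddell_def)
qed

section \<open>Symmetric and coercive matrices\<close>

lemma symmetric_inner:
  fixes A :: "real^'d^'d"
  assumes "transpose A = A"
  shows "x \<bullet> (A *v y) = (A *v x) \<bullet> y"
  by (simp add: dot_lmul_matrix[symmetric] transpose_matrix_vector[symmetric] assms)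

text \<open>Spectral theorem by induction on the dimension: a maximiser e of the quadratic form on
  the unit sphere of V is an eigenvector, and its orthogonal complement inside V is again invariant.
  Invariant subspaces instead of the whole space make the induction hypothesis applicable to that
  complement.\<close>

lemma symmetric_eigenbasis_subspace:
  fixes A :: "real^'d^'d"
  assumes A: "transpose A = A" and V: "subspace V" "\<And>v. v \<in> V \<Longrightarrow> A *v v \<in> V"
  shows "\<exists>E. E \<subseteq> V \<and> pairwise orthogonal E \<and> (\<forall>e\<in>E. norm e = 1 \<and> (\<exists>l. A *v e = l *\<^sub>R e)) \<and> span E = V"
  using V
proof (induction "dim V" arbitrary: V rule: less_induct)
  case (less V)
  show ?case
  proof (cases "V \<subseteq> {0}")
    case True
    then have "V = {0}" using subspace_0[OF less.prems(1)] by auto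
    then show ?thesis by (intro exI[of _ "{}"]) auto
  next
    case False
    then obtain v0 where v0: "v0 \<in> V" "v0 \<noteq> 0" by auto
    let ?K = "sphere 0 1 \<inter> V"
    have "compact ?K" using closed_subspace[OF less.prems(1)] by (intro compact_Int_closed) auto
    moreover have "(1 / norm v0) *\<^sub>R v0 \<in> ?K"
      using v0 subspace_scale[OF less.prems(1)] by (auto simp: dist_norm)
    moreover have "continuous_on ?K (\<lambda>x. x \<bullet> (A *v x))"
      by (intro continuous_intros linear_continuous_on_compose matrix_vector_mul_linear)
    ultimately obtain e where e: "e \<in> ?K" "\<And>x. x \<in> ?K \<Longrightarrow> x \<bullet> (A *v x) \<le> e \<bullet> (A *v e)"
      using continuous_attains_sup[of ?K "\<lambda>x. x \<bullet> (A *v x)"] by blast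
    define m where "m = e \<bullet> (A *v e)"
    have eV: "e \<in> V" and ne: "norm e = 1" "e \<bullet> e = 1" using e(1) by (auto simp: dist_norm norm_eq_1)
    have le: "x \<bullet> (A *v x) \<le> m * (x \<bullet> x)" if "x \<in> V" for x
    proof (cases "x = 0")
      case False
      have "(1 / norm x) *\<^sub>R x \<in> ?K"
        using that False subspace_scale[OF less.prems(1)] by (auto simp: dist_norm)
      from e(2)[OF this] have "(x \<bullet> (A *v x)) / (norm x)\<^sup>2 \<le> m"
        by (simp add: m_def matrix_vector_mult_scaleR power2_eq_square)
      then show ?thesis using False by (simp add: divide_simps dot_square_norm mult.commute)
    qed simp
    \<comment> \<open>First variation at the maximiser: comparing e + t v with e gives 2 t b \<le>
      t^2 c for every real t, which a nonzero b contradicts at a suitably small t.\<close>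
    have orth: "v \<bullet> (A *v e) = 0" if v: "v \<in> V" "v \<bullet> e = 0" for v
    proof (rule ccontr)
      define b where "b = v \<bullet> (A *v e)"
      define c where "c = m * (v \<bullet> v) - v \<bullet> (A *v v)"
      assume "v \<bullet> (A *v e) \<noteq> 0"
      then have b: "b \<noteq> 0" by (simp add: b_def)
      have q: "2 * t * b \<le> t\<^sup>2 * c" for t
      proof -
        have "e + t *\<^sub>R v \<in> V" using eV v subspace_add[OF less.prems(1)] subspace_scale[OF less.prems(1)] by auto
        from le[OF this] have "m + 2 * t * b + t\<^sup>2 * (v \<bullet> (A *v v)) \<le> m * (1 + t\<^sup>2 * (v \<bullet> v))"
          using v(2) ne symmetric_inner[OF A, of e v]
          by (simp add: matrix_vector_right_distrib matrix_vector_mult_scaleR inner_add m_def b_def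
              inner_commute power2_eq_square algebra_simps)
        then show ?thesis by (simp add: c_def algebra_simps)
      qed
      have c0: "c \<ge> 0" using le[OF v(1)] by (simp add: c_def)
      \<comment> \<open>The added 1 keeps the denominator positive, since c may vanish; at t = r the
        inequality reads 2 (c + 1) \<le> c after cancelling r^2.\<close>
      define r where "r = b / (c + 1)"
      have r: "b = r * (c + 1)" "r\<^sup>2 > 0" using c0 b by (simp_all add: r_def)
      have "r\<^sup>2 * (2 * (c + 1)) \<le> r\<^sup>2 * c"
        using q[of r] unfolding r(1) by (simp only: power2_eq_square mult_ac)
      then have "2 * (c + 1) \<le> c" using r(2) by (simp only: mult_le_cancel_left_pos)
      then show False using c0 by simp
    qed
    have Ae: "A *v e = m *\<^sub>R e"
    proof -
      let ?v = "A *v e - m *\<^sub>R e"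
      have "?v \<in> V" by (rule subspace_diff[OF less.prems(1) less.prems(2)[OF eV] subspace_scale[OF less.prems(1) eV]])
      moreover have "?v \<bullet> e = 0" using ne(2) by (simp add: inner_diff_left m_def inner_commute[of "A *v e"])
      ultimately have "?v \<bullet> (A *v e) = 0" by (rule orth)
      then have "?v \<bullet> ?v = 0" using \<open>?v \<bullet> e = 0\<close> by (simp add: inner_diff_right)
      then show ?thesis by simp
    qed
    define W where "W = {v \<in> V. v \<bullet> e = 0}"
    have W: "subspace W" using less.prems(1) by (auto simp: W_def subspace_def inner_add_left)
    have WA: "A *v v \<in> W" if "v \<in> W" for v
      using that less.prems(2) symmetric_inner[OF A, of v e] orth by (auto simp: W_def)
    have "dim W < dim V"
    proof -
      have "e \<notin> W" using ne by (simp add: W_def)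
      then have "W \<subset> V" using eV unfolding W_def by blast
      then show ?thesis using W less.prems(1) by (simp add: dim_psubset span_eq_iff[THEN iffD2])
    qed
    from less.hyps[OF this W WA] obtain E where E: "E \<subseteq> W" "pairwise orthogonal E"
      "\<forall>e\<in>E. norm e = 1 \<and> (\<exists>l. A *v e = l *\<^sub>R e)" "span E = W" by blast
    have "span (insert e E) = V"
    proof
      show "span (insert e E) \<subseteq> V" using E(1) eV less.prems(1) by (intro span_minimal) (auto simp: W_def)
      show "V \<subseteq> span (insert e E)"
      proof
        fix v assume v: "v \<in> V"
        have "v - (v \<bullet> e) *\<^sub>R e \<in> W"
          using subspace_diff[OF less.prems(1) v subspace_scale[OF less.prems(1) eV]] ne
          by (simp add: W_def inner_diff_left)
        then show "v \<in> span (insert e E)" using E(4) by (auto simp: span_insert)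
      qed
    qed
    moreover have "pairwise orthogonal (insert e E)"
      using E(1,2) by (auto simp: pairwise_insert W_def orthogonal_def inner_commute)
    ultimately show ?thesis using E(1,3) eV ne Ae
      by (intro exI[of _ "insert e E"]) (auto simp: W_def)
  qed
qed

lemma orthonormal_expansion:
  fixes E :: "(real^'d) set"
  assumes E: "pairwise orthogonal E" "\<And>e. e \<in> E \<Longrightarrow> norm e = 1" "span E = UNIV"
  shows "finite E" "(\<Sum>e\<in>E. (e \<bullet> x) *\<^sub>R e) = x"
proof -
  have "0 \<notin> E" using E(2) by force
  then have ind: "independent E" using E(1) by (simp add: pairwise_orthogonal_independent)
  then show fin: "finite E" by (rule independent_imp_finite)
  let ?y = "x - (\<Sum>e\<in>E. (e \<bullet> x) *\<^sub>R e)"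
  have "orthogonal ?y e" if "e \<in> E" for e
  proof -
    have "(\<Sum>f\<in>E. (f \<bullet> x) *\<^sub>R f) \<bullet> e = (\<Sum>f\<in>E. (f \<bullet> x) * (f \<bullet> e))" by (simp add: inner_sum_left)
    also have "\<dots> = (\<Sum>f\<in>E. if f = e then e \<bullet> x else 0)"
      using E(1,2) that by (intro sum.cong refl) (auto simp: pairwise_def orthogonal_def norm_eq_1)
    also have "\<dots> = e \<bullet> x" using fin that by simp
    finally show ?thesis by (simp add: orthogonal_def inner_diff_left inner_commute[of x e])
  qed
  then have "orthogonal ?y ?y" by (rule orthogonal_to_span[where S = E, rotated]) (simp_all only: E(3) UNIV_I)
  then have "?y = 0" by (simp only: orthogonal_self)
  then show "(\<Sum>e\<in>E. (e \<bullet> x) *\<^sub>R e) = x" by (simp only: right_minus_eq)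
qed

text \<open>\<open>matrix_sqrt\<close> is a definite description, so existence and uniqueness of a
  positive semidefinite root are both required before anything can be said about it. The root is
  built on an orthonormal eigenbasis of A, and uniqueness is tested on the same basis.\<close>

lemma matrix_sqrt_props:
  fixes A :: "real^'d^'d"
  assumes A: "transpose A = A" and psd: "\<And>x. 0 \<le> x \<bullet> (A *v x)"
  shows "transpose (matrix_sqrt A) = matrix_sqrt A" "matrix_sqrt A ** matrix_sqrt A = A"
proof -
  obtain E where E: "pairwise orthogonal E" "\<And>e. e \<in> E \<Longrightarrow> norm e = 1"
    "\<And>e. e \<in> E \<Longrightarrow> \<exists>l. A *v e = l *\<^sub>R e" "span E = UNIV"
    using symmetric_eigenbasis_subspace[OF A, of UNIV] by auto
  note ex = orthonormal_expansion[OF E(1,2,4)]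
  define l where "l e = e \<bullet> (A *v e)" for e
  have l: "A *v e = l e *\<^sub>R e" "0 \<le> l e" if e: "e \<in> E" for e
  proof -
    obtain k where "A *v e = k *\<^sub>R e" using E(3)[OF e] by blast
    then show "A *v e = l e *\<^sub>R e" using E(2)[OF e] by (simp add: l_def norm_eq_1)
  qed (simp add: l_def psd)
  define f where "f x = (\<Sum>e\<in>E. (sqrt (l e) * (e \<bullet> x)) *\<^sub>R e)" for x
  have lf: "linear f"
    by (rule linearI) (simp_all add: f_def inner_add_right algebra_simps sum.distrib scaleR_sum_right)
  define B where "B = matrix f"
  have B: "B *v x = f x" for x by (simp add: B_def lf matrix_works)
  have fe: "f e = sqrt (l e) *\<^sub>R e" if "e \<in> E" for e
  proof -
    have "f e = (\<Sum>d\<in>E. if d = e then sqrt (l e) *\<^sub>R e else 0)"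
      unfolding f_def using E(1,2) that
      by (intro sum.cong refl) (auto simp: pairwise_def orthogonal_def norm_eq_1)
    then show ?thesis using ex(1) that by simp
  qed
  have eqE: "M = N" if "\<And>e. e \<in> E \<Longrightarrow> M *v e = N *v e" for M N :: "real^'d^'d"
  proof -
    have "M *v x = N *v x" for x
      by (rule linear_eq_on_span[of "(*v) M" "(*v) N" E]) (use that E(4) in auto)
    then show ?thesis by (simp add: matrix_eq)
  qed
  have BP: "transpose B = B" "\<And>x. 0 \<le> x \<bullet> (B *v x)" "B ** B = A"
  proof -
    have "(B *v x) \<bullet> y = x \<bullet> (B *v y)" for x y
      by (simp add: B f_def inner_sum_left inner_sum_right inner_commute mult_ac)
    then have "x \<bullet> (transpose B *v y) = x \<bullet> (B *v y)" for x y
      unfolding transpose_matrix_vector inner_commute[of x "y v* B"] dot_lmul_matrix inner_commute[of y]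
      by blast
    then have "transpose B *v y = B *v y" for y using vector_eq_ldot by blast
    then show "transpose B = B" by (simp add: matrix_eq)
    show "0 \<le> x \<bullet> (B *v x)" for x
      using l(2) by (simp add: B f_def inner_sum_right inner_commute power2_eq_square[symmetric] mult.assoc sum_nonneg)
    show "B ** B = A"
    proof (rule eqE)
      fix e assume e: "e \<in> E"
      have "(B ** B) *v e = f (f e)" by (simp add: B matrix_vector_mul_assoc[symmetric])
      also have "\<dots> = sqrt (l e) *\<^sub>R f e" by (simp add: fe[OF e] linear_scale[OF lf])
      also have "\<dots> = A *v e" using l[OF e] by (simp add: fe[OF e])
      finally show "(B ** B) *v e = A *v e" .
    qed
  qed
  \<comment> \<open>Write r for the square root of the eigenvalue at e. The vector v = C e - r e
    satisfies C v = - r v, so positivity of C forces v = 0 when r > 0. For eigenvalue 0 the squared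
    norm of C e equals the inner product of e with C (C e), which is 0.\<close>
  have uniq: "C = B" if C: "transpose C = C" "\<forall>x. 0 \<le> x \<bullet> (C *v x)" "C ** C = A" for C
  proof (rule eqE)
    fix e assume e: "e \<in> E"
    let ?r = "sqrt (l e)"
    have CC: "C *v (C *v e) = l e *\<^sub>R e" using C(3) l(1)[OF e] by (simp add: matrix_vector_mul_assoc)
    have "C *v e = ?r *\<^sub>R e"
    proof (cases "l e = 0")
      case True
      have "(C *v e) \<bullet> (C *v e) = e \<bullet> (C *v (C *v e))" using symmetric_inner[OF C(1)] by simp
      then show ?thesis using CC True by simp
    next
      case False
      let ?v = "C *v e - ?r *\<^sub>R e"
      have "C *v ?v = - (?r *\<^sub>R ?v)"
        using l(2)[OF e] by (simp add: matrix_vector_mult_diff_distrib matrix_vector_mult_scaleR CC scaleR_diff_right)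
      then have "?v \<bullet> (C *v ?v) = - (?r * (?v \<bullet> ?v))" by simp
      moreover have "0 \<le> ?v \<bullet> (C *v ?v)" using C(2) by blast
      ultimately have "?r * (?v \<bullet> ?v) \<le> 0" by linarith
      moreover have "?r > 0" using False l(2)[OF e] by simp
      ultimately have "?v \<bullet> ?v \<le> 0" by (simp add: mult_le_0_iff)
      then have "?v = 0" by (metis inner_eq_zero_iff inner_ge_zero order_antisym)
      then show ?thesis by simp
    qed
    then show "C *v e = B *v e" using fe[OF e] by (simp add: B)
  qed
  have "matrix_sqrt A = B"
    unfolding matrix_sqrt_def
  proof (rule the_equality)
    show "transpose B = B \<and> (\<forall>x. 0 \<le> x \<bullet> (B *v x)) \<and> B ** B = A"
      using BP by (intro conjI allI)
    show "C = B" if "transpose C = C \<and> (\<forall>x. 0 \<le> x \<bullet> (C *v x)) \<and> C ** C = A" for C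
      using that by (elim conjE) (rule uniq)
  qed
  then show "transpose (matrix_sqrt A) = matrix_sqrt A" "matrix_sqrt A ** matrix_sqrt A = A"
    by (simp_all only: BP(1,3))
qed

text \<open>Coercivity gives c |x| \<le> |A x|, hence a trivial kernel and, in finite dimension,
  invertibility; the same inequality at a preimage bounds the inverse by 1 / c.\<close>

lemma coercive_matrix:
  fixes A :: "real^'d^'d"
  assumes c: "c > 0" and A: "\<And>u. norm u = 1 \<Longrightarrow> c \<le> u \<bullet> (A *v u)"
  shows "c * (norm x)\<^sup>2 \<le> x \<bullet> (A *v x)"
    and "matrix_inv A ** A = mat 1" "A ** matrix_inv A = mat 1"
    and "norm (matrix_inv A *v y) \<le> norm y / c"
proof -
  show ge: "c * (norm x)\<^sup>2 \<le> x \<bullet> (A *v x)" for x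
  proof (cases "x = 0")
    case False
    with A[of "(1 / norm x) *\<^sub>R x"] have "c \<le> (x \<bullet> (A *v x)) / (norm x)\<^sup>2"
      by (simp add: matrix_vector_mult_scaleR power2_eq_square)
    then show ?thesis using False by (simp add: divide_simps mult.commute)
  qed simp
  have ge': "c * norm x \<le> norm (A *v x)" for x
  proof (cases "x = 0")
    case False
    have "c * (norm x)\<^sup>2 \<le> norm x * norm (A *v x)"
      using ge[of x] Cauchy_Schwarz_ineq2[of x "A *v x"] by simp
    then show ?thesis using False by (simp add: power2_eq_square mult.left_commute)
  qed simp
  have "invertible A"
  proof -
    have "A *v x = 0 \<Longrightarrow> x = 0" for x using ge'[of x] c by (simp add: mult_le_0_iff)
    then show ?thesis
      by (simp add: invertible_left_inverse matrix_left_invertible_ker)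
  qed
  then show inv: "matrix_inv A ** A = mat 1" "A ** matrix_inv A = mat 1"
    using someI_ex[of "\<lambda>B. A ** B = mat 1 \<and> B ** A = mat 1", folded matrix_inv_def]
    unfolding invertible_def by simp_all
  have "c * norm (matrix_inv A *v y) \<le> norm y"
    using ge'[of "matrix_inv A *v y"] inv(2) by (simp add: matrix_vector_mul_assoc)
  then show "norm (matrix_inv A *v y) \<le> norm y / c" using c by (simp add: field_simps)
qed

text \<open>Resolvent identity: the difference of the inverses is inv A (B - A) inv B, and each
  inverse contributes a factor 1 / c.\<close>

lemma coercive_matrix_inv_diff:
  fixes A B :: "real^'d^'d"
  assumes c: "c > 0" and A: "\<And>u. norm u = 1 \<Longrightarrow> c \<le> u \<bullet> (A *v u)"
    and B: "\<And>u. norm u = 1 \<Longrightarrow> c \<le> u \<bullet> (B *v u)"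
  shows "norm (matrix_inv A *v y - matrix_inv B *v y) \<le> norm (A - B) * norm y / c\<^sup>2"
proof -
  note cA = coercive_matrix[OF c A] and cB = coercive_matrix[OF c B]
  have "matrix_inv A *v y - matrix_inv B *v y = matrix_inv A *v ((B - A) *v (matrix_inv B *v y))"
  proof -
    have "matrix_inv A *v (B *v (matrix_inv B *v y)) = matrix_inv A *v y"
      "matrix_inv A *v (A *v (matrix_inv B *v y)) = matrix_inv B *v y"
      using cA(2) cB(3) by (simp_all add: matrix_vector_mul_assoc matrix_mul_assoc)
    then show ?thesis by (simp add: matrix_vector_mult_diff_rdistrib matrix_vector_mult_diff_distrib)
  qed
  then have "norm (matrix_inv A *v y - matrix_inv B *v y) \<le> norm ((B - A) *v (matrix_inv B *v y)) / c"
    using cA(4) by simp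
  also have "\<dots> \<le> norm (A - B) * (norm y / c) / c"
  proof (rule divide_right_mono)
    have "norm ((B - A) *v (matrix_inv B *v y)) \<le> norm (B - A) * norm (matrix_inv B *v y)"
      by (rule norm_matrix_vector_mult_le)
    also have "\<dots> \<le> norm (B - A) * (norm y / c)" by (rule mult_left_mono[OF cB(4) norm_ge_zero])
    finally show "norm ((B - A) *v (matrix_inv B *v y)) \<le> norm (A - B) * (norm y / c)"
      by (simp only: norm_minus_commute)
  qed (use c in simp)
  also have "\<dots> = norm (A - B) * norm y / c\<^sup>2" by (simp add: power2_eq_square)
  finally show ?thesis .
qed

text \<open>Supplies what \<open>matrix_sqrt_props\<close> asks of the inverse. The last identity
  turns the limiting variance of the score in direction inv A u into the quadratic form of inv A at
  u.\<close>

lemma coercive_matrix_inv_psd: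
  fixes A :: "real^'d^'d"
  assumes c: "c > 0" and A: "\<And>u. norm u = 1 \<Longrightarrow> c \<le> u \<bullet> (A *v u)" and sym: "transpose A = A"
  shows "transpose (matrix_inv A) = matrix_inv A" "0 \<le> x \<bullet> (matrix_inv A *v x)"
    "(matrix_inv A *v u) \<bullet> (A *v (matrix_inv A *v u)) = u \<bullet> (matrix_inv A *v u)"
proof -
  note cA = coercive_matrix[OF c A]
  have "transpose (matrix_inv A) ** A = mat 1"
    using arg_cong[OF cA(3), of transpose] by (simp add: matrix_transpose_mul transpose_mat sym)
  then have "transpose (matrix_inv A) ** (A ** matrix_inv A) = matrix_inv A"
    by (simp only: matrix_mul_assoc matrix_mul_lid)
  then show "transpose (matrix_inv A) = matrix_inv A"
    by (simp only: cA(3) matrix_mul_rid)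
  have AA: "A *v (matrix_inv A *v x) = x" for x using cA(3) by (simp add: matrix_vector_mul_assoc)
  show "0 \<le> x \<bullet> (matrix_inv A *v x)"
  proof -
    have "0 \<le> c * (norm (matrix_inv A *v x))\<^sup>2" using c by simp
    also have "\<dots> \<le> (matrix_inv A *v x) \<bullet> x" using cA(1)[of "matrix_inv A *v x"] by (simp only: AA)
    finally show ?thesis by (simp only: inner_commute)
  qed
  show "(matrix_inv A *v u) \<bullet> (A *v (matrix_inv A *v u)) = u \<bullet> (matrix_inv A *v u)"
    by (simp only: AA inner_commute)
qed

section \<open>Gaussian vectors and the continuity theorem\<close>

lemma norm_integral_le_integral:
  fixes f :: "'a \<Rightarrow> 'b::{banach,second_countable_topology}"
  assumes "integrable M f" "integrable M g" "\<And>x. x \<in> space M \<Longrightarrow> norm (f x) \<le> g x"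
  shows "norm (\<integral>x. f x \<partial>M) \<le> (\<integral>x. g x \<partial>M)"
  by (rule order_trans[OF integral_norm_bound]) (intro integral_mono integrable_norm assms)

section \<open>The standard Gaussian law and its characteristic function\<close>

definition gauss_density :: "real^'d \<Rightarrow> real" where
  "gauss_density x = (\<Prod>i\<in>UNIV. std_normal_density (x $ i))"

lemma gauss_density_Basis:
  fixes x :: "real^'d"
  shows "gauss_density x = (\<Prod>b\<in>Basis. std_normal_density (x \<bullet> b))"
proof -
  have B: "(Basis :: (real^'d) set) = (\<lambda>i. axis i 1) ` UNIV" by (auto simp: Basis_vec_def)
  have "inj (\<lambda>i::'d. axis i (1::real))" by (simp add: inj_on_def axis_eq_axis)
  then have "(\<Prod>b\<in>Basis. std_normal_density (x \<bullet> b)) =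
      (\<Prod>i\<in>UNIV. std_normal_density (x \<bullet> axis i 1))"
    unfolding B by (simp add: prod.reindex)
  then show ?thesis by (simp add: gauss_density_def inner_axis)
qed

lemma gauss_density_eq:
  fixes x :: "real^'d"
  shows "gauss_density x = (1 / sqrt (2 * pi)) ^ CARD('d) * exp (- (norm x)\<^sup>2 / 2)"
proof -
  have "gauss_density x = (1 / sqrt (2 * pi)) ^ CARD('d) * exp (\<Sum>i\<in>UNIV. - (x $ i)\<^sup>2 / 2)"
    unfolding gauss_density_def std_normal_density_def prod.distrib by (simp add: exp_sum)
  also have "(\<Sum>i\<in>UNIV. - (x $ i)\<^sup>2 / 2) = - (norm x)\<^sup>2 / 2"
    unfolding power2_norm_eq_inner inner_vec_def
    by (simp add: sum_divide_distrib sum_negf power2_eq_square)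
  finally show ?thesis .
qed

lemma gauss_density_bounds: "0 < gauss_density x" "norm (gauss_density (x::real^'d)) \<le> 1"
proof -
  have s: "1 \<le> sqrt (2 * pi)" using pi_gt3 by (simp add: real_le_rsqrt)
  show "0 < gauss_density x" using s unfolding gauss_density_eq by (intro mult_pos_pos zero_less_power) auto
  moreover have "gauss_density x \<le> 1" unfolding gauss_density_eq using s
    by (intro mult_le_one power_le_one) auto
  ultimately show "norm (gauss_density (x::real^'d)) \<le> 1" by simp
qed

lemma gauss_density_measurable [measurable]: "gauss_density \<in> borel_measurable borel"
  unfolding gauss_density_eq[abs_def] by measurable

lemma std_gauss_eq: "std_gauss = density lborel (\<lambda>x. ennreal (gauss_density x))"
  by (simp add: std_gauss_def gauss_density_def)

lemma sets_std_gauss [measurable_cong, simp]: "sets std_gauss = sets borel"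
  by (simp add: std_gauss_def)

lemma space_std_gauss [simp]: "space std_gauss = UNIV"
  by (simp add: std_gauss_def)

lemma nn_integral_std_normal: "(\<integral>\<^sup>+ x. ennreal (std_normal_density x) \<partial>lborel) = 1"
proof -
  interpret prob_space "density lborel std_normal_density" by (rule prob_space_normal_density) simp
  show ?thesis using emeasure_space_1 by (simp add: emeasure_density)
qed

lemma prob_space_std_gauss: "prob_space (std_gauss :: (real^'d) measure)"
proof
  have "emeasure (std_gauss :: (real^'d) measure) (space std_gauss) = (\<integral>\<^sup>+ x. ennreal (gauss_density x) \<partial>(lborel :: (real^'d) measure))"
    by (simp add: std_gauss_eq emeasure_density)
  also have "\<dots> = (\<integral>\<^sup>+ x. (\<Prod>b\<in>Basis. ennreal (std_normal_density (x \<bullet> b))) \<partial>(lborel :: (real^'d) measure))"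
    by (simp add: gauss_density_Basis prod_ennreal)
  also have "\<dots> = 1"
    by (subst nn_integral_lborel_prod) (simp_all add: nn_integral_std_normal)
  finally show "emeasure (std_gauss :: (real^'d) measure) (space std_gauss) = 1" .
qed

lemma integral_std_gauss:
  fixes h :: "real^'d \<Rightarrow> 'b::{banach, second_countable_topology}"
  assumes "h \<in> borel_measurable borel"
  shows "integral\<^sup>L std_gauss h = (\<integral>x. gauss_density x *\<^sub>R h x \<partial>lborel)"
  unfolding std_gauss_eq
  by (subst integral_density) (use assms in \<open>auto simp: less_imp_le[OF gauss_density_bounds(1)]\<close>)

text \<open>Lebesgue measure is the image of a product of one-dimensional Lebesgue measures over
  \<open>Basis\<close>, and the integrand factors over the coordinates, so the one-dimensional
  characteristic function is applied in each of them.\<close>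

lemma char_std_gauss:
  fixes u :: "real^'d"
  shows "(\<integral>z. iexp (u \<bullet> z) \<partial>std_gauss) = complex_of_real (exp (- (norm u)\<^sup>2 / 2))"
proof -
  interpret product_sigma_finite "\<lambda>b :: real^'d. lborel :: real measure" ..
  let ?F = "\<lambda>(b :: real^'d) t. complex_of_real (std_normal_density t) * iexp ((u \<bullet> b) * t)"
  have int: "integrable lborel (?F b)" for b
  proof (rule Bochner_Integration.integrable_bound[of lborel std_normal_density])
    show "integrable lborel std_normal_density" by (rule integrable_normal_density) simp
    show "AE x in lborel. cmod (?F b x) \<le> norm (std_normal_density x)"
      by (simp add: norm_mult)
  qed simp
  have ch: "(\<integral>t. ?F b t \<partial>lborel) = exp (- (u \<bullet> b)\<^sup>2 / 2)" for b
  proof -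
    have "(\<integral>t. ?F b t \<partial>lborel) = char std_normal_distribution (u \<bullet> b)"
      unfolding char_def by (subst integral_density) (auto simp: scaleR_conv_of_real)
    then show ?thesis by (simp add: char_std_normal_distribution)
  qed
  have "(\<integral>z. iexp (u \<bullet> z) \<partial>std_gauss) = (\<integral>z. gauss_density z *\<^sub>R iexp (u \<bullet> z) \<partial>lborel)"
    by (rule integral_std_gauss) measurable
  also have "\<dots> = (\<integral>z. (\<Prod>b\<in>Basis. ?F b (z \<bullet> b)) \<partial>lborel)"
  proof (rule arg_cong[where f = "integral\<^sup>L lborel"], rule ext)
    fix z :: "real^'d"
    have "iexp (u \<bullet> z) = (\<Prod>b\<in>Basis. iexp ((u \<bullet> b) * (z \<bullet> b)))"
      by (subst euclidean_inner) (simp add: sum_distrib_left exp_sum)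
    then show "gauss_density z *\<^sub>R iexp (u \<bullet> z) = (\<Prod>b\<in>Basis. ?F b (z \<bullet> b))"
      by (simp add: gauss_density_Basis prod.distrib scaleR_conv_of_real)
  qed
  also have "\<dots> = (\<integral>f. (\<Prod>b\<in>Basis. ?F b ((\<Sum>c\<in>Basis. f c *\<^sub>R c) \<bullet> b)) \<partial>(\<Pi>\<^sub>M b\<in>(Basis :: (real^'d) set). lborel))"
    by (subst lborel_eq, subst integral_distr) auto
  also have "\<dots> = (\<integral>f. (\<Prod>b\<in>Basis. ?F b (f b)) \<partial>(\<Pi>\<^sub>M b\<in>(Basis :: (real^'d) set). lborel))"
    by (intro Bochner_Integration.integral_cong refl prod.cong) (simp add: inner_sum_left inner_Basis if_distrib cong: if_cong)
  also have "\<dots> = (\<Prod>b\<in>Basis. \<integral>t. ?F b t \<partial>lborel)"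
    by (rule product_integral_prod) (use int in auto)
  also have "\<dots> = complex_of_real (exp (\<Sum>b\<in>Basis. - (u \<bullet> b)\<^sup>2 / 2))"
    unfolding ch by (simp add: exp_sum)
  also have "(\<Sum>b\<in>Basis. - (u \<bullet> b)\<^sup>2 / 2) = - (norm u)\<^sup>2 / 2"
    unfolding power2_norm_eq_inner by (subst euclidean_inner)
      (simp add: sum_divide_distrib sum_negf power2_eq_square)
  finally show ?thesis .
qed

section \<open>Gaussian smoothing and the continuity theorem in several dimensions\<close>

lemma integrable_iexp_inner:
  fixes f :: "'a \<Rightarrow> real"
  assumes "finite_measure M" "f \<in> borel_measurable M"
  shows "integrable M (\<lambda>x. iexp (f x))"
proof -
  interpret finite_measure M by fact
  show ?thesis by (rule integrable_const_bound[of _ 1]) (use assms in auto)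
qed

text \<open>A Gaussian density is a constant multiple of a Gaussian characteristic function.
  Substituting this and exchanging the integrals expresses a smoothed density of \<mu> through the
  characteristic function of \<mu> integrated against \<open>std_gauss\<close>, a finite measure
  through which pointwise convergence passes by domination.\<close>

lemma gauss_smoothing_char:
  fixes \<mu> :: "(real^'d) measure"
  assumes \<mu>: "prob_space \<mu>" "sets \<mu> = sets borel"
  shows "complex_of_real (\<integral>y. gauss_density ((x - y) /\<^sub>R \<sigma>) \<partial>\<mu>) =
    (1 / sqrt (2 * pi)) ^ CARD('d) *
      (\<integral>z. iexp (x \<bullet> z / \<sigma>) * (\<integral>y. iexp ((- (1 / \<sigma>) *\<^sub>R z) \<bullet> y) \<partial>\<mu>) \<partial>std_gauss)"
proof -
  interpret M: prob_space \<mu> by fact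
  interpret G: prob_space "std_gauss :: (real^'d) measure" by (rule prob_space_std_gauss)
  interpret pair_prob_space \<mu> "std_gauss :: (real^'d) measure" ..
  note [measurable_cong] = \<mu>(2)
  let ?C = "(1 / sqrt (2 * pi)) ^ CARD('d)"
  have "complex_of_real (\<integral>y. gauss_density ((x - y) /\<^sub>R \<sigma>) \<partial>\<mu>) = (\<integral>y. complex_of_real (gauss_density ((x - y) /\<^sub>R \<sigma>)) \<partial>\<mu>)"
    by simp
  also have "\<dots> = (\<integral>y. ?C * (\<integral>z. iexp (((x - y) /\<^sub>R \<sigma>) \<bullet> z) \<partial>std_gauss) \<partial>\<mu>)"
    by (simp only: gauss_density_eq char_std_gauss of_real_mult)
  also have "\<dots> = ?C * (\<integral>y. (\<integral>z. iexp (((x - y) /\<^sub>R \<sigma>) \<bullet> z) \<partial>std_gauss) \<partial>\<mu>)" by simp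
  also have "(\<integral>y. (\<integral>z. iexp (((x - y) /\<^sub>R \<sigma>) \<bullet> z) \<partial>std_gauss) \<partial>\<mu>) =
      (\<integral>z. (\<integral>y. iexp (((x - y) /\<^sub>R \<sigma>) \<bullet> z) \<partial>\<mu>) \<partial>std_gauss)"
  proof (rule Fubini_integral[symmetric])
    have "(\<lambda>p. ((x - fst p) /\<^sub>R \<sigma>) \<bullet> snd p) \<in> borel_measurable (\<mu> \<Otimes>\<^sub>M std_gauss)" by measurable
    from integrable_iexp_inner[OF finite_measure_axioms this]
    show "integrable (\<mu> \<Otimes>\<^sub>M std_gauss) (\<lambda>(y, z). iexp (((x - y) /\<^sub>R \<sigma>) \<bullet> z))"
      by (simp add: case_prod_beta')
  qed
  also have "\<dots> = (\<integral>z. iexp (x \<bullet> z / \<sigma>) * (\<integral>y. iexp ((- (1 / \<sigma>) *\<^sub>R z) \<bullet> y) \<partial>\<mu>) \<partial>std_gauss)"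
  proof (rule Bochner_Integration.integral_cong[OF refl])
    fix z :: "real^'d"
    have "iexp (((x - y) /\<^sub>R \<sigma>) \<bullet> z) = iexp (x \<bullet> z / \<sigma>) * iexp ((- (1 / \<sigma>) *\<^sub>R z) \<bullet> y)" for y
      unfolding exp_add[symmetric]
      by (rule arg_cong[where f = exp]) (simp add: inner_diff_left inner_commute[of z] field_simps)
    then show "(\<integral>y. iexp (((x - y) /\<^sub>R \<sigma>) \<bullet> z) \<partial>\<mu>) = iexp (x \<bullet> z / \<sigma>) * (\<integral>y. iexp ((- (1 / \<sigma>) *\<^sub>R z) \<bullet> y) \<partial>\<mu>)"
      by simp
  qed
  finally show ?thesis by simp
qed

text \<open>Convolution of f with the law of \<sigma> times a standard Gaussian vector, written as
  an expectation so that closeness to f is immediate; the Lebesgue kernel form, needed for Fubini,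
  follows by an affine substitution.\<close>

definition gauss_smooth :: "real \<Rightarrow> (real^'d \<Rightarrow> real) \<Rightarrow> real^'d \<Rightarrow> real" where
  "gauss_smooth \<sigma> f y = (\<integral>z. f (y + \<sigma> *\<^sub>R z) \<partial>std_gauss)"

lemma gauss_smooth_lborel:
  fixes f :: "real^'d \<Rightarrow> real"
  assumes "\<sigma> > 0" and [measurable]: "f \<in> borel_measurable borel"
  shows "gauss_smooth \<sigma> f y = (\<integral>x. f x * gauss_density ((x - y) /\<^sub>R \<sigma>) \<partial>lborel) / \<sigma> ^ CARD('d)"
proof -
  let ?F = "\<lambda>x. f x * gauss_density ((x - y) /\<^sub>R \<sigma>)"
  have "(\<integral>x. ?F x \<partial>lborel) = (\<integral>x. ?F x \<partial>density (distr lborel borel (\<lambda>x. y + \<sigma> *\<^sub>R x)) (\<lambda>_. \<bar>\<sigma>\<bar> ^ DIM(real^'d)))"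
    by (subst lborel_affine[of \<sigma> y]) (use assms in auto)
  also have "\<dots> = \<sigma> ^ CARD('d) * (\<integral>x. f (y + \<sigma> *\<^sub>R x) * gauss_density x \<partial>lborel)"
    using assms by (subst integral_density; (subst integral_distr)?) (auto simp: DIM_cart)
  also have "(\<integral>x. f (y + \<sigma> *\<^sub>R x) * gauss_density x \<partial>lborel) = gauss_smooth \<sigma> f y"
    unfolding gauss_smooth_def by (subst integral_std_gauss) (auto simp: mult.commute)
  finally show ?thesis using assms(1) by simp
qed

lemma compact_support_integrable:
  fixes f :: "real^'d \<Rightarrow> real"
  assumes f: "continuous_on UNIV f" "\<And>x. norm x > R \<Longrightarrow> f x = 0"
  shows "integrable lborel f"
proof -
  have "integrable lborel (\<lambda>x. indicator (cball 0 R) x *\<^sub>R f x)"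
    by (rule borel_integrable_compact) (auto intro: continuous_on_subset[OF f(1)])
  also have "(\<lambda>x. indicator (cball 0 R) x *\<^sub>R f x) = f"
    using f(2) by (auto simp: fun_eq_iff indicator_def dist_norm)
  finally show ?thesis .
qed

lemma compact_support_bounded:
  fixes f :: "real^'d \<Rightarrow> real"
  assumes f: "continuous_on UNIV f" "\<And>x. norm x > R \<Longrightarrow> f x = 0"
  obtains b where "b > 0" "\<And>x. \<bar>f x\<bar> \<le> b"
proof -
  have "compact (f ` cball 0 R)" by (intro compact_continuous_image continuous_on_subset[OF f(1)]) auto
  then obtain b where b: "b > 0" "\<And>x. x \<in> cball 0 R \<Longrightarrow> norm (f x) \<le> b"
    using compact_imp_bounded bounded_pos by (metis imageI)
  have "\<bar>f x\<bar> \<le> b" for x using b(1) b(2)[of x] f(2)[of x] by (cases "norm x \<le> R") (auto simp: dist_norm)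
  with b(1) that show ?thesis by blast
qed

text \<open>The Gaussian variable is split at norm n: beyond n the probability is below e / (4 b)
  and the difference at most 2 b, within n the shift \<sigma> z is so small that uniform continuity
  applies. Each part contributes at most e / 2.\<close>

lemma gauss_smooth_uniform:
  fixes f :: "real^'d \<Rightarrow> real"
  assumes f: "continuous_on UNIV f" "\<And>x. norm x > R \<Longrightarrow> f x = 0" and e: "e > 0"
  obtains \<sigma> where "\<sigma> > 0" "\<And>y. \<bar>gauss_smooth \<sigma> f y - f y\<bar> \<le> e"
proof -
  interpret G: prob_space "std_gauss :: (real^'d) measure" by (rule prob_space_std_gauss)
  have [measurable]: "f \<in> borel_measurable borel" using f(1) by (rule borel_measurable_continuous_onI)
  obtain b where b: "b > 0" "\<And>x. \<bar>f x\<bar> \<le> b" using compact_support_bounded[OF f] by blast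
  \<comment> \<open>The margin 1 handles pairs near the edge of the support: two points closer than
    1, one of them outside radius R + 1, both lie outside radius R, where f vanishes.\<close>
  have "uniformly_continuous_on (cball 0 (R + 1)) f"
    by (intro compact_uniformly_continuous continuous_on_subset[OF f(1)]) auto
  then obtain d where d: "d > 0" "\<And>x y. x \<in> cball 0 (R + 1) \<Longrightarrow> y \<in> cball 0 (R + 1) \<Longrightarrow> dist y x < d \<Longrightarrow> dist (f y) (f x) < e / 2"
    using e unfolding uniformly_continuous_on_def by (meson half_gt_zero)
  have uc: "\<bar>f y - f x\<bar> \<le> e / 2" if "norm (y - x) < min d 1" for x y
  proof (cases "norm x \<le> R + 1 \<and> norm y \<le> R + 1")
    case True
    then show ?thesis using d(2)[of x y] that by (auto simp: dist_norm dist_real_def)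
  next
    case False
    then have "norm x > R \<and> norm y > R"
      using that norm_triangle_ineq2[of x y] norm_triangle_ineq2[of y x] by (auto simp: norm_minus_commute)
    then show ?thesis using f(2) e by simp
  qed
  have "(\<lambda>n. measure std_gauss {z :: real^'d. norm z > real n}) \<longlonglongrightarrow> measure std_gauss (\<Inter>n. {z :: real^'d. norm z > real n})"
    by (rule G.finite_Lim_measure_decseq) (auto simp: decseq_def)
  moreover have "(\<Inter>n. {z :: real^'d. norm z > real n}) = {}"
    by auto (meson not_less real_arch_simple)
  ultimately have "(\<lambda>n. measure std_gauss {z :: real^'d. norm z > real n}) \<longlonglongrightarrow> 0" by simp
  then have "\<forall>\<^sub>F n in sequentially. measure std_gauss {z :: real^'d. norm z > real n} < e / (4 * b)"
    using e b(1) by (intro order_tendstoD) auto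
  then obtain n where n: "measure std_gauss {z :: real^'d. norm z > real n} < e / (4 * b)"
    by (auto simp: eventually_sequentially)
  \<comment> \<open>This scale gives |\<sigma> z| < min d 1 whenever |z| \<le> n, the range in which
    \<open>uc\<close> applies.\<close>
  define \<sigma> where "\<sigma> = min d 1 / (real n + 1)"
  have \<sigma>: "\<sigma> > 0" using d(1) by (simp add: \<sigma>_def)
  have "\<bar>gauss_smooth \<sigma> f y - f y\<bar> \<le> e" for y
  proof -
    let ?A = "{z :: real^'d. norm z > real n}"
    have pw: "norm (f (y + \<sigma> *\<^sub>R z) - f y) \<le> e / 2 + 2 * b * indicator ?A z" for z
    proof (cases "z \<in> ?A")
      case True
      then show ?thesis using b(2)[of "y + \<sigma> *\<^sub>R z"] b(2)[of y] e by auto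
    next
      case False
      have "norm (\<sigma> *\<^sub>R z) < min d 1"
      proof -
        have "\<sigma> * norm z \<le> \<sigma> * real n" using False \<sigma> by simp
        also have "\<dots> < \<sigma> * (real n + 1)" using \<sigma> by simp
        finally show ?thesis using \<sigma> d(1) by (simp add: \<sigma>_def)
      qed
      then show ?thesis using uc[of "y + \<sigma> *\<^sub>R z" y] False by simp
    qed
    have i2: "integrable std_gauss (\<lambda>z. f (y + \<sigma> *\<^sub>R z))"
      by (rule G.integrable_const_bound[of _ b]) (use b(2) in auto)
    then have i1: "integrable std_gauss (\<lambda>z. f (y + \<sigma> *\<^sub>R z) - f y)" by simp
    have i3: "integrable std_gauss (indicator ?A :: _ \<Rightarrow> real)"
      by (rule G.integrable_const_bound[of _ 1]) (auto simp: indicator_def)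
    have "gauss_smooth \<sigma> f y - f y = (\<integral>z. f (y + \<sigma> *\<^sub>R z) - f y \<partial>std_gauss)"
      unfolding gauss_smooth_def using i2 G.prob_space by simp
    also have "\<bar>\<dots>\<bar> \<le> (\<integral>z. norm (f (y + \<sigma> *\<^sub>R z) - f y) \<partial>std_gauss)"
      using integral_norm_bound[of std_gauss "\<lambda>z. f (y + \<sigma> *\<^sub>R z) - f y"] by simp
    also have "\<dots> \<le> (\<integral>z. e / 2 + 2 * b * indicator ?A z \<partial>std_gauss)"
      using i1 i3 pw by (intro integral_mono integrable_norm) simp_all
    also have "\<dots> = e / 2 + 2 * b * measure std_gauss ?A"
      using i3 G.prob_space by simp
    also have "\<dots> \<le> e" using n b(1) by (simp add: field_simps)
    finally show ?thesis .
  qed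
  with \<sigma> that show ?thesis by blast
qed

text \<open>Tightness is not an issue for compact support: f is integrable for Lebesgue measure, so
  the smoothed densities, bounded by 1 and pointwise convergent, can be integrated against f with
  |f| as dominating function. This settles the smoothed f, and f itself is uniformly close to it
  under every probability measure.\<close>

lemma levy_compact_support:
  fixes \<mu> :: "(real^'d) measure" and f :: "real^'d \<Rightarrow> real"
  assumes \<mu>n: "\<And>n. prob_space (\<mu>n n)" "\<And>n. sets (\<mu>n n) = sets borel"
    and \<mu>: "prob_space \<mu>" "sets \<mu> = sets borel"
    and ch: "\<And>u. (\<lambda>n. \<integral>y. iexp (u \<bullet> y) \<partial>\<mu>n n) \<longlonglongrightarrow> (\<integral>y. iexp (u \<bullet> y) \<partial>\<mu>)"
    and f: "continuous_on UNIV f" "\<And>x. norm x > R \<Longrightarrow> f x = 0"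
  shows "(\<lambda>n. \<integral>x. f x \<partial>\<mu>n n) \<longlonglongrightarrow> (\<integral>x. f x \<partial>\<mu>)"
proof -
  interpret G: prob_space "std_gauss :: (real^'d) measure" by (rule prob_space_std_gauss)
  have [measurable]: "f \<in> borel_measurable borel" using f(1) by (rule borel_measurable_continuous_onI)
  obtain b where b: "b > 0" "\<And>x. \<bar>f x\<bar> \<le> b" using compact_support_bounded[OF f] by blast
  have fint: "integrable lborel f" by (rule compact_support_integrable[OF f])
  have dens: "(\<lambda>n. \<integral>y. gauss_density ((x - y) /\<^sub>R \<sigma>) \<partial>\<mu>n n) \<longlonglongrightarrow> (\<integral>y. gauss_density ((x - y) /\<^sub>R \<sigma>) \<partial>\<mu>)" for x and \<sigma> :: real
  proof -
    have m: "(\<lambda>z. iexp (x \<bullet> z / \<sigma>) * (\<integral>y. iexp ((- (1 / \<sigma>) *\<^sub>R z) \<bullet> y) \<partial>\<nu>)) \<in> borel_measurable std_gauss"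
      if "prob_space \<nu>" "sets \<nu> = sets borel" for \<nu>
    proof -
      interpret prob_space \<nu> by fact
      note [measurable_cong] = that(2)
      show ?thesis by measurable
    qed
    have cb: "norm (\<integral>y. iexp (v \<bullet> y) \<partial>\<nu>) \<le> 1" if "prob_space \<nu>" "sets \<nu> = sets borel" for v \<nu>
    proof -
      interpret prob_space \<nu> by fact
      have "norm (\<integral>y. iexp (v \<bullet> y) \<partial>\<nu>) \<le> (\<integral>y. norm (iexp (v \<bullet> y)) \<partial>\<nu>)" by (rule integral_norm_bound)
      then show ?thesis by (simp add: prob_space)
    qed
    have "(\<lambda>n. complex_of_real (\<integral>y. gauss_density ((x - y) /\<^sub>R \<sigma>) \<partial>\<mu>n n)) \<longlonglongrightarrow>
        complex_of_real (\<integral>y. gauss_density ((x - y) /\<^sub>R \<sigma>) \<partial>\<mu>)"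
      unfolding gauss_smoothing_char[OF \<mu>n] gauss_smoothing_char[OF \<mu>]
    proof (intro tendsto_mult tendsto_const integral_dominated_convergence[where w = "\<lambda>_. 1"])
      show "AE z in std_gauss. norm (iexp (x \<bullet> z / \<sigma>) * (\<integral>y. iexp ((- (1 / \<sigma>) *\<^sub>R z) \<bullet> y) \<partial>\<mu>n n)) \<le> 1" for n
        using cb[OF \<mu>n] by (intro AE_I2) (simp only: norm_mult norm_exp_i_times mult_1_left)
      show "AE z in std_gauss. (\<lambda>n. iexp (x \<bullet> z / \<sigma>) * (\<integral>y. iexp ((- (1 / \<sigma>) *\<^sub>R z) \<bullet> y) \<partial>\<mu>n n)) \<longlonglongrightarrow>
         iexp (x \<bullet> z / \<sigma>) * (\<integral>y. iexp ((- (1 / \<sigma>) *\<^sub>R z) \<bullet> y) \<partial>\<mu>)"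
        by (intro AE_I2 tendsto_mult tendsto_const ch)
    qed (use m[OF \<mu>n] m[OF \<mu>] in auto)
    then show ?thesis by (simp only: tendsto_of_real_iff)
  qed
  have smooth_eq: "(\<integral>y. gauss_smooth \<sigma> f y \<partial>\<nu>) = (\<integral>x. f x * (\<integral>y. gauss_density ((x - y) /\<^sub>R \<sigma>) \<partial>\<nu>) \<partial>lborel) / \<sigma> ^ CARD('d)"
    if \<sigma>: "\<sigma> > 0" and \<nu>: "prob_space \<nu>" "sets \<nu> = sets borel" for \<sigma> \<nu>
  proof -
    interpret N: prob_space \<nu> by fact
    interpret pair_sigma_finite "lborel :: (real^'d) measure" \<nu> ..
    note [measurable_cong] = \<nu>(2)
    have "integrable (lborel \<Otimes>\<^sub>M \<nu>) (\<lambda>(x, y). f x * gauss_density ((x - y) /\<^sub>R \<sigma>))"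
    proof (rule Bochner_Integration.integrable_bound)
      show "integrable (lborel \<Otimes>\<^sub>M \<nu>) (\<lambda>p. f (fst p))"
      proof (rule integrableI_bounded)
        have "(\<integral>\<^sup>+ p. ennreal (norm (f (fst p))) \<partial>(lborel \<Otimes>\<^sub>M \<nu>)) = (\<integral>\<^sup>+ x. (\<integral>\<^sup>+ y. ennreal (norm (f x)) \<partial>\<nu>) \<partial>lborel)"
          by (subst N.nn_integral_fst[symmetric]) simp_all
        also have "\<dots> = (\<integral>\<^sup>+ x. ennreal (norm (f x)) \<partial>lborel)" by (simp add: N.emeasure_space_1)
        also have "\<dots> < \<infinity>" using fint by (simp add: integrable_iff_bounded)
        finally show "(\<integral>\<^sup>+ p. ennreal (norm (f (fst p))) \<partial>(lborel \<Otimes>\<^sub>M \<nu>)) < \<infinity>" .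
      qed measurable
      show "AE p in lborel \<Otimes>\<^sub>M \<nu>. norm (case p of (x, y) \<Rightarrow> f x * gauss_density ((x - y) /\<^sub>R \<sigma>)) \<le> norm (f (fst p))"
        by (rule AE_I2) (auto simp: abs_mult gauss_density_bounds[unfolded real_norm_def] mult_left_le split: prod.split)
    qed measurable
    from Fubini_integral[OF this] show ?thesis
      by (simp add: gauss_smooth_lborel[OF \<sigma> \<open>f \<in> borel_measurable borel\<close>])
  qed
  have smooth: "(\<lambda>n. \<integral>y. gauss_smooth \<sigma> f y \<partial>\<mu>n n) \<longlonglongrightarrow> (\<integral>y. gauss_smooth \<sigma> f y \<partial>\<mu>)" if \<sigma>: "\<sigma> > 0" for \<sigma>
    unfolding smooth_eq[OF \<sigma> \<mu>n] smooth_eq[OF \<sigma> \<mu>]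
  proof (intro tendsto_divide tendsto_const integral_dominated_convergence[where w = "\<lambda>x. \<bar>f x\<bar>"])
    have m: "(\<lambda>x. f x * (\<integral>y. gauss_density ((x - y) /\<^sub>R \<sigma>) \<partial>\<nu>)) \<in> borel_measurable lborel"
      if "prob_space \<nu>" "sets \<nu> = sets borel" for \<nu>
    proof -
      interpret prob_space \<nu> by fact
      note [measurable_cong] = that(2)
      show ?thesis by measurable
    qed
    show "(\<lambda>x. f x * (\<integral>y. gauss_density ((x - y) /\<^sub>R \<sigma>) \<partial>\<mu>n n)) \<in> borel_measurable lborel" for n by (rule m[OF \<mu>n])
    show "(\<lambda>x. f x * (\<integral>y. gauss_density ((x - y) /\<^sub>R \<sigma>) \<partial>\<mu>)) \<in> borel_measurable lborel" by (rule m[OF \<mu>])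
    show "AE x in lborel. (\<lambda>n. f x * (\<integral>y. gauss_density ((x - y) /\<^sub>R \<sigma>) \<partial>\<mu>n n)) \<longlonglongrightarrow> f x * (\<integral>y. gauss_density ((x - y) /\<^sub>R \<sigma>) \<partial>\<mu>)"
      by (intro AE_I2 tendsto_mult tendsto_const dens)
    show "AE x in lborel. norm (f x * (\<integral>y. gauss_density ((x - y) /\<^sub>R \<sigma>) \<partial>\<mu>n n)) \<le> \<bar>f x\<bar>" for n
    proof (rule AE_I2)
      fix x
      interpret prob_space "\<mu>n n" by (rule \<mu>n)
      have "norm (\<integral>y. gauss_density ((x - y) /\<^sub>R \<sigma>) \<partial>\<mu>n n) \<le> (\<integral>y. 1 \<partial>\<mu>n n)"
      proof (rule norm_integral_le_integral)
        show "integrable (\<mu>n n) (\<lambda>y. gauss_density ((x - y) /\<^sub>R \<sigma>))"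
          by (rule integrable_const_bound[of _ 1], rule AE_I2, rule gauss_density_bounds(2))
            (simp add: measurable_cong_sets[OF \<mu>n(2) refl])
      qed (use gauss_density_bounds(2) in auto)
      then show "norm (f x * (\<integral>y. gauss_density ((x - y) /\<^sub>R \<sigma>) \<partial>\<mu>n n)) \<le> \<bar>f x\<bar>"
        by (simp add: abs_mult prob_space mult_left_le)
    qed
    show "integrable lborel (\<lambda>x. \<bar>f x\<bar>)" using fint by simp
    show "\<sigma> ^ CARD('d) \<noteq> 0" using \<sigma> by simp
  qed
  show ?thesis
  proof (rule LIMSEQ_I)
    fix r :: real assume r: "r > 0"
    obtain \<sigma> where \<sigma>: "\<sigma> > 0" "\<And>y. \<bar>gauss_smooth \<sigma> f y - f y\<bar> \<le> r / 4"
      using gauss_smooth_uniform[OF f, where e = "r / 4"] r by auto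
    have close: "\<bar>(\<integral>y. gauss_smooth \<sigma> f y \<partial>\<nu>) - (\<integral>y. f y \<partial>\<nu>)\<bar> \<le> r / 4"
      if \<nu>: "prob_space \<nu>" "sets \<nu> = sets borel" for \<nu>
    proof -
      interpret prob_space \<nu> by fact
      note [measurable_cong] = \<nu>(2)
      have [measurable]: "gauss_smooth \<sigma> f \<in> borel_measurable borel"
        unfolding gauss_smooth_def[abs_def] by measurable
      have i1: "integrable \<nu> f" by (rule integrable_const_bound[of _ b]) (use b in auto)
      have i2: "integrable \<nu> (gauss_smooth \<sigma> f)"
      proof (rule integrable_const_bound[of _ "b + r / 4"])
        show "AE x in \<nu>. norm (gauss_smooth \<sigma> f x) \<le> b + r / 4"
        proof (rule AE_I2)
          fix x show "norm (gauss_smooth \<sigma> f x) \<le> b + r / 4" using b(2)[of x] \<sigma>(2)[of x] unfolding real_norm_def by linarith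
        qed
      qed measurable
      have "\<bar>\<integral>y. gauss_smooth \<sigma> f y - f y \<partial>\<nu>\<bar> \<le> (\<integral>y. r / 4 \<partial>\<nu>)"
        using norm_integral_le_integral[of \<nu> "\<lambda>y. gauss_smooth \<sigma> f y - f y" "\<lambda>_. r / 4"] i1 i2 \<sigma>(2) by simp
      then show ?thesis using i1 i2 by (simp add: prob_space)
    qed
    from LIMSEQ_D[OF smooth[OF \<sigma>(1)], of "r / 4"] r obtain N where
      N: "\<And>n. n \<ge> N \<Longrightarrow> norm ((\<integral>y. gauss_smooth \<sigma> f y \<partial>\<mu>n n) - (\<integral>y. gauss_smooth \<sigma> f y \<partial>\<mu>)) < r / 4" by auto
    have "norm ((\<integral>y. f y \<partial>\<mu>n n) - (\<integral>y. f y \<partial>\<mu>)) < r" if "n \<ge> N" for n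
      using N[OF that] close[OF \<mu>n, of n] close[OF \<mu>] r unfolding real_norm_def by linarith
    then show "\<exists>N. \<forall>n\<ge>N. norm ((\<integral>y. f y \<partial>\<mu>n n) - (\<integral>y. f y \<partial>\<mu>)) < r" by blast
  qed
qed

text \<open>The limit is assumed to be a probability measure, so no mass can escape: a compactly
  supported cutoff with nearly full mass under \<mu> has nearly full mass under the later \<mu>n by
  the compact case. The bounded test function is therefore replaced by its product with the
  cutoff.\<close>

theorem levy_continuity_vec:
  fixes \<mu> :: "(real^'d) measure"
  assumes \<mu>n: "\<And>n. prob_space (\<mu>n n)" "\<And>n. sets (\<mu>n n) = sets borel"
    and \<mu>: "prob_space \<mu>" "sets \<mu> = sets borel"
    and ch: "\<And>u. (\<lambda>n. \<integral>y. iexp (u \<bullet> y) \<partial>\<mu>n n) \<longlonglongrightarrow> (\<integral>y. iexp (u \<bullet> y) \<partial>\<mu>)"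
  shows "weak_conv_vec \<mu>n \<mu>"
  unfolding weak_conv_vec_def
proof (intro allI impI, elim conjE)
  fix f :: "real^'d \<Rightarrow> real" assume f: "continuous_on UNIV f" "bounded (range f)"
  have fm[measurable]: "f \<in> borel_measurable borel" using f(1) by (rule borel_measurable_continuous_onI)
  obtain b where b: "b > 0" "\<And>x. \<bar>f x\<bar> \<le> b" using f(2) unfolding bounded_pos by auto
  interpret M: prob_space \<mu> by fact
  \<comment> \<open>A continuous cutoff, equal to 1 up to radius R and to 0 beyond R + 1.\<close>
  define \<kappa> :: "nat \<Rightarrow> real^'d \<Rightarrow> real" where "\<kappa> R x = max 0 (min 1 (real R + 1 - norm x))" for R x
  have \<kappa>c: "continuous_on UNIV (\<kappa> R)" for R unfolding \<kappa>_def by (intro continuous_intros)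
  have \<kappa>m[measurable]: "\<kappa> R \<in> borel_measurable borel" for R by (rule borel_measurable_continuous_onI[OF \<kappa>c])
  have \<kappa>b: "0 \<le> \<kappa> R x" "\<kappa> R x \<le> 1" for R x by (auto simp: \<kappa>_def)
  have \<kappa>z: "norm x > real R + 1 \<Longrightarrow> \<kappa> R x = 0" for R x by (auto simp: \<kappa>_def)
  note levy = levy_compact_support[OF \<mu>n \<mu> ch]
  have intb: "integrable \<nu> h" if "prob_space \<nu>" "sets \<nu> = sets borel" "h \<in> borel_measurable borel" "\<And>x. \<bar>h x\<bar> \<le> c" for \<nu> and h :: "real^'d \<Rightarrow> real" and c
  proof -
    interpret prob_space \<nu> by fact
    show ?thesis by (rule integrable_const_bound[of _ c]) (use that in \<open>auto simp: measurable_cong_sets[OF that(2) refl]\<close>)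
  qed
  have "(\<lambda>R. \<integral>x. \<kappa> R x \<partial>\<mu>) \<longlonglongrightarrow> (\<integral>x. 1 \<partial>\<mu>)"
  proof (rule integral_dominated_convergence[where w = "\<lambda>_. 1"])
    show "AE x in \<mu>. (\<lambda>R. \<kappa> R x) \<longlonglongrightarrow> 1"
    proof (rule AE_I2)
      fix x
      have "\<forall>\<^sub>F R in sequentially. \<kappa> R x = 1"
        using eventually_ge_at_top[of "nat \<lceil>norm x\<rceil>"] by eventually_elim (auto simp: \<kappa>_def nat_ceiling_le_eq)
      then show "(\<lambda>R. \<kappa> R x) \<longlonglongrightarrow> 1" by (rule tendsto_eventually)
    qed
  qed (use \<kappa>b \<mu>(2) in \<open>auto simp: measurable_cong_sets[OF \<mu>(2) refl]\<close>)
  then have lim1: "(\<lambda>R. \<integral>x. \<kappa> R x \<partial>\<mu>) \<longlonglongrightarrow> 1" by (simp add: M.prob_space)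
  show "(\<lambda>n. \<integral>x. f x \<partial>\<mu>n n) \<longlonglongrightarrow> (\<integral>x. f x \<partial>\<mu>)"
  proof (rule LIMSEQ_I)
    fix r :: real assume r: "r > 0"
    \<comment> \<open>The mass lost through the cutoff is kept below e under the later \<mu>n and
      below e / 2 under \<mu>. Multiplied by the bound b, either loss stays below r / 4; the
      convergence for the truncated function takes another r / 4.\<close>
    define e where "e = r / (4 * b)"
    have e: "e > 0" using r b by (simp add: e_def)
    from LIMSEQ_D[OF lim1, of "e / 2"] e obtain R where R: "norm ((\<integral>x. \<kappa> R x \<partial>\<mu>) - 1) < e / 2" by auto
    let ?h = "\<lambda>x. f x * \<kappa> R x"
    have "(\<lambda>n. \<integral>x. \<kappa> R x \<partial>\<mu>n n) \<longlonglongrightarrow> (\<integral>x. \<kappa> R x \<partial>\<mu>)"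
      by (rule levy[OF \<kappa>c \<kappa>z])
    from LIMSEQ_D[OF this, of "e / 2"] e obtain N1 where
      N1: "\<And>n. n \<ge> N1 \<Longrightarrow> norm ((\<integral>x. \<kappa> R x \<partial>\<mu>n n) - (\<integral>x. \<kappa> R x \<partial>\<mu>)) < e / 2" by auto
    have "(\<lambda>n. \<integral>x. ?h x \<partial>\<mu>n n) \<longlonglongrightarrow> (\<integral>x. ?h x \<partial>\<mu>)"
      by (rule levy[of _ "real R + 1"]) (auto intro!: continuous_intros f(1) \<kappa>c simp: \<kappa>z)
    from LIMSEQ_D[OF this, of "r / 4"] r obtain N2 where
      N2: "\<And>n. n \<ge> N2 \<Longrightarrow> norm ((\<integral>x. ?h x \<partial>\<mu>n n) - (\<integral>x. ?h x \<partial>\<mu>)) < r / 4" by auto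
    have close: "\<bar>(\<integral>x. f x \<partial>\<nu>) - (\<integral>x. ?h x \<partial>\<nu>)\<bar> \<le> b * (1 - (\<integral>x. \<kappa> R x \<partial>\<nu>))"
      if \<nu>: "prob_space \<nu>" "sets \<nu> = sets borel" for \<nu>
    proof -
      interpret prob_space \<nu> by fact
      have i1: "integrable \<nu> f" by (rule intb[OF \<nu> fm b(2)])
      have i2: "integrable \<nu> ?h"
      proof (rule intb[OF \<nu>])
        show "\<bar>?h x\<bar> \<le> b" for x
          using mult_mono[OF b(2)[of x] \<kappa>b(2)[of R x]] \<kappa>b[of R x] b(1) by (simp add: abs_mult)
      qed measurable
      have i3: "integrable \<nu> (\<kappa> R)" by (rule intb[OF \<nu> \<kappa>m, of _ 1]) (use \<kappa>b in auto)
      have "\<bar>\<integral>x. f x - ?h x \<partial>\<nu>\<bar> \<le> (\<integral>x. b * (1 - \<kappa> R x) \<partial>\<nu>)"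
        unfolding real_norm_def[symmetric]
      proof (rule norm_integral_le_integral)
        fix x
        have "f x - ?h x = f x * (1 - \<kappa> R x)" by (simp add: algebra_simps)
        then show "norm (f x - ?h x) \<le> b * (1 - \<kappa> R x)"
          using \<kappa>b(2)[of R x] b(2)[of x] by (simp add: abs_mult mult_right_mono)
      qed (use i1 i2 i3 in auto)
      then show ?thesis using i1 i2 i3 by (simp add: prob_space)
    qed
    have "norm ((\<integral>x. f x \<partial>\<mu>n n) - (\<integral>x. f x \<partial>\<mu>)) < r" if n: "n \<ge> max N1 N2" for n
    proof -
      have "b * (1 - (\<integral>x. \<kappa> R x \<partial>\<mu>n n)) < b * e" "b * (1 - (\<integral>x. \<kappa> R x \<partial>\<mu>)) < b * (e / 2)"
        using R N1[of n] n b(1) unfolding real_norm_def by (intro mult_strict_left_mono; linarith)+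
      then have "b * (1 - (\<integral>x. \<kappa> R x \<partial>\<mu>n n)) < r / 4" "b * (1 - (\<integral>x. \<kappa> R x \<partial>\<mu>)) < r / 4"
        using b(1) r by (auto simp: e_def)
      then show ?thesis using close[OF \<mu>n, of n] close[OF \<mu>] N2[of n] n r
        unfolding real_norm_def by linarith
    qed
    then show "\<exists>N. \<forall>n\<ge>N. norm ((\<integral>x. f x \<partial>\<mu>n n) - (\<integral>x. f x \<partial>\<mu>)) < r" by blast
  qed
qed

section \<open>Centred normal laws with a given covariance\<close>

lemma matrix_vector_mult_measurable:
  fixes A :: "real^'d^'d"
  shows "(\<lambda>z. A *v z) \<in> borel_measurable borel"
  by (intro borel_measurable_continuous_onI linear_continuous_on matrix_vector_mul_bounded_linear)

lemma prob_space_normal_vec: "prob_space (normal_vec \<Sigma>)" "sets (normal_vec \<Sigma>) = sets borel"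
proof -
  interpret prob_space std_gauss by (rule prob_space_std_gauss)
  show "prob_space (normal_vec \<Sigma>)" unfolding normal_vec_def
    by (rule prob_space_distr) (simp add: measurable_cong_sets[OF sets_std_gauss refl] matrix_vector_mult_measurable)
qed (simp add: normal_vec_def)

lemma integral_normal_vec:
  fixes f :: "real^'d \<Rightarrow> 'b::{banach, second_countable_topology}"
  assumes "f \<in> borel_measurable borel"
  shows "(\<integral>y. f y \<partial>normal_vec \<Sigma>) = (\<integral>z. f (matrix_sqrt \<Sigma> *v z) \<partial>std_gauss)"
  unfolding normal_vec_def
  by (rule integral_distr) (use assms in \<open>simp_all add: measurable_cong_sets[OF sets_std_gauss refl] matrix_vector_mult_measurable\<close>)

lemma char_normal_vec:
  fixes A :: "real^'d^'d"
  assumes A: "transpose A = A" and psd: "\<And>x. 0 \<le> x \<bullet> (A *v x)"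
  shows "(\<integral>y. iexp (u \<bullet> y) \<partial>normal_vec A) = complex_of_real (exp (- (u \<bullet> (A *v u)) / 2))"
proof -
  let ?B = "matrix_sqrt A"
  note B = matrix_sqrt_props[OF A psd]
  have "(\<integral>y. iexp (u \<bullet> y) \<partial>normal_vec A) = (\<integral>z. iexp ((?B *v u) \<bullet> z) \<partial>std_gauss)"
    by (subst integral_normal_vec) (simp_all only: symmetric_inner[OF B(1)], measurable)
  also have "\<dots> = complex_of_real (exp (- (norm (?B *v u))\<^sup>2 / 2))" by (rule char_std_gauss)
  also have "(norm (?B *v u))\<^sup>2 = u \<bullet> (A *v u)"
    unfolding power2_norm_eq_inner using symmetric_inner[OF B(1), of u "?B *v u"] B(2)
    by (simp add: matrix_vector_mul_assoc)
  finally show ?thesis .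
qed

section \<open>Autoregression at a fixed parameter\<close>

text \<open>Integrating \<open>G (x + 1) - G x\<close> over \<open>x\<close> and exchanging the integrals avoids limits at infinity.\<close>

lemma integral_derivative_eq_0:
  fixes G k :: "real \<Rightarrow> real"
  assumes G: "\<And>x. (G has_real_derivative k x) (at x)" and k: "\<And>x. isCont k x"
    and iG: "integrable lborel G" and ik: "integrable lborel k"
  shows "(\<integral>x. k x \<partial>lborel) = 0"
proof -
  have km[measurable]: "k \<in> borel_measurable borel" using ik by auto
  let ?f = "\<lambda>x t. k (x + t) * indicator {0..1} t :: real"
  have shift: "(\<integral>x. F (x + t) \<partial>lborel) = (\<integral>x. F x \<partial>lborel)" for F :: "real \<Rightarrow> real" and t
    using lborel_integral_real_affine[of 1 F t] by (simp add: add.commute)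
  have nshift: "(\<integral>\<^sup>+x. ennreal \<bar>k (x + t)\<bar> \<partial>lborel) = (\<integral>\<^sup>+x. ennreal \<bar>k x\<bar> \<partial>lborel)" for t
    using nn_integral_real_affine[of "\<lambda>x. ennreal \<bar>k x\<bar>" 1 t] by (simp add: add.commute)
  have int: "integrable (lborel \<Otimes>\<^sub>M lborel) (\<lambda>(x, t). ?f x t)"
  proof (rule integrableI_bounded)
    have "(\<integral>\<^sup>+p. ennreal (norm (case p of (x, t) \<Rightarrow> ?f x t)) \<partial>(lborel \<Otimes>\<^sub>M lborel)) =
        (\<integral>\<^sup>+t. (\<integral>\<^sup>+x. ennreal \<bar>k (x + t)\<bar> * indicator {0..1} t \<partial>lborel) \<partial>lborel)"
      by (subst lborel_pair.nn_integral_snd[symmetric]) (auto simp: abs_mult ennreal_mult ennreal_indicator)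
    also have "\<dots> = (\<integral>\<^sup>+t. (\<integral>\<^sup>+x. ennreal \<bar>k x\<bar> \<partial>lborel) * indicator {0..1} t \<partial>(lborel :: real measure))"
      by (simp add: nn_integral_multc nshift)
    also have "\<dots> = (\<integral>\<^sup>+x. ennreal \<bar>k x\<bar> \<partial>lborel)" by (simp add: nn_integral_cmult_indicator)
    also have "\<dots> < \<infinity>" using ik by (simp add: integrable_iff_bounded)
    finally show "(\<integral>\<^sup>+p. ennreal (norm (case p of (x, t) \<Rightarrow> ?f x t)) \<partial>(lborel \<Otimes>\<^sub>M lborel)) < \<infinity>" .
  qed measurable
  have "(\<integral>t. (\<integral>x. ?f x t \<partial>lborel) \<partial>lborel) = (\<integral>t. (\<integral>x. k x \<partial>lborel) * indicator {0..1} t \<partial>(lborel :: real measure))"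
    by (simp add: shift)
  also have "\<dots> = (\<integral>x. k x \<partial>lborel)" by (simp add: content_real)
  finally have 1: "(\<integral>t. (\<integral>x. ?f x t \<partial>lborel) \<partial>lborel) = (\<integral>x. k x \<partial>lborel)" .
  have "(\<integral>x. (\<integral>t. ?f x t \<partial>lborel) \<partial>lborel) = (\<integral>x. G (x + 1) - G x \<partial>lborel)"
  proof (rule Bochner_Integration.integral_cong[OF refl])
    fix x :: real
    have "(\<integral>t. ?f x t \<partial>lborel) = (\<lambda>t. G (x + t)) 1 - (\<lambda>t. G (x + t)) 0"
    proof (rule integral_FTC_Icc_real)
      fix t :: real
      show "((\<lambda>t. G (x + t)) has_real_derivative k (x + t)) (at t)"
        using DERIV_shift[of G "k (x + t)" t x] G[of "t + x"] by (simp add: add.commute)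
      show "isCont (\<lambda>t. k (x + t)) t" by (rule continuous_within_compose3[OF k]) (intro continuous_intros)
    qed simp
    then show "(\<integral>t. ?f x t \<partial>lborel) = G (x + 1) - G x" by simp
  qed
  also have "\<dots> = 0"
    using iG lborel_integrable_real_affine[OF iG, of 1 1] shift[of G 1] by (simp add: add.commute)
  finally show ?thesis using 1 lborel_pair.Fubini_integral[OF int] by simp
qed

lemma le_one_plus_square: "y \<le> 1 + y\<^sup>2" for y :: real
proof -
  have "2 * y \<le> 1 + y\<^sup>2" using zero_le_power2[of "y - 1"] by (simp add: power2_diff)
  moreover have "0 \<le> y\<^sup>2" by simp
  ultimately show ?thesis by linarith
qed

lemma square_integrable_imp:
  fixes f :: "'a \<Rightarrow> real"
  assumes "finite_measure N" "f \<in> borel_measurable N" "integrable N (\<lambda>x. (f x)\<^sup>2)"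
  shows "integrable N f"
proof (rule Bochner_Integration.integrable_bound)
  interpret finite_measure N by fact
  show "integrable N (\<lambda>x. 1 + (f x)\<^sup>2)" using assms(3) by simp
  have "\<bar>y\<bar> \<le> \<bar>1 + y\<^sup>2\<bar>" for y :: real
    using le_one_plus_square[of "\<bar>y\<bar>"] by simp
  then show "AE x in N. norm (f x) \<le> norm (1 + (f x)\<^sup>2)" by simp
qed fact

text \<open>The model under one law. The regression function is a plain function s, so that every
  estimate below can be used under each law of a sequence of parameters without carrying the
  parameter along.\<close>

locale ar_law = prob_space M for M :: "'w measure" +
  fixes X :: "nat \<Rightarrow> 'w \<Rightarrow> real" and s g :: "real \<Rightarrow> real"
  assumes X_meas[measurable]: "\<And>j. X j \<in> borel_measurable M"
    and s_meas[measurable]: "s \<in> borel_measurable borel"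
    and indep: "indep_vars (\<lambda>_. borel) (\<lambda>j w. if j = 0 then X 0 w else X j w - s (X (j - 1) w)) UNIV"
    and noise: "\<And>j. j \<ge> 1 \<Longrightarrow> distributed M lborel (\<lambda>w. X j w - s (X (j - 1) w)) (\<lambda>e. ennreal (g e))"
    and g_pos: "\<And>x. g x > 0" and g_C3: "C3_real g"
begin

definition eps :: "nat \<Rightarrow> 'w \<Rightarrow> real" where "eps j w = X j w - s (X (j - 1) w)"

definition past :: "nat \<Rightarrow> 'w \<Rightarrow> nat \<Rightarrow> real" where "past j w = (\<lambda>i\<in>{..j}. X i w)"

text \<open>The history up to time j, encoded as preimages under the single map
  \<open>past j\<close>; independence of blocks of coordinates can then be transferred to it
  directly.\<close>

definition F :: "nat \<Rightarrow> 'w measure" where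
  "F j = vimage_algebra (space M) (past j) (PiM {..j} (\<lambda>_. borel))"

text \<open>The noise law. Its definition involves g alone, so it is literally the same measure for
  every parameter, and constants derived from it are automatically uniform.\<close>

definition \<nu> :: "real measure" where "\<nu> = density lborel (\<lambda>e. ennreal (g e))"

lemma eps_meas[measurable]: "eps j \<in> borel_measurable M"
  unfolding eps_def[abs_def] by measurable

lemma space_F[simp]: "space (F j) = space M" by (simp add: F_def)

lemma past_meas[measurable]: "past j \<in> measurable M (PiM {..j} (\<lambda>_. borel))"
  unfolding past_def[abs_def] by measurable

lemma X_F: "i \<le> j \<Longrightarrow> X i \<in> borel_measurable (F j)"
proof -
  assume "i \<le> j"
  have "past j \<in> measurable (F j) (PiM {..j} (\<lambda>_. borel))" unfolding F_def
    by (rule measurable_vimage_algebra1) (auto simp: past_def space_PiM)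
  then have "(\<lambda>w. past j w i) \<in> borel_measurable (F j)"
    by (rule measurable_compose) (use \<open>i \<le> j\<close> in \<open>auto intro: measurable_component_singleton\<close>)
  then show ?thesis using \<open>i \<le> j\<close> by (simp add: past_def)
qed

lemma sets_F: "sets (F j) = {past j -` A \<inter> space M | A. A \<in> sets (PiM {..j} (\<lambda>_. borel))}"
  unfolding F_def by (rule sets_vimage_algebra2) (auto simp: past_def space_PiM)

lemma measurable_F: "Y \<in> measurable (F j) N \<Longrightarrow> Y \<in> measurable M N"
proof -
  have "sets (F j) \<subseteq> sets M" using measurable_sets[OF past_meas] by (auto simp: sets_F)
  then show "Y \<in> measurable (F j) N \<Longrightarrow> Y \<in> measurable M N" by (auto simp: measurable_def)
qed

text \<open>Solves the recursion backwards: from the initial state and the innovations it recovers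
  the states, so that the past is a measurable function of the independent variables in the
  hypothesis \<open>indep\<close>.\<close>

primrec traj :: "(nat \<Rightarrow> real) \<Rightarrow> nat \<Rightarrow> real" where
  "traj z 0 = z 0"
| "traj z (Suc n) = z (Suc n) + s (traj z n)"

lemma traj_measurable: "i \<le> j \<Longrightarrow> (\<lambda>z. traj z i) \<in> borel_measurable (PiM {..j} (\<lambda>_. borel))"
proof (induction i)
  case (Suc i)
  then have [measurable]: "(\<lambda>z. traj z i) \<in> borel_measurable (PiM {..j} (\<lambda>_. borel))" by simp
  have [measurable]: "(\<lambda>z. z (Suc i)) \<in> borel_measurable (PiM {..j} (\<lambda>_. borel))"
    using Suc(2) by (intro measurable_component_singleton) auto
  show ?case by simp
qed (auto intro: measurable_component_singleton)

text \<open>The past up to j - 1 is the image under \<open>traj\<close> of the initial state and the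
  innovations up to j - 1, and this block is independent of the innovation j.\<close>

lemma prob_F_eps:
  assumes A: "A \<in> sets (F (j - 1))" and B: "B \<in> sets borel" and j: "j \<ge> 1"
  shows "prob (A \<inter> (eps j -` B \<inter> space M)) = prob A * prob (eps j -` B \<inter> space M)"
proof -
  define i where "i = j - 1"
  have ji: "j = Suc i" using j by (simp add: i_def)
  define \<zeta> where "\<zeta> = (\<lambda>w n. if n = 0 then X 0 w else X n w - s (X (n - 1) w))"
  let ?E = "\<lambda>w. restrict (\<zeta> w) {Suc i}"
  have "indep_var (PiM {..i} (\<lambda>_. borel)) (\<lambda>w. restrict (\<zeta> w) {..i}) (PiM {Suc i} (\<lambda>_. borel)) ?E"
    using indep_var_restrict[OF indep, of "{..i}" "{Suc i}"] by (simp add: \<zeta>_def)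
  then have "indep_var (PiM {..i} (\<lambda>_. borel)) ((\<lambda>z. \<lambda>n\<in>{..i}. traj z n) \<circ> (\<lambda>w. restrict (\<zeta> w) {..i}))
      (PiM {Suc i} (\<lambda>_. borel)) ((\<lambda>z. z) \<circ> ?E)"
    by (rule indep_var_compose) (auto intro!: measurable_restrict traj_measurable)
  moreover have "traj (restrict (\<zeta> w) {..i}) n = X n w" if "n \<le> i" for w n
    using that by (induction n) (auto simp: \<zeta>_def)
  then have "(\<lambda>z. \<lambda>n\<in>{..i}. traj z n) \<circ> (\<lambda>w. restrict (\<zeta> w) {..i}) = past i"
    by (auto simp: past_def fun_eq_iff)
  ultimately have ind: "indep_var (PiM {..i} (\<lambda>_. borel)) (past i) (PiM {Suc i} (\<lambda>_. borel)) ?E"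
    by (simp add: o_def)
  obtain A' where A': "A = past i -` A' \<inter> space M" "A' \<in> sets (PiM {..i} (\<lambda>_. borel))"
    using A by (auto simp: sets_F ji)
  define B' where "B' = {z \<in> space (PiM {Suc i} (\<lambda>_. borel :: real measure)). z (Suc i) \<in> B}"
  have "B' \<in> sets (PiM {Suc i} (\<lambda>_. borel))"
    unfolding B'_def using B by measurable
  moreover have E: "?E -` B' \<inter> space M = eps j -` B \<inter> space M"
    by (auto simp: B'_def \<zeta>_def eps_def ji space_PiM)
  moreover have "(\<lambda>w. (past i w, ?E w)) -` (A' \<times> B') \<inter> space M = A \<inter> (eps j -` B \<inter> space M)"
    unfolding E[symmetric] A'(1) by auto
  ultimately show ?thesis
    using indep_varD[OF ind A'(2), of B'] A'(1) by simp
qed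

lemma distr_F_eps:
  fixes Y :: "'w \<Rightarrow> 'b::topological_space"
  assumes Y: "Y \<in> borel_measurable (F (j - 1))" and j: "j \<ge> 1"
  shows "distr M borel Y \<Otimes>\<^sub>M distr M borel (eps j) = distr M (borel \<Otimes>\<^sub>M borel) (\<lambda>w. (Y w, eps j w))"
proof (rule pair_measure_eqI)
  note Ym[measurable] = measurable_F[OF Y]
  interpret D1: prob_space "distr M borel Y" by (rule prob_space_distr[OF Ym])
  interpret D2: prob_space "distr M borel (eps j)" by (rule prob_space_distr) simp
  show "sigma_finite_measure (distr M borel Y)" "sigma_finite_measure (distr M borel (eps j))"
    by unfold_locales
  fix A :: "'b set" and B :: "real set" assume "A \<in> sets (distr M borel Y)" "B \<in> sets (distr M borel (eps j))"
  then have AB[measurable]: "A \<in> sets borel" "B \<in> sets borel" by auto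
  have "Y -` A \<inter> space M \<in> sets (F (j - 1))" using measurable_sets[OF Y AB(1)] by simp
  have eqI: "(\<lambda>w. (Y w, eps j w)) -` (A \<times> B) \<inter> space M = (Y -` A \<inter> space M) \<inter> (eps j -` B \<inter> space M)"
    by auto
  from prob_F_eps[OF \<open>Y -` A \<inter> space M \<in> sets (F (j - 1))\<close> AB(2) j]
  have "prob ((\<lambda>w. (Y w, eps j w)) -` (A \<times> B) \<inter> space M) = prob (Y -` A \<inter> space M) * prob (eps j -` B \<inter> space M)"
    by (simp only: eqI)
  then show "emeasure (distr M borel Y) A * emeasure (distr M borel (eps j)) B =
      emeasure (distr M (borel \<Otimes>\<^sub>M borel) (\<lambda>w. (Y w, eps j w))) (A \<times> B)"
    by (simp add: emeasure_distr emeasure_eq_measure ennreal_mult)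
qed simp

lemma indep_F_eps:
  fixes Y :: "'w \<Rightarrow> real"
  assumes Y: "Y \<in> borel_measurable (F (j - 1))" and j: "j \<ge> 1"
  shows "indep_var borel Y borel (eps j)"
  unfolding indep_var_distribution_eq
proof (intro conjI)
  show "distr M borel Y \<Otimes>\<^sub>M distr M borel (eps j) = distr M (borel \<Otimes>\<^sub>M borel) (\<lambda>x. (Y x, eps j x))"
    by (rule distr_F_eps[OF Y j])
qed (use measurable_F[OF Y] in auto)

lemma distr_eps: "j \<ge> 1 \<Longrightarrow> distr M borel (eps j) = \<nu>"
proof -
  assume j: "j \<ge> 1"
  have "distr M lborel (eps j) = \<nu>"
    using noise[OF j] unfolding distributed_def \<nu>_def eps_def[abs_def] by simp
  then show ?thesis by (metis distr_cong sets_lborel)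
qed

lemma sets_\<nu>[simp, measurable_cong]: "sets \<nu> = sets borel" by (simp add: \<nu>_def)

lemma prob_space_\<nu>: "prob_space \<nu>"
  using prob_space_distr[of "eps 1" borel] distr_eps[of 1] by simp

lemma g_meas[measurable]: "g \<in> borel_measurable borel"
  using C3_real_derivs(1)[OF g_C3] by (intro borel_measurable_continuous_onI continuous_at_imp_continuous_on ballI DERIV_isCont)

text \<open>The target space of Y is kept general because a pair of a complex prefactor and a real
  weight is inserted later.\<close>

lemma joint_law:
  fixes Y :: "'w \<Rightarrow> 'b::second_countable_topology"
  assumes Y: "Y \<in> borel_measurable (F (j - 1))" and j: "j \<ge> 1"
  shows "distr M borel Y \<Otimes>\<^sub>M \<nu> = distr M (borel \<Otimes>\<^sub>M borel) (\<lambda>w. (Y w, eps j w))"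
  using distr_F_eps[OF Y j] unfolding distr_eps[OF j] .

lemma nn_integral_joint:
  fixes Y :: "'w \<Rightarrow> 'b::second_countable_topology"
  assumes Y: "Y \<in> borel_measurable (F (j - 1))" and j: "j \<ge> 1"
    and f[measurable]: "f \<in> borel_measurable (borel \<Otimes>\<^sub>M borel)"
  shows "(\<integral>\<^sup>+w. f (Y w, eps j w) \<partial>M) = (\<integral>\<^sup>+w. (\<integral>\<^sup>+e. f (Y w, e) \<partial>\<nu>) \<partial>M)"
proof -
  interpret N: prob_space \<nu> by (rule prob_space_\<nu>)
  note Ym[measurable] = measurable_F[OF Y]
  have "(\<integral>\<^sup>+w. f (Y w, eps j w) \<partial>M) = (\<integral>\<^sup>+p. f p \<partial>(distr M borel Y \<Otimes>\<^sub>M \<nu>))"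
    unfolding joint_law[OF Y j] by (subst nn_integral_distr) auto
  also have "\<dots> = (\<integral>\<^sup>+y. (\<integral>\<^sup>+e. f (y, e) \<partial>\<nu>) \<partial>distr M borel Y)"
    by (subst N.nn_integral_fst[symmetric]) (auto simp: measurable_cong_sets[OF sets_pair_measure_cong[OF sets_distr sets_\<nu>] refl])
  also have "\<dots> = (\<integral>\<^sup>+w. (\<integral>\<^sup>+e. f (Y w, e) \<partial>\<nu>) \<partial>M)"
    by (subst nn_integral_distr) auto
  finally show ?thesis .
qed

text \<open>Freezing: a quantity determined by the past is held fixed while the new innovation is
  integrated out. Iterated integrals of this kind stand in for conditional expectations
  throughout.\<close>

lemma integral_joint:
  fixes Y :: "'w \<Rightarrow> 'b::second_countable_topology" and f :: "_ \<Rightarrow> 'c::{banach,second_countable_topology}"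
  assumes Y: "Y \<in> borel_measurable (F (j - 1))" and j: "j \<ge> 1"
    and f[measurable]: "f \<in> borel_measurable (borel \<Otimes>\<^sub>M borel)"
    and int: "integrable M (\<lambda>w. f (Y w, eps j w))"
  shows "(\<integral>w. f (Y w, eps j w) \<partial>M) = (\<integral>w. (\<integral>e. f (Y w, e) \<partial>\<nu>) \<partial>M)"
proof -
  interpret N: prob_space \<nu> by (rule prob_space_\<nu>)
  note Ym[measurable] = measurable_F[OF Y]
  interpret D: prob_space "distr M borel Y" by (rule prob_space_distr[OF Ym])
  interpret pair_sigma_finite "distr M borel Y" \<nu> ..
  have int': "integrable (distr M borel Y \<Otimes>\<^sub>M \<nu>) f"
    unfolding joint_law[OF Y j] by (subst integrable_distr_eq) (use int in auto)
  have "(\<integral>w. f (Y w, eps j w) \<partial>M) = (\<integral>p. f p \<partial>(distr M borel Y \<Otimes>\<^sub>M \<nu>))"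
    unfolding joint_law[OF Y j] by (subst integral_distr) auto
  also have "\<dots> = (\<integral>y. (\<integral>e. f (y, e) \<partial>\<nu>) \<partial>distr M borel Y)"
    using integral_fst'[OF int'] by simp
  also have "\<dots> = (\<integral>w. (\<integral>e. f (Y w, e) \<partial>\<nu>) \<partial>M)"
    by (subst integral_distr) auto
  finally show ?thesis .
qed

lemma integrable_eps:
  fixes f :: "real \<Rightarrow> real"
  assumes "j \<ge> 1" and [measurable]: "f \<in> borel_measurable borel"
  shows "integrable M (\<lambda>w. f (eps j w)) \<longleftrightarrow> integrable \<nu> f"
  unfolding distr_eps[OF assms(1), symmetric] by (subst integrable_distr_eq) auto

lemma integral_eps:
  fixes f :: "real \<Rightarrow> real"
  assumes "j \<ge> 1" and [measurable]: "f \<in> borel_measurable borel"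
  shows "(\<integral>w. f (eps j w) \<partial>M) = integral\<^sup>L \<nu> f"
  unfolding distr_eps[OF assms(1), symmetric] by (subst integral_distr) auto

lemma integrable_mult_eps:
  fixes Y :: "'w \<Rightarrow> real" and \<phi> :: "real \<Rightarrow> real"
  assumes Y: "Y \<in> borel_measurable (F (j - 1))" "integrable M Y" and j: "j \<ge> 1"
    and \<phi>: "\<phi> \<in> borel_measurable borel" "integrable \<nu> \<phi>"
  shows "integrable M (\<lambda>w. Y w * \<phi> (eps j w))"
    "(\<integral>w. Y w * \<phi> (eps j w) \<partial>M) = (\<integral>w. Y w \<partial>M) * (\<integral>e. \<phi> e \<partial>\<nu>)"
proof -
  have "indep_var borel ((\<lambda>x. x) \<circ> Y) borel (\<phi> \<circ> eps j)"
    by (rule indep_var_compose[OF indep_F_eps[OF Y(1) j]]) (use \<phi>(1) in auto)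
  then have "indep_var borel Y borel (\<lambda>w. \<phi> (eps j w))" by (simp add: o_def)
  moreover have "integrable M (\<lambda>w. \<phi> (eps j w))" using integrable_eps[OF j \<phi>(1)] \<phi>(2) by simp
  ultimately show "integrable M (\<lambda>w. Y w * \<phi> (eps j w))"
    "(\<integral>w. Y w * \<phi> (eps j w) \<partial>M) = (\<integral>w. Y w \<partial>M) * (\<integral>e. \<phi> e \<partial>\<nu>)"
    using indep_var_integrable[of Y] indep_var_lebesgue_integral[of Y] Y(2) integral_eps[OF j \<phi>(1)] by simp_all
qed

section \<open>Moment identities of the score under the noise law\<close>

lemmas score_meas[measurable] = score_measurable[OF g_C3 g_pos]

lemma integrable_\<nu>:
  fixes f :: "real \<Rightarrow> real"
  assumes "f \<in> borel_measurable borel"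
  shows "integrable \<nu> f \<longleftrightarrow> integrable lborel (\<lambda>e. f e * g e)" "integral\<^sup>L \<nu> f = (\<integral>e. f e * g e \<partial>lborel)"
  unfolding \<nu>_def using assms less_imp_le[OF g_pos]
  by (auto simp: integrable_density integral_density mult.commute)

text \<open>Multiplying \<open>score g\<close> by the density gives g', the derivative of an
  integrable function, whose integral over the line vanishes.\<close>

lemma score_mean_zero:
  assumes "integrable \<nu> (\<lambda>e. (score g e)\<^sup>2)"
  shows "integrable \<nu> (score g)" "(\<integral>e. score g e \<partial>\<nu>) = 0"
proof -
  interpret N: prob_space \<nu> by (rule prob_space_\<nu>)
  have gi: "integrable lborel g"
    using integrable_\<nu>(1)[of "\<lambda>_. 1"] by simp
  show s: "integrable \<nu> (score g)"
    by (rule square_integrable_imp[OF N.finite_measure_axioms _ assms]) simp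
  have eq: "(\<lambda>e. score g e * g e) = deriv g"
    using g_pos by (auto simp: score_def fun_eq_iff less_imp_neq[symmetric])
  have "(\<integral>x. deriv g x \<partial>lborel) = 0"
    by (rule integral_derivative_eq_0[OF C3_real_derivs(1)[OF g_C3] DERIV_isCont[OF C3_real_derivs(2)[OF g_C3]] gi])
      (use s in \<open>simp add: integrable_\<nu> eq\<close>)
  then show "(\<integral>e. score g e \<partial>\<nu>) = 0" by (simp add: integrable_\<nu> eq)
qed

text \<open>The information identity for the noise: the sum of \<open>dscore\<close> and the squared
  score, times the density, is g'', and its integral vanishes because g' is integrable. This is what
  links the Hessian to the conditional variance of the score.\<close>

lemma dscore_mean:
  assumes s2: "integrable \<nu> (\<lambda>e. (score g e)\<^sup>2)" and d2: "integrable \<nu> (\<lambda>e. (dscore g e)\<^sup>2)"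
  shows "integrable \<nu> (dscore g)" "(\<integral>e. dscore g e \<partial>\<nu>) = - (\<integral>e. (score g e)\<^sup>2 \<partial>\<nu>)"
proof -
  interpret N: prob_space \<nu> by (rule prob_space_\<nu>)
  have eq1: "(\<lambda>e. score g e * g e) = deriv g"
    using g_pos by (auto simp: score_def fun_eq_iff less_imp_neq[symmetric])
  have gi: "integrable lborel (deriv g)"
    using score_mean_zero(1)[OF s2] by (simp add: integrable_\<nu> eq1)
  show d: "integrable \<nu> (dscore g)"
    by (rule square_integrable_imp[OF N.finite_measure_axioms _ d2]) simp
  have eq: "(\<lambda>e. (dscore g e + (score g e)\<^sup>2) * g e) = deriv (deriv g)"
    using g_pos by (auto simp: dscore_def fun_eq_iff less_imp_neq[symmetric])
  have i: "integrable \<nu> (\<lambda>e. dscore g e + (score g e)\<^sup>2)" using d s2 by simp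
  have "(\<integral>x. deriv (deriv g) x \<partial>lborel) = 0"
    by (rule integral_derivative_eq_0[OF C3_real_derivs(2)[OF g_C3] DERIV_isCont[OF C3_real_derivs(3)[OF g_C3]] gi])
      (use i in \<open>simp add: integrable_\<nu> eq\<close>)
  then have "(\<integral>e. dscore g e + (score g e)\<^sup>2 \<partial>\<nu>) = 0" by (simp add: integrable_\<nu> eq)
  then show "(\<integral>e. dscore g e \<partial>\<nu>) = - (\<integral>e. (score g e)\<^sup>2 \<partial>\<nu>)" using d s2 by simp
qed

end

section \<open>Second moments of products and of martingale sums\<close>

lemma integrable_mult_square:
  fixes f h :: "'a \<Rightarrow> real"
  assumes [measurable]: "f \<in> borel_measurable N" "h \<in> borel_measurable N"
    and "integrable N (\<lambda>x. (f x)\<^sup>2)" "integrable N (\<lambda>x. (h x)\<^sup>2)"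
  shows "integrable N (\<lambda>x. f x * h x)"
proof (rule Bochner_Integration.integrable_bound)
  show "integrable N (\<lambda>x. (f x)\<^sup>2 + (h x)\<^sup>2)" using assms by simp
  have "\<bar>a * b\<bar> \<le> \<bar>a\<^sup>2 + b\<^sup>2\<bar>" for a b :: real
  proof -
    have "2 * (\<bar>a\<bar> * \<bar>b\<bar>) \<le> a\<^sup>2 + b\<^sup>2" using sum_squares_bound[of "\<bar>a\<bar>" "\<bar>b\<bar>"] by (simp add: mult.assoc)
    moreover have "0 \<le> \<bar>a\<bar> * \<bar>b\<bar>" by simp
    ultimately show ?thesis unfolding abs_mult by linarith
  qed
  then show "AE x in N. norm (f x * h x) \<le> norm ((f x)\<^sup>2 + (h x)\<^sup>2)" by simp
qed measurable

lemma integrable_add_square: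
  fixes f h :: "'a \<Rightarrow> real"
  assumes [measurable]: "f \<in> borel_measurable N" "h \<in> borel_measurable N"
    and "integrable N (\<lambda>x. (f x)\<^sup>2)" "integrable N (\<lambda>x. (h x)\<^sup>2)"
  shows "integrable N (\<lambda>x. (f x + h x)\<^sup>2)" "integrable N (\<lambda>x. (f x - h x)\<^sup>2)"
  using integrable_mult_square[OF assms] assms(3,4) by (simp_all add: power2_sum power2_diff mult.assoc)

lemma square_sum_integral:
  fixes D :: "nat \<Rightarrow> 'a \<Rightarrow> real"
  assumes m: "\<And>j. j \<ge> 1 \<Longrightarrow> D j \<in> borel_measurable N"
    and sq: "\<And>j. j \<ge> 1 \<Longrightarrow> integrable N (\<lambda>x. (D j x)\<^sup>2)"
    and orth: "\<And>i j. 1 \<le> i \<Longrightarrow> i < j \<Longrightarrow> (\<integral>x. D i x * D j x \<partial>N) = 0"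
  shows "integrable N (\<lambda>x. (\<Sum>j=1..n. D j x)\<^sup>2) \<and>
    (\<integral>x. (\<Sum>j=1..n. D j x)\<^sup>2 \<partial>N) = (\<Sum>j=1..n. \<integral>x. (D j x)\<^sup>2 \<partial>N)"
proof (induction n)
  case (Suc n)
  let ?S = "\<lambda>x. \<Sum>j=1..n. D j x"
  have Sm: "?S \<in> borel_measurable N" using m by (intro borel_measurable_sum) auto
  have iS: "integrable N (\<lambda>x. (?S x)\<^sup>2)" using Suc by blast
  have iD: "integrable N (\<lambda>x. (D (Suc n) x)\<^sup>2)" using sq by simp
  have iDD: "integrable N (\<lambda>x. D j x * D (Suc n) x)" if "j \<in> {1..n}" for j
    using that m sq by (intro integrable_mult_square) auto
  have "(\<integral>x. ?S x * D (Suc n) x \<partial>N) = (\<Sum>j=1..n. \<integral>x. D j x * D (Suc n) x \<partial>N)"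
    using iDD by (simp add: sum_distrib_right)
  also have "\<dots> = 0" using orth by (intro sum.neutral) auto
  finally have z: "(\<integral>x. ?S x * D (Suc n) x \<partial>N) = 0" .
  have iSD: "integrable N (\<lambda>x. ?S x * D (Suc n) x)"
    using Sm m iS iD by (intro integrable_mult_square) auto
  have e: "(\<Sum>j=1..Suc n. D j x)\<^sup>2 = (?S x)\<^sup>2 + (D (Suc n) x)\<^sup>2 + 2 * (?S x * D (Suc n) x)" for x
    by (simp add: power2_sum)
  show ?case unfolding e using iS iD iSD z Suc by simp
qed simp

context ar_law
begin

lemma eps_F: "1 \<le> i \<Longrightarrow> i \<le> j \<Longrightarrow> eps i \<in> borel_measurable (F j)"
proof -
  assume i: "1 \<le> i" "i \<le> j"
  have [measurable]: "X i \<in> borel_measurable (F j)" "X (i - 1) \<in> borel_measurable (F j)"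
    using i by (auto intro: X_F)
  show ?thesis unfolding eps_def[abs_def] by measurable
qed

text \<open>Stated with nonnegative integrals so that it can be used before either factor is known
  to be integrable.\<close>

lemma nn_integral_product_eps:
  assumes [measurable]: "\<phi> \<in> borel_measurable borel" "a \<in> borel_measurable borel" and j: "j \<ge> 1"
  shows "(\<integral>\<^sup>+w. ennreal ((\<phi> (eps j w) * a (X (j - 1) w))\<^sup>2) \<partial>M) =
    (\<integral>\<^sup>+e. ennreal ((\<phi> e)\<^sup>2) \<partial>\<nu>) * (\<integral>\<^sup>+w. ennreal ((a (X (j - 1) w))\<^sup>2) \<partial>M)"
proof -
  have "(\<integral>\<^sup>+w. ennreal ((\<phi> (eps j w) * a (X (j - 1) w))\<^sup>2) \<partial>M) =
      (\<integral>\<^sup>+w. (\<lambda>(x, e). ennreal ((\<phi> e)\<^sup>2) * ennreal ((a x)\<^sup>2)) (X (j - 1) w, eps j w) \<partial>M)"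
    by (simp add: power_mult_distrib ennreal_mult)
  also have "\<dots> = (\<integral>\<^sup>+w. (\<integral>\<^sup>+e. (\<lambda>(x, e). ennreal ((\<phi> e)\<^sup>2) * ennreal ((a x)\<^sup>2)) (X (j - 1) w, e) \<partial>\<nu>) \<partial>M)"
    by (rule nn_integral_joint[OF X_F j]) auto
  also have "\<dots> = (\<integral>\<^sup>+e. ennreal ((\<phi> e)\<^sup>2) \<partial>\<nu>) * (\<integral>\<^sup>+w. ennreal ((a (X (j - 1) w))\<^sup>2) \<partial>M)"
    by (simp add: nn_integral_multc nn_integral_cmult)
  finally show ?thesis .
qed

lemma integrable_square_iff:
  fixes f :: "'a \<Rightarrow> real"
  assumes "f \<in> borel_measurable N"
  shows "integrable N (\<lambda>x. (f x)\<^sup>2) \<longleftrightarrow> (\<integral>\<^sup>+x. ennreal ((f x)\<^sup>2) \<partial>N) < \<infinity>"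
  using assms by (simp add: integrable_iff_bounded)

text \<open>The second moment of the product equals the product \<open>?P * ?A\<close> and is finite
  and positive. Both factors are then nonzero, and an infinite \<open>?P\<close> against a nonzero
  \<open>?A\<close> would make the product infinite. Finite Fisher information of the noise is thus
  a consequence, not an assumption.\<close>

lemma score_square_integrable:
  assumes [measurable]: "a \<in> borel_measurable borel" and j: "j \<ge> 1"
    and int: "integrable M (\<lambda>w. (score g (eps j w) * a (X (j - 1) w))\<^sup>2)"
    and pos: "(\<integral>w. (score g (eps j w) * a (X (j - 1) w))\<^sup>2 \<partial>M) > 0"
  shows "integrable \<nu> (\<lambda>e. (score g e)\<^sup>2)" "(\<integral>e. (score g e)\<^sup>2 \<partial>\<nu>) > 0"
    "\<not> (AE w in M. a (X (j - 1) w) = 0)"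
proof -
  let ?L = "\<integral>\<^sup>+w. ennreal ((score g (eps j w) * a (X (j - 1) w))\<^sup>2) \<partial>M"
  let ?P = "\<integral>\<^sup>+e. ennreal ((score g e)\<^sup>2) \<partial>\<nu>" and ?A = "\<integral>\<^sup>+w. ennreal ((a (X (j - 1) w))\<^sup>2) \<partial>M"
  have L: "?L = ?P * ?A" by (rule nn_integral_product_eps[OF _ _ j]) auto
  have "?L = ennreal (\<integral>w. (score g (eps j w) * a (X (j - 1) w))\<^sup>2 \<partial>M)"
    by (rule nn_integral_eq_integral[OF int]) simp
  then have L': "?L < \<infinity>" "?L \<noteq> 0" using pos by auto
  then have A: "?A \<noteq> 0" and P: "?P \<noteq> 0" using L by auto
  have "?P < \<infinity>"
  proof (rule ccontr)
    assume "\<not> ?P < \<infinity>"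
    then have "?P = \<top>" by (simp add: less_top[symmetric])
    with L A have "?L = \<top>" by (simp add: ennreal_top_mult)
    with L' show False by simp
  qed
  then show i: "integrable \<nu> (\<lambda>e. (score g e)\<^sup>2)" by (simp add: integrable_square_iff)
  have "?P = ennreal (\<integral>e. (score g e)\<^sup>2 \<partial>\<nu>)" by (rule nn_integral_eq_integral[OF i]) simp
  then show "(\<integral>e. (score g e)\<^sup>2 \<partial>\<nu>) > 0" using P by (metis ennreal_0 ennreal_neg not_le)
  show "\<not> (AE w in M. a (X (j - 1) w) = 0)"
  proof
    assume "AE w in M. a (X (j - 1) w) = 0"
    then have "?A = (\<integral>\<^sup>+w. 0 \<partial>M)" by (intro nn_integral_cong_AE) auto
    with A show False by simp
  qed
qed

lemma score_factor_integrable: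
  assumes [measurable]: "a \<in> borel_measurable borel" and j: "j \<ge> 1"
    and int: "integrable M (\<lambda>w. (score g (eps j w) * a (X (j - 1) w))\<^sup>2)"
    and s2: "integrable \<nu> (\<lambda>e. (score g e)\<^sup>2)" and pos: "(\<integral>e. (score g e)\<^sup>2 \<partial>\<nu>) > 0"
  shows "integrable M (\<lambda>w. (a (X (j - 1) w))\<^sup>2)"
proof -
  let ?A = "\<integral>\<^sup>+w. ennreal ((a (X (j - 1) w))\<^sup>2) \<partial>M"
  have P: "(\<integral>\<^sup>+e. ennreal ((score g e)\<^sup>2) \<partial>\<nu>) = ennreal (\<integral>e. (score g e)\<^sup>2 \<partial>\<nu>)"
    by (rule nn_integral_eq_integral[OF s2]) simp
  have "ennreal (\<integral>e. (score g e)\<^sup>2 \<partial>\<nu>) * ?A < \<infinity>"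
    using int nn_integral_product_eps[of "score g" a j] j
    by (simp add: P[symmetric] integrable_square_iff)
  then have "?A < \<infinity>" using pos by (auto simp: ennreal_mult_less_top)
  then show ?thesis by (simp add: integrable_square_iff)
qed

lemma hess_form_nn_integral:
  assumes [measurable]: "A \<in> borel_measurable borel" "B \<in> borel_measurable borel" and j: "j \<ge> 1"
  shows "(\<integral>\<^sup>+w. ennreal ((dscore g (eps j w) * A (X (j - 1) w) - score g (eps j w) * B (X (j - 1) w))\<^sup>2) \<partial>M) =
    (\<integral>\<^sup>+w. (\<integral>\<^sup>+e. ennreal ((dscore g e * A (X (j - 1) w) - score g e * B (X (j - 1) w))\<^sup>2) \<partial>\<nu>) \<partial>M)"
proof -
  have "(\<integral>\<^sup>+w. (\<lambda>(x, e). ennreal ((dscore g e * A x - score g e * B x)\<^sup>2)) (X (j - 1) w, eps j w) \<partial>M) =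
      (\<integral>\<^sup>+w. (\<integral>\<^sup>+e. (\<lambda>(x, e). ennreal ((dscore g e * A x - score g e * B x)\<^sup>2)) (X (j - 1) w, e) \<partial>\<nu>) \<partial>M)"
    by (rule nn_integral_joint[OF X_F j]) auto
  then show ?thesis by simp
qed

text \<open>The Hessian form mixes two noise functions and its second moment does not factor.
  Instead the past is frozen at one point where the inner integral is finite and A does not vanish;
  there the square integrable score term is added back and the remaining coefficient divided
  out.\<close>

lemma dscore_square_integrable:
  assumes Am[measurable]: "A \<in> borel_measurable borel" and Bm[measurable]: "B \<in> borel_measurable borel" and j: "j \<ge> 1"
    and int: "integrable M (\<lambda>w. (dscore g (eps j w) * A (X (j - 1) w) - score g (eps j w) * B (X (j - 1) w))\<^sup>2)"
    and s2: "integrable \<nu> (\<lambda>e. (score g e)\<^sup>2)" and nz: "\<not> (AE w in M. A (X (j - 1) w) = 0)"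
  shows "integrable \<nu> (\<lambda>e. (dscore g e)\<^sup>2)"
proof -
  interpret N: prob_space \<nu> by (rule prob_space_\<nu>)
  let ?h = "\<lambda>w. \<integral>\<^sup>+e. ennreal ((dscore g e * A (X (j - 1) w) - score g e * B (X (j - 1) w))\<^sup>2) \<partial>\<nu>"
  have "(\<integral>\<^sup>+w. ?h w \<partial>M) < \<infinity>"
    unfolding hess_form_nn_integral[OF Am Bm j, symmetric] using int by (simp add: integrable_square_iff)
  then have ae: "AE w in M. ?h w \<noteq> \<infinity>" by (intro nn_integral_noteq_infinite) auto
  have "\<exists>w. A (X (j - 1) w) \<noteq> 0 \<and> ?h w \<noteq> \<infinity>"
  proof (rule ccontr)
    assume "\<not> ?thesis"
    then have "\<And>w. ?h w \<noteq> \<infinity> \<Longrightarrow> A (X (j - 1) w) = 0" by blast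
    with ae have "AE w in M. A (X (j - 1) w) = 0" by (rule eventually_mono)
    with nz show False by blast
  qed
  then obtain w where w: "A (X (j - 1) w) \<noteq> 0" "?h w \<noteq> \<infinity>" by blast
  define \<alpha> \<beta> where "\<alpha> = A (X (j - 1) w)" and "\<beta> = B (X (j - 1) w)"
  have "integrable \<nu> (\<lambda>e. (dscore g e * \<alpha> - score g e * \<beta>)\<^sup>2)"
    using w(2) by (simp add: integrable_square_iff \<alpha>_def \<beta>_def top.not_eq_extremum)
  moreover have "integrable \<nu> (\<lambda>e. (score g e * \<beta>)\<^sup>2)" using s2 by (simp add: power_mult_distrib)
  ultimately have "integrable \<nu> (\<lambda>e. ((dscore g e * \<alpha> - score g e * \<beta>) + score g e * \<beta>)\<^sup>2)"
    by (rule integrable_add_square(1)[rotated 2]) auto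
  then have "integrable \<nu> (\<lambda>e. \<alpha>\<^sup>2 * (dscore g e)\<^sup>2)" by (simp add: power_mult_distrib mult.commute)
  then show ?thesis using w(1) by (simp add: \<alpha>_def)
qed

text \<open>Given the past, the quadratic form of the Hessian has mean \<open>- J A\<close>, so its second moment dominates
  that of \<open>J A\<close> by Jensen's inequality.\<close>

lemma hess_form_bound:
  assumes Am[measurable]: "A \<in> borel_measurable borel" and Bm[measurable]: "B \<in> borel_measurable borel" and j: "j \<ge> 1"
    and int: "integrable M (\<lambda>w. (dscore g (eps j w) * A (X (j - 1) w) - score g (eps j w) * B (X (j - 1) w))\<^sup>2)"
    and s2: "integrable \<nu> (\<lambda>e. (score g e)\<^sup>2)" and d2: "integrable \<nu> (\<lambda>e. (dscore g e)\<^sup>2)"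
    and J: "J = (\<integral>e. (score g e)\<^sup>2 \<partial>\<nu>)" "J > 0"
  shows "integrable M (\<lambda>w. (A (X (j - 1) w))\<^sup>2)" "integrable M (\<lambda>w. (B (X (j - 1) w))\<^sup>2)"
    "J\<^sup>2 * (\<integral>w. (A (X (j - 1) w))\<^sup>2 \<partial>M) \<le>
      (\<integral>w. (dscore g (eps j w) * A (X (j - 1) w) - score g (eps j w) * B (X (j - 1) w))\<^sup>2 \<partial>M)"
proof -
  interpret N: prob_space \<nu> by (rule prob_space_\<nu>)
  note sm = score_mean_zero[OF s2] and dm = dscore_mean[OF s2 d2]
  let ?H = "\<lambda>w. dscore g (eps j w) * A (X (j - 1) w) - score g (eps j w) * B (X (j - 1) w)"
  \<comment> \<open>For frozen values \<alpha> and \<beta> the form has mean - J \<alpha> under the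
    noise, because the score is centred. Nonnegativity of the variance gives the bound, whatever the
    value of \<beta>.\<close>
  have inner: "ennreal (J\<^sup>2 * \<alpha>\<^sup>2) \<le> (\<integral>\<^sup>+e. ennreal ((dscore g e * \<alpha> - score g e * \<beta>)\<^sup>2) \<partial>\<nu>)" for \<alpha> \<beta>
  proof -
    let ?f = "\<lambda>e. dscore g e * \<alpha> - score g e * \<beta>"
    have i2: "integrable \<nu> (\<lambda>e. (?f e)\<^sup>2)"
      by (rule integrable_add_square(2)) (use s2 d2 in \<open>auto simp: power_mult_distrib\<close>)
    have "N.expectation ?f = - J * \<alpha>" using sm dm J by simp
    have "0 \<le> N.variance ?f" by (rule N.variance_positive)
    moreover have "N.variance ?f = N.expectation (\<lambda>e. (?f e)\<^sup>2) - (N.expectation ?f)\<^sup>2"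
      using sm(1) dm(1) i2 by (intro N.variance_eq) auto
    moreover have "(N.expectation ?f)\<^sup>2 = J\<^sup>2 * \<alpha>\<^sup>2"
      using \<open>N.expectation ?f = - J * \<alpha>\<close> by (simp add: power_mult_distrib)
    ultimately have "J\<^sup>2 * \<alpha>\<^sup>2 \<le> N.expectation (\<lambda>e. (?f e)\<^sup>2)" by linarith
    then show ?thesis by (subst nn_integral_eq_integral[OF i2]) (auto intro: ennreal_leI)
  qed
  have le: "(\<integral>\<^sup>+w. ennreal (J\<^sup>2 * (A (X (j - 1) w))\<^sup>2) \<partial>M) \<le> (\<integral>\<^sup>+w. ennreal ((?H w)\<^sup>2) \<partial>M)"
    unfolding hess_form_nn_integral[OF Am Bm j] by (intro nn_integral_mono inner)
  also have fin: "\<dots> < \<infinity>" using int by (simp add: integrable_square_iff)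
  finally have "(\<integral>\<^sup>+w. ennreal ((J * A (X (j - 1) w))\<^sup>2) \<partial>M) < \<infinity>"
    unfolding power_mult_distrib .
  then have "integrable M (\<lambda>w. (J * A (X (j - 1) w))\<^sup>2)"
    by (subst integrable_square_iff) auto
  then show iA: "integrable M (\<lambda>w. (A (X (j - 1) w))\<^sup>2)" using J(2) by (simp add: power_mult_distrib)
  have "ennreal (\<integral>w. J\<^sup>2 * (A (X (j - 1) w))\<^sup>2 \<partial>M) \<le> ennreal (\<integral>w. (?H w)\<^sup>2 \<partial>M)"
    using le iA int by (subst (1 2) nn_integral_eq_integral[symmetric]) auto
  then show "J\<^sup>2 * (\<integral>w. (A (X (j - 1) w))\<^sup>2 \<partial>M) \<le> (\<integral>w. (?H w)\<^sup>2 \<partial>M)"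
    by (simp add: ennreal_le_iff integral_nonneg)
  \<comment> \<open>With A under control, the \<open>dscore\<close> part is square integrable by
    independence; subtracting the whole form isolates the score times B, from which B is
    recovered.\<close>
  have "(\<lambda>w. (A (X (j - 1) w))\<^sup>2) \<in> borel_measurable (F (j - 1))"
    by (rule measurable_compose[OF X_F]) auto
  then have "integrable M (\<lambda>w. (A (X (j - 1) w))\<^sup>2 * (dscore g (eps j w))\<^sup>2)"
    by (rule integrable_mult_eps(1)[OF _ iA j _ d2]) auto
  then have "integrable M (\<lambda>w. (dscore g (eps j w) * A (X (j - 1) w))\<^sup>2)"
    by (simp add: power_mult_distrib mult.commute)
  then have "integrable M (\<lambda>w. (dscore g (eps j w) * A (X (j - 1) w) - ?H w)\<^sup>2)"
    using int by (rule integrable_add_square(2)[rotated 2]) auto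
  then have "integrable M (\<lambda>w. (score g (eps j w) * B (X (j - 1) w))\<^sup>2)" by simp
  then show "integrable M (\<lambda>w. (B (X (j - 1) w))\<^sup>2)"
    by (rule score_factor_integrable[OF Bm j]) (use s2 J in auto)
qed

text \<open>For i < j the increment i is determined by the past of j while the innovation j is
  independent of it with centred factors, so cross terms vanish. Two noise factors are allowed
  because the centred Hessian form needs both \<open>dscore\<close> plus J and the negative
  score.\<close>

lemma martingale_difference_square:
  fixes \<phi>1 \<phi>2 a b :: "real \<Rightarrow> real"
  assumes \<phi>m[measurable]: "\<phi>1 \<in> borel_measurable borel" "\<phi>2 \<in> borel_measurable borel"
    and ab[measurable]: "a \<in> borel_measurable borel" "b \<in> borel_measurable borel"
    and \<phi>: "integrable \<nu> (\<lambda>e. (\<phi>1 e)\<^sup>2)" "(\<integral>e. \<phi>1 e \<partial>\<nu>) = 0"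
      "integrable \<nu> (\<lambda>e. (\<phi>2 e)\<^sup>2)" "(\<integral>e. \<phi>2 e \<partial>\<nu>) = 0"
    and ia: "\<And>j. j \<ge> 1 \<Longrightarrow> integrable M (\<lambda>w. (a (X (j - 1) w))\<^sup>2)"
    and ib: "\<And>j. j \<ge> 1 \<Longrightarrow> integrable M (\<lambda>w. (b (X (j - 1) w))\<^sup>2)"
  defines "D \<equiv> \<lambda>j w. a (X (j - 1) w) * \<phi>1 (eps j w) + b (X (j - 1) w) * \<phi>2 (eps j w)"
  shows "integrable M (\<lambda>w. (\<Sum>j=1..n. D j w)\<^sup>2)"
    "(\<integral>w. (\<Sum>j=1..n. D j w)\<^sup>2 \<partial>M) = (\<Sum>j=1..n. \<integral>w. (D j w)\<^sup>2 \<partial>M)"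
proof -
  interpret N: prob_space \<nu> by (rule prob_space_\<nu>)
  have Dm[measurable]: "D j \<in> borel_measurable M" for j unfolding D_def by measurable
  have am: "(\<lambda>w. a (X (j - 1) w) * \<phi>1 (eps j w)) \<in> borel_measurable M"
    and bm: "(\<lambda>w. b (X (j - 1) w) * \<phi>2 (eps j w)) \<in> borel_measurable M" for j
    by measurable
  have \<phi>i: "integrable \<nu> \<phi>1" "integrable \<nu> \<phi>2"
    using \<phi> by (auto intro!: square_integrable_imp[OF N.finite_measure_axioms])
  have D2: "integrable M (\<lambda>w. (D j w)\<^sup>2)" if j: "j \<ge> 1" for j
  proof -
    have cF: "(\<lambda>w. (c (X (j - 1) w))\<^sup>2) \<in> borel_measurable (F (j - 1))"
      if [measurable]: "c \<in> borel_measurable borel" for c :: "real \<Rightarrow> real"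
      by (rule measurable_compose[OF X_F]) auto
    have "integrable M (\<lambda>w. (a (X (j - 1) w))\<^sup>2 * (\<phi>1 (eps j w))\<^sup>2)"
      by (rule integrable_mult_eps(1)[OF cF ia[OF j] j _ \<phi>(1)]) auto
    moreover have "integrable M (\<lambda>w. (b (X (j - 1) w))\<^sup>2 * (\<phi>2 (eps j w))\<^sup>2)"
      by (rule integrable_mult_eps(1)[OF cF ib[OF j] j _ \<phi>(3)]) auto
    ultimately have "integrable M (\<lambda>w. (a (X (j - 1) w) * \<phi>1 (eps j w))\<^sup>2)"
      "integrable M (\<lambda>w. (b (X (j - 1) w) * \<phi>2 (eps j w))\<^sup>2)"
      by (simp_all add: power_mult_distrib)
    then show ?thesis unfolding D_def by (rule integrable_add_square(1)[OF am bm])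
  qed
  have orth: "(\<integral>w. D i w * D j w \<partial>M) = 0" if i: "1 \<le> i" and ij: "i < j" for i j
  proof -
    have j: "j \<ge> 1" using i ij by simp
    have [measurable]: "X (j - 1) \<in> borel_measurable (F (j - 1))" "X (i - 1) \<in> borel_measurable (F (j - 1))"
       using ij by (auto intro: X_F)
    have [measurable]: "eps i \<in> borel_measurable (F (j - 1))" using i ij by (intro eps_F) auto
    have DF[measurable]: "D i \<in> borel_measurable (F (j - 1))" unfolding D_def by measurable
    have DaF: "(\<lambda>w. D i w * a (X (j - 1) w)) \<in> borel_measurable (F (j - 1))"
      "(\<lambda>w. D i w * b (X (j - 1) w)) \<in> borel_measurable (F (j - 1))" by measurable
    have "integrable M (\<lambda>w. D i w * a (X (j - 1) w))" "integrable M (\<lambda>w. D i w * b (X (j - 1) w))"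
      by (rule integrable_mult_square[OF Dm measurable_compose[OF X_meas ab(1)] D2[OF i] ia[OF j]])
        (rule integrable_mult_square[OF Dm measurable_compose[OF X_meas ab(2)] D2[OF i] ib[OF j]])
    note I1 = integrable_mult_eps[OF DaF(1) this(1) j \<phi>m(1) \<phi>i(1)] and I2 = integrable_mult_eps[OF DaF(2) this(2) j \<phi>m(2) \<phi>i(2)]
    have "(\<integral>w. D i w * D j w \<partial>M) = (\<integral>w. (D i w * a (X (j - 1) w)) * \<phi>1 (eps j w) + (D i w * b (X (j - 1) w)) * \<phi>2 (eps j w) \<partial>M)"
      by (subst (2) D_def) (simp add: algebra_simps)
    also have "\<dots> = 0" using I1 I2 \<phi>(2,4) by simp
    finally show ?thesis .
  qed
  show "integrable M (\<lambda>w. (\<Sum>j=1..n. D j w)\<^sup>2)"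
    "(\<integral>w. (\<Sum>j=1..n. D j w)\<^sup>2 \<partial>M) = (\<Sum>j=1..n. \<integral>w. (D j w)\<^sup>2 \<partial>M)"
    using square_sum_integral[of D M n, OF Dm D2 orth] by auto
qed

lemma score_sum_square:
  assumes [measurable]: "a \<in> borel_measurable borel"
    and s2: "integrable \<nu> (\<lambda>e. (score g e)\<^sup>2)" and J: "(\<integral>e. (score g e)\<^sup>2 \<partial>\<nu>) > 0"
    and int: "\<And>j. j \<ge> 1 \<Longrightarrow> integrable M (\<lambda>w. (score g (eps j w) * a (X (j - 1) w))\<^sup>2)"
    and C: "\<And>j. j \<ge> 1 \<Longrightarrow> (\<integral>w. (score g (eps j w) * a (X (j - 1) w))\<^sup>2 \<partial>M) \<le> C"
  shows "integrable M (\<lambda>w. (\<Sum>j=1..n. score g (eps j w) * a (X (j - 1) w))\<^sup>2)"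
    "(\<integral>w. (\<Sum>j=1..n. score g (eps j w) * a (X (j - 1) w))\<^sup>2 \<partial>M) \<le> real n * C"
proof -
  have ia: "integrable M (\<lambda>w. (a (X (j - 1) w))\<^sup>2)" if "j \<ge> 1" for j
    using score_factor_integrable[OF _ that int[OF that] s2 J] by simp
  \<comment> \<open>The two-factor lemma is applied with a vanishing second factor; this rewrites
    its increments.\<close>
  have e: "a x * score g e + 0 * 0 = score g e * a x" for x e by simp
  note R = martingale_difference_square[of "score g" "\<lambda>_. 0" a "\<lambda>_. 0" n, OF _ _ _ _ s2 score_mean_zero(2)[OF s2] _ _ ia, unfolded e]
  show "integrable M (\<lambda>w. (\<Sum>j=1..n. score g (eps j w) * a (X (j - 1) w))\<^sup>2)" by (rule R) auto
  have "(\<integral>w. (\<Sum>j=1..n. score g (eps j w) * a (X (j - 1) w))\<^sup>2 \<partial>M) =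
      (\<Sum>j=1..n. \<integral>w. (score g (eps j w) * a (X (j - 1) w))\<^sup>2 \<partial>M)" by (rule R) auto
  also have "\<dots> \<le> (\<Sum>j=1..n. C)" using C by (intro sum_mono) auto
  finally show "(\<integral>w. (\<Sum>j=1..n. score g (eps j w) * a (X (j - 1) w))\<^sup>2 \<partial>M) \<le> real n * C" by simp
qed

text \<open>Given the past the form has mean - J A, so adding J A produces martingale differences.
  The factor 4 comes from (x + y)^2 \<le> 2 x^2 + 2 y^2 together with the Jensen bound, which puts
  the second moment of J A below C as well.\<close>

lemma hess_form_sum_square:
  assumes Am[measurable]: "A \<in> borel_measurable borel" and Bm[measurable]: "B \<in> borel_measurable borel"
    and s2: "integrable \<nu> (\<lambda>e. (score g e)\<^sup>2)" and d2: "integrable \<nu> (\<lambda>e. (dscore g e)\<^sup>2)"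
    and J: "J = (\<integral>e. (score g e)\<^sup>2 \<partial>\<nu>)" "J > 0"
    and int: "\<And>j. j \<ge> 1 \<Longrightarrow> integrable M (\<lambda>w. (dscore g (eps j w) * A (X (j - 1) w) - score g (eps j w) * B (X (j - 1) w))\<^sup>2)"
    and C: "\<And>j. j \<ge> 1 \<Longrightarrow> (\<integral>w. (dscore g (eps j w) * A (X (j - 1) w) - score g (eps j w) * B (X (j - 1) w))\<^sup>2 \<partial>M) \<le> C"
  defines "D \<equiv> \<lambda>j w. dscore g (eps j w) * A (X (j - 1) w) - score g (eps j w) * B (X (j - 1) w) + J * A (X (j - 1) w)"
  shows "integrable M (\<lambda>w. (\<Sum>j=1..n. D j w)\<^sup>2)"
    "(\<integral>w. (\<Sum>j=1..n. D j w)\<^sup>2 \<partial>M) \<le> real n * (4 * C)"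
proof -
  interpret N: prob_space \<nu> by (rule prob_space_\<nu>)
  note hb = hess_form_bound[OF Am Bm _ int s2 d2 J]
  note dm = dscore_mean[OF s2 d2] and sm = score_mean_zero[OF s2]
  have e: "A x * (dscore g e + J) + B x * (- score g e) = dscore g e * A x - score g e * B x + J * A x" for x e
    by (simp add: algebra_simps)
  have q1: "integrable \<nu> (\<lambda>e. (dscore g e + J)\<^sup>2)" by (rule integrable_add_square(1)) (use d2 in auto)
  have q2: "(\<integral>e. dscore g e + J \<partial>\<nu>) = 0" using dm J by (simp add: N.prob_space)
  have p1: "integrable \<nu> (\<lambda>e. (- score g e)\<^sup>2)" using s2 by simp
  have p2: "(\<integral>e. - score g e \<partial>\<nu>) = 0" using sm by simp
  note R = martingale_difference_square[of "\<lambda>e. dscore g e + J" "\<lambda>e. - score g e" A B n, OF _ _ Am Bm q1 q2 p1 p2 hb(1,2), unfolded e]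
  show "integrable M (\<lambda>w. (\<Sum>j=1..n. D j w)\<^sup>2)" unfolding D_def by (rule R) auto
  have "(\<integral>w. (\<Sum>j=1..n. D j w)\<^sup>2 \<partial>M) = (\<Sum>j=1..n. \<integral>w. (D j w)\<^sup>2 \<partial>M)" unfolding D_def by (rule R) auto
  also have "\<dots> \<le> (\<Sum>j=1..n. 4 * C)"
  proof (rule sum_mono)
    fix j assume "j \<in> {1..n}"
    then have j: "j \<ge> 1" by simp
    let ?H = "\<lambda>w. dscore g (eps j w) * A (X (j - 1) w) - score g (eps j w) * B (X (j - 1) w)"
    let ?A = "\<lambda>w. J * A (X (j - 1) w)"
    have iA: "integrable M (\<lambda>w. (?A w)\<^sup>2)" using hb(1)[OF j j] by (simp add: power_mult_distrib)
    have "(\<integral>w. (D j w)\<^sup>2 \<partial>M) \<le> (\<integral>w. 2 * (?H w)\<^sup>2 + 2 * (?A w)\<^sup>2 \<partial>M)"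
    proof (rule integral_mono)
      show "integrable M (\<lambda>w. (D j w)\<^sup>2)" unfolding D_def using int[OF j] iA by (rule integrable_add_square(1)[rotated 2]) measurable
      show "integrable M (\<lambda>w. 2 * (?H w)\<^sup>2 + 2 * (?A w)\<^sup>2)" using int[OF j] iA by simp
      fix w
      have "(x + y)\<^sup>2 \<le> 2 * x\<^sup>2 + 2 * y\<^sup>2" for x y :: real
        using zero_le_power2[of "x - y"] by (simp add: power2_sum power2_diff)
      then show "(D j w)\<^sup>2 \<le> 2 * (?H w)\<^sup>2 + 2 * (?A w)\<^sup>2" unfolding D_def .
    qed
    also have "\<dots> = 2 * (\<integral>w. (?H w)\<^sup>2 \<partial>M) + 2 * (J\<^sup>2 * (\<integral>w. (A (X (j - 1) w))\<^sup>2 \<partial>M))"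
      using int[OF j] iA by (simp add: power_mult_distrib)
    also have "\<dots> \<le> 4 * C" using hb(3)[OF j j] C[OF j] by linarith
    finally show "(\<integral>w. (D j w)\<^sup>2 \<partial>M) \<le> 4 * C" .
  qed
  finally show "(\<integral>w. (\<Sum>j=1..n. D j w)\<^sup>2 \<partial>M) \<le> real n * (4 * C)" by simp
qed

end

section \<open>A martingale bound for characteristic functions\<close>

lemma exp_minus_taylor:
  fixes x :: real assumes "x \<ge> 0"
  shows "\<bar>exp (- x) - (1 - x)\<bar> \<le> x\<^sup>2 / 2"
proof -
  have lo: "exp (- x) \<ge> 1 - x" using exp_ge_add_one_self[of "- x"] by simp
  define f where "f t = 1 - t + t\<^sup>2 / 2 - exp (- t)" for t :: real
  have "f 0 \<le> f x"
  proof (rule DERIV_nonneg_imp_nondecreasing[OF assms])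
    fix t :: real assume "0 \<le> t" "t \<le> x"
    have "(f has_real_derivative (- 1 + t + exp (- t))) (at t)"
      unfolding f_def by (auto intro!: derivative_eq_intros)
    moreover have "0 \<le> - 1 + t + exp (- t)" using exp_ge_add_one_self[of "- t"] by simp
    ultimately show "\<exists>y. (f has_real_derivative y) (at t) \<and> 0 \<le> y" by blast
  qed
  then show ?thesis using lo by (simp add: f_def)
qed

lemma exp_diff_le:
  fixes x y c :: real assumes "x \<le> c" "y \<le> c"
  shows "\<bar>exp x - exp y\<bar> \<le> exp c * \<bar>x - y\<bar>"
proof -
  have *: "exp x - exp y \<le> exp c * \<bar>x - y\<bar>" if "x \<le> c" for x y :: real
  proof -
    have "exp x - exp y = exp x * (1 - exp (y - x))" by (simp add: algebra_simps exp_diff exp_minus)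
    also have "\<dots> \<le> exp x * \<bar>x - y\<bar>" using exp_ge_add_one_self[of "y - x"] abs_ge_self[of "x - y"]
      by (intro mult_left_mono) (linarith, simp)
    also have "\<dots> \<le> exp c * \<bar>x - y\<bar>" using that by (intro mult_right_mono) auto
    finally show ?thesis .
  qed
  show ?thesis using *[OF assms(1), of y] *[OF assms(2), of x] by (simp add: abs_minus_commute)
qed

text \<open>With two moments only, the remainder of the expansion is o(t^2) at 0. The statement
  trades this for a bound valid at every t: an arbitrarily small multiple of t^2, plus a multiple of
  t^4 that absorbs large t. Such a bound can be summed over random weights t once their second and
  fourth moments are controlled.\<close>

lemma (in prob_space) char_gauss_bound:
  fixes \<psi> :: "'a \<Rightarrow> real"
  assumes [measurable]: "\<psi> \<in> borel_measurable M" and i2: "integrable M (\<lambda>x. (\<psi> x)\<^sup>2)"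
    and mean: "expectation \<psi> = 0" and \<eta>: "\<eta> > 0"
  obtains C where "C \<ge> 0"
    "\<And>t. cmod ((\<integral>x. iexp (t * \<psi> x) \<partial>M) - complex_of_real (exp (- (expectation (\<lambda>x. (\<psi> x)\<^sup>2) * t\<^sup>2 / 2)))) \<le> \<eta> * t\<^sup>2 + C * t ^ 4"
proof -
  define J where "J = expectation (\<lambda>x. (\<psi> x)\<^sup>2)"
  have J0: "J \<ge> 0" by (simp add: J_def)
  have i1: "integrable M \<psi>"
    by (rule square_integrable_imp[OF finite_measure_axioms _ i2]) simp
  define m where "m t = expectation (\<lambda>x. min (6 * (\<psi> x)\<^sup>2) (\<bar>t\<bar> * \<bar>\<psi> x\<bar> ^ 3))" for t
  have im: "integrable M (\<lambda>x. min (6 * (\<psi> x)\<^sup>2) (\<bar>t\<bar> * \<bar>\<psi> x\<bar> ^ 3))" for t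
    by (rule Bochner_Integration.integrable_bound[of M "\<lambda>x. 6 * (\<psi> x)\<^sup>2"]) (use i2 in \<open>auto intro!: AE_I2\<close>)
  have approx: "cmod ((\<integral>x. iexp (t * \<psi> x) \<partial>M) - (1 - t\<^sup>2 * J / 2)) \<le> t\<^sup>2 / 6 * m t" for t
  proof -
    have "variance \<psi> = J" using mean by (simp add: J_def)
    from char_approx3'[OF _ i1 i2 mean this refl, of t]
    moreover have "char (distr M borel \<psi>) t = (\<integral>x. iexp (t * \<psi> x) \<partial>M)"
      unfolding char_def by (subst integral_distr) auto
    ultimately show ?thesis unfolding m_def by simp
  qed
  have m_le: "m t \<le> 6 * J" for t
  proof -
    have "m t \<le> (\<integral>x. 6 * (\<psi> x)\<^sup>2 \<partial>M)" unfolding m_def by (rule integral_mono[OF im]) (use i2 in auto)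
    then show ?thesis by (simp add: J_def)
  qed
  \<comment> \<open>Convergence along 1 / (n + 1) is enough, since m grows with |t|.\<close>
  have "(\<lambda>n. m (1 / real (Suc n))) \<longlonglongrightarrow> (\<integral>x. 0 \<partial>M)"
    unfolding m_def
  proof (rule integral_dominated_convergence[where w = "\<lambda>x. 6 * (\<psi> x)\<^sup>2"])
    show "AE x in M. (\<lambda>n. min (6 * (\<psi> x)\<^sup>2) (\<bar>1 / real (Suc n)\<bar> * \<bar>\<psi> x\<bar> ^ 3)) \<longlonglongrightarrow> 0"
    proof (rule AE_I2)
      fix x
      have "(\<lambda>n. min (6 * (\<psi> x)\<^sup>2) (\<bar>1 / real (Suc n)\<bar> * \<bar>\<psi> x\<bar> ^ 3)) \<longlonglongrightarrow> min (6 * (\<psi> x)\<^sup>2) (\<bar>0\<bar> * \<bar>\<psi> x\<bar> ^ 3)"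
        by (intro tendsto_intros LIMSEQ_Suc[OF lim_1_over_n])
      then show "(\<lambda>n. min (6 * (\<psi> x)\<^sup>2) (\<bar>1 / real (Suc n)\<bar> * \<bar>\<psi> x\<bar> ^ 3)) \<longlonglongrightarrow> 0" by simp
    qed
  qed (use i2 in auto)
  then have "\<forall>\<^sub>F n in sequentially. m (1 / real (Suc n)) < 6 * \<eta>"
    using \<eta> by (intro order_tendstoD) auto
  then obtain n where n: "m (1 / real (Suc n)) < 6 * \<eta>" by (auto simp: eventually_sequentially)
  define d where "d = 1 / real (Suc n)"
  have d: "d > 0" "m d < 6 * \<eta>" using n by (auto simp: d_def)
  \<comment> \<open>For |t| > d the crude bound m t \<le> 6 J is multiplied by t^2 / d^2 \<ge> 1,
    giving J / d^2. The term J^2 / 8 is the second-order error of exp (- J t^2 / 2).\<close>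
  define C where "C = J / d\<^sup>2 + J\<^sup>2 / 8"
  show ?thesis
  proof (rule that[of C])
    show "C \<ge> 0" using J0 by (simp add: C_def)
    fix t :: real
    have "t\<^sup>2 / 6 * m t \<le> \<eta> * t\<^sup>2 + J / d\<^sup>2 * t ^ 4"
    proof (cases "\<bar>t\<bar> \<le> d")
      case True
      have "m t \<le> m d" unfolding m_def
        by (rule integral_mono[OF im im], rule min.mono) (use True d in \<open>auto intro!: mult_right_mono\<close>)
      then have "t\<^sup>2 / 6 * m t \<le> t\<^sup>2 / 6 * (6 * \<eta>)" using d(2) by (intro mult_left_mono) auto
      moreover have "t\<^sup>2 / 6 * (6 * \<eta>) = \<eta> * t\<^sup>2" by simp
      moreover have "0 \<le> J / d\<^sup>2 * t ^ 4" using J0 by simp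
      ultimately show ?thesis by linarith
    next
      case False
      have "t\<^sup>2 / 6 * m t \<le> t\<^sup>2 / 6 * (6 * J)" using m_le by (intro mult_left_mono) auto
      also have "\<dots> = J * t\<^sup>2 * 1" by simp
      also have "\<dots> \<le> J * t\<^sup>2 * (t\<^sup>2 / d\<^sup>2)"
      proof (rule mult_left_mono)
        have "d\<^sup>2 \<le> t\<^sup>2" using False d(1) by (simp add: abs_le_square_iff[symmetric])
        then show "1 \<le> t\<^sup>2 / d\<^sup>2" using d(1) by simp
      qed (use J0 in simp)
      also have "\<dots> = J / d\<^sup>2 * t ^ 4" by (simp add: power2_eq_square power4_eq_xxxx)
      finally show ?thesis using \<eta> by (simp add: add.commute add_increasing)
    qed
    moreover have "\<bar>exp (- (J * t\<^sup>2 / 2)) - (1 - J * t\<^sup>2 / 2)\<bar> \<le> (J * t\<^sup>2 / 2)\<^sup>2 / 2"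
      using J0 by (intro exp_minus_taylor) simp
    moreover have "(J * t\<^sup>2 / 2)\<^sup>2 / 2 = J\<^sup>2 / 8 * t ^ 4" by (simp add: power2_eq_square power4_eq_xxxx)
    moreover have "cmod (complex_of_real (1 - t\<^sup>2 * J / 2) - complex_of_real (exp (- (J * t\<^sup>2 / 2)))) = \<bar>exp (- (J * t\<^sup>2 / 2)) - (1 - J * t\<^sup>2 / 2)\<bar>"
      unfolding of_real_diff[symmetric] norm_of_real by (simp add: abs_minus_commute mult.commute)
    moreover have "cmod ((\<integral>x. iexp (t * \<psi> x) \<partial>M) - complex_of_real (exp (- (J * t\<^sup>2 / 2)))) \<le>
       cmod ((\<integral>x. iexp (t * \<psi> x) \<partial>M) - (1 - t\<^sup>2 * J / 2)) + cmod (complex_of_real (1 - t\<^sup>2 * J / 2) - complex_of_real (exp (- (J * t\<^sup>2 / 2))))"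
      using norm_triangle_ineq[of "(\<integral>x. iexp (t * \<psi> x) \<partial>M) - (1 - t\<^sup>2 * J / 2)" "complex_of_real (1 - t\<^sup>2 * J / 2) - complex_of_real (exp (- (J * t\<^sup>2 / 2)))"] by simp
    ultimately have "cmod ((\<integral>x. iexp (t * \<psi> x) \<partial>M) - complex_of_real (exp (- (J * t\<^sup>2 / 2)))) \<le> \<eta> * t\<^sup>2 + J / d\<^sup>2 * t ^ 4 + J\<^sup>2 / 8 * t ^ 4"
      using approx[of t] by linarith
    then show "cmod ((\<integral>x. iexp (t * \<psi> x) \<partial>M) - complex_of_real (exp (- (expectation (\<lambda>x. (\<psi> x)\<^sup>2) * t\<^sup>2 / 2)))) \<le> \<eta> * t\<^sup>2 + C * t ^ 4"
      unfolding C_def J_def[symmetric] by (simp add: algebra_simps)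
  qed
qed

context ar_law
begin

text \<open>The compensated exponential \<open>Z j\<close> below would be a martingale if the conditional
  characteristic functions were exactly Gaussian; truncating the weights once the accumulated variance
  exceeds \<open>v + 1\<close> keeps it bounded.\<close>

lemma char_martingale_bound:
  fixes b :: "real \<Rightarrow> real"
  assumes bm[measurable]: "b \<in> borel_measurable borel"
    and J: "J \<ge> 0" and v: "v \<ge> 0" and \<kappa>: "0 \<le> \<kappa>" "\<kappa> \<le> 1" and \<eta>: "\<eta> \<ge> 0" "C \<ge> 0"
    and \<phi>: "\<And>t. cmod ((\<integral>e. iexp (t * score g e) \<partial>\<nu>) - complex_of_real (exp (- (J * t\<^sup>2 / 2)))) \<le> \<eta> * t\<^sup>2 + C * t ^ 4"
    and i2: "\<And>j. j \<ge> 1 \<Longrightarrow> integrable M (\<lambda>w. (b (X (j - 1) w))\<^sup>2)"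
    and i4: "\<And>j. j \<ge> 1 \<Longrightarrow> integrable M (\<lambda>w. (b (X (j - 1) w)) ^ 4)"
  defines "V \<equiv> \<lambda>n w. J * (\<Sum>j=1..n. (b (X (j - 1) w))\<^sup>2)"
  shows "cmod ((\<integral>w. iexp (\<Sum>j=1..k. score g (eps j w) * b (X (j - 1) w)) \<partial>M) * complex_of_real (exp (v / 2)) - 1) \<le>
    exp ((v + 1) / 2) * ((\<Sum>j=1..k. \<eta> * (\<integral>w. (b (X (j - 1) w))\<^sup>2 \<partial>M) + C * (\<integral>w. (b (X (j - 1) w)) ^ 4 \<partial>M))
      + \<kappa> + 2 * prob {w \<in> space M. \<bar>V k w - v\<bar> > \<kappa>})"
proof -
  let ?K = "exp ((v + 1) / 2)"
  \<comment> \<open>The test involves V j, which already contains the weight at index j. The weight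
    that would cross the level is itself dropped, and by monotonicity of V so are all later ones;
    the accumulated variance never overshoots v + 1.\<close>
  define b' where "b' j w = (if V j w \<le> v + 1 then b (X (j - 1) w) else 0)" for j w
  define V' where "V' n w = J * (\<Sum>j=1..n. (b' j w)\<^sup>2)" for n w
  define T where "T n w = (\<Sum>j=1..n. score g (eps j w) * b' j w)" for n w
  define Z where "Z n w = iexp (T n w) * exp (V' n w / 2)" for n w
  \<comment> \<open>Predictability: V n involves the states up to n - 1 only, hence the bound n
    \<le> Suc j in place of n \<le> j. The truncated weights inherit it.\<close>
  have V_F: "V n \<in> borel_measurable (F j)" if "n \<le> Suc j" for n j
  proof -
    have "(\<lambda>w. (b (X (i - 1) w))\<^sup>2) \<in> borel_measurable (F j)" if "i \<in> {1..n}" for i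
      by (rule measurable_compose[OF X_F]) (use that \<open>n \<le> Suc j\<close> in auto)
    then show ?thesis unfolding V_def by (intro borel_measurable_times borel_measurable_sum) auto
  qed
  have b'_F: "b' n \<in> borel_measurable (F j)" if "n \<le> Suc j" for n j
  proof -
    have [measurable]: "V n \<in> borel_measurable (F j)" by (rule V_F[OF that])
    have [measurable]: "(\<lambda>w. b (X (n - 1) w)) \<in> borel_measurable (F j)"
      by (rule measurable_compose[OF X_F bm]) (use that in auto)
    show ?thesis unfolding b'_def by measurable
  qed
  have V'_F: "V' n \<in> borel_measurable (F j)" if "n \<le> Suc j" for n j
    unfolding V'_def using b'_F that by (intro borel_measurable_times borel_measurable_sum borel_measurable_power) auto
  have T_F: "T n \<in> borel_measurable (F j)" if "n \<le> j" for n j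
    unfolding T_def using b'_F that eps_F
    by (intro borel_measurable_sum borel_measurable_times measurable_compose[OF _ score_meas(1)]) auto
  have V'm[measurable]: "V' n \<in> borel_measurable M" for n by (rule measurable_F[OF V'_F[of n n]]) simp
  have Tm[measurable]: "T n \<in> borel_measurable M" for n by (rule measurable_F[OF T_F[of n n]]) simp
  have b'm[measurable]: "b' n \<in> borel_measurable M" for n by (rule measurable_F[OF b'_F[of n n]]) simp
  have Vm[measurable]: "V n \<in> borel_measurable M" for n by (rule measurable_F[OF V_F[of n n]]) simp
  have V_mono: "V i w \<le> V j w" if "i \<le> j" for i j w
    unfolding V_def using J that by (intro mult_left_mono sum_mono2) auto
  have V'_le: "V' n w \<le> v + 1" for n w
  proof (induction n)
    case 0 then show ?case using v by (simp add: V'_def)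
  next
    case (Suc n)
    show ?case
    proof (cases "V (Suc n) w \<le> v + 1")
      case True
      have "b' j w = b (X (j - 1) w)" if "j \<in> {1..Suc n}" for j
        using V_mono[of j "Suc n" w] that True by (simp add: b'_def)
      then have "V' (Suc n) w = V (Suc n) w" unfolding V'_def V_def
        by (intro arg_cong2[where f = "(*)"] refl sum.cong) auto
      then show ?thesis using True by simp
    next
      case False
      then have "V' (Suc n) w = V' n w" by (simp add: V'_def b'_def)
      then show ?thesis using Suc by simp
    qed
  qed
  have b'_le: "(b' j w)\<^sup>2 \<le> (b (X (j - 1) w))\<^sup>2" "(b' j w) ^ 4 \<le> (b (X (j - 1) w)) ^ 4" for j w
    by (auto simp: b'_def)
  have expV: "exp (V' n w / 2) \<le> ?K" for n w using V'_le[of n w] by simp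
  have Zi: "integrable M (Z n)" for n
  proof (rule integrable_const_bound[of _ ?K])
    show "AE w in M. norm (Z n w) \<le> ?K" using expV by (intro AE_I2) (simp add: Z_def norm_mult)
    show "Z n \<in> borel_measurable M" unfolding Z_def by measurable
  qed
  have step: "cmod ((\<integral>w. Z (Suc n) w \<partial>M) - (\<integral>w. Z n w \<partial>M)) \<le>
     ?K * (\<eta> * (\<integral>w. (b (X n w))\<^sup>2 \<partial>M) + C * (\<integral>w. (b (X n w)) ^ 4 \<partial>M))" for n
  proof -
    \<comment> \<open>The next value of Z without its new exponential factor; it is determined by
      the history up to n, so the innovation n + 1 can be integrated out with W and the weight
      frozen.\<close>
    define W where "W w = iexp (T n w) * exp (V' (Suc n) w / 2)" for w
    let ?\<phi> = "\<lambda>t. \<integral>e. iexp (t * score g e) \<partial>\<nu>"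
    have W_F: "(\<lambda>w. (W w, b' (Suc n) w)) \<in> borel_measurable (F (Suc n - 1))"
    proof -
      have [measurable]: "T n \<in> borel_measurable (F n)" "V' (Suc n) \<in> borel_measurable (F n)" "b' (Suc n) \<in> borel_measurable (F n)"
        using T_F V'_F b'_F by auto
      have "W \<in> borel_measurable (F n)" unfolding W_def by measurable
      then show ?thesis by simp
    qed
    have Wm[measurable]: "W \<in> borel_measurable M" unfolding W_def by measurable
    have cW: "cmod (W w) \<le> ?K" for w using expV[of "Suc n" w] by (simp add: W_def norm_mult)
    let ?f = "\<lambda>p :: (complex \<times> real) \<times> real. fst (fst p) * iexp (snd (fst p) * score g (snd p))"
    have Zs: "Z (Suc n) w = ?f ((W w, b' (Suc n) w), eps (Suc n) w)" for w
      by (simp add: Z_def W_def T_def distrib_left exp_add mult_ac)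
    have fm: "?f \<in> borel_measurable (borel \<Otimes>\<^sub>M borel)"
    proof -
      have "?f \<in> borel_measurable ((borel \<Otimes>\<^sub>M borel) \<Otimes>\<^sub>M borel)" by measurable
      then show ?thesis by (simp add: borel_prod)
    qed
    have "(\<integral>w. Z (Suc n) w \<partial>M) = (\<integral>w. (\<integral>e. ?f ((W w, b' (Suc n) w), e) \<partial>\<nu>) \<partial>M)"
      unfolding Zs by (rule integral_joint[OF W_F _ fm]) (use Zi[of "Suc n"] in \<open>simp_all add: Zs[abs_def]\<close>)
    also have "\<dots> = (\<integral>w. W w * ?\<phi> (b' (Suc n) w) \<partial>M)" by simp
    finally have E1: "(\<integral>w. Z (Suc n) w \<partial>M) = (\<integral>w. W w * ?\<phi> (b' (Suc n) w) \<partial>M)" .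
    \<comment> \<open>The previous value of Z has the same prefactor W times the Gaussian factor, so
      the increment in mean is W times the error of the Gaussian approximation at the current
      weight.\<close>
    have Zn: "Z n w = W w * exp (- (J * (b' (Suc n) w)\<^sup>2 / 2))" for w
    proof -
      have "V' (Suc n) w = V' n w + J * (b' (Suc n) w)\<^sup>2" by (simp add: V'_def algebra_simps)
      then have "exp (V' n w / 2) = exp (V' (Suc n) w / 2) * exp (- (J * (b' (Suc n) w)\<^sup>2 / 2))"
        unfolding exp_add[symmetric] by (simp add: add_divide_distrib)
      then show ?thesis unfolding Z_def W_def by simp
    qed
    interpret N: prob_space \<nu> by (rule prob_space_\<nu>)
    have \<phi>m: "(\<lambda>t. ?\<phi> t) \<in> borel_measurable borel"
      by (rule N.borel_measurable_lebesgue_integral) measurable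
    have \<phi>1: "cmod (?\<phi> t) \<le> 1" for t
      using order_trans[OF integral_norm_bound[of \<nu> "\<lambda>e. iexp (t * score g e)"]] by (simp add: N.prob_space)
    have iW: "integrable M (\<lambda>w. W w * ?\<phi> (b' (Suc n) w))"
    proof (rule integrable_const_bound[of _ ?K])
      show "AE w in M. norm (W w * ?\<phi> (b' (Suc n) w)) \<le> ?K"
      proof (rule AE_I2)
        fix w
        have "norm (W w * ?\<phi> (b' (Suc n) w)) \<le> ?K * 1"
          unfolding norm_mult by (intro mult_mono cW \<phi>1) auto
        then show "norm (W w * ?\<phi> (b' (Suc n) w)) \<le> ?K" by simp
      qed
      show "(\<lambda>w. W w * ?\<phi> (b' (Suc n) w)) \<in> borel_measurable M"
        by (intro borel_measurable_times Wm measurable_compose[OF b'm \<phi>m])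
    qed
    have ib: "integrable M (\<lambda>w. (b (X n w))\<^sup>2)" "integrable M (\<lambda>w. (b (X n w)) ^ 4)"
      using i2[of "Suc n"] i4[of "Suc n"] by auto
    have "(\<integral>w. Z (Suc n) w \<partial>M) - (\<integral>w. Z n w \<partial>M) = (\<integral>w. W w * ?\<phi> (b' (Suc n) w) - Z n w \<partial>M)"
      unfolding E1 by (rule Bochner_Integration.integral_diff[OF iW Zi, symmetric])
    also have "cmod \<dots> \<le> (\<integral>w. cmod (W w * ?\<phi> (b' (Suc n) w) - Z n w) \<partial>M)"
      by (rule integral_norm_bound)
    also have "\<dots> \<le> (\<integral>w. ?K * (\<eta> * (b (X n w))\<^sup>2 + C * (b (X n w)) ^ 4) \<partial>M)"
    proof (rule integral_mono)
      show "integrable M (\<lambda>w. cmod (W w * ?\<phi> (b' (Suc n) w) - Z n w))"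
        by (intro integrable_norm Bochner_Integration.integrable_diff iW Zi)
      show "integrable M (\<lambda>w. ?K * (\<eta> * (b (X n w))\<^sup>2 + C * (b (X n w)) ^ 4))" using ib by simp
      fix w
      let ?t = "b' (Suc n) w"
      have "cmod (W w * ?\<phi> ?t - Z n w) = cmod (W w) * cmod (?\<phi> ?t - complex_of_real (exp (- (J * ?t\<^sup>2 / 2))))"
        unfolding Zn norm_mult[symmetric] by (simp add: algebra_simps)
      also have "\<dots> \<le> ?K * (\<eta> * ?t\<^sup>2 + C * ?t ^ 4)" by (rule mult_mono[OF cW \<phi>[of "b' (Suc n) w"]]) simp_all
      also have "\<dots> \<le> ?K * (\<eta> * (b (X n w))\<^sup>2 + C * (b (X n w)) ^ 4)"
        using b'_le[of "Suc n" w] \<eta> by (intro mult_left_mono add_mono) auto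
      finally show "cmod (W w * ?\<phi> ?t - Z n w) \<le> ?K * (\<eta> * (b (X n w))\<^sup>2 + C * (b (X n w)) ^ 4)" .
    qed
    also have "\<dots> = ?K * (\<eta> * (\<integral>w. (b (X n w))\<^sup>2 \<partial>M) + C * (\<integral>w. (b (X n w)) ^ 4 \<partial>M))"
      using ib by simp
    finally show ?thesis .
  qed
  have tele: "cmod ((\<integral>w. Z n w \<partial>M) - 1) \<le>
     ?K * (\<Sum>j=1..n. \<eta> * (\<integral>w. (b (X (j - 1) w))\<^sup>2 \<partial>M) + C * (\<integral>w. (b (X (j - 1) w)) ^ 4 \<partial>M))" for n
  proof (induction n)
    case 0 then show ?case by (simp add: Z_def T_def V'_def prob_space)
  next
    case (Suc n)
    have "cmod ((\<integral>w. Z (Suc n) w \<partial>M) - 1) \<le> cmod ((\<integral>w. Z (Suc n) w \<partial>M) - (\<integral>w. Z n w \<partial>M)) + cmod ((\<integral>w. Z n w \<partial>M) - 1)"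
      using norm_triangle_ineq[of "(\<integral>w. Z (Suc n) w \<partial>M) - (\<integral>w. Z n w \<partial>M)" "(\<integral>w. Z n w \<partial>M) - 1"] by simp
    then show ?case using step[of n] Suc by (simp add: distrib_left)
  qed
  let ?S = "\<lambda>w. \<Sum>j=1..k. score g (eps j w) * b (X (j - 1) w)"
  let ?G = "{w \<in> space M. \<bar>V k w - v\<bar> > \<kappa>}"
  have Si: "integrable M (\<lambda>w. iexp (?S w) * exp (v / 2))"
    by (rule integrable_const_bound[of _ "exp (v / 2)"]) (auto simp: norm_mult)
  have Gm[measurable]: "?G \<in> sets M" by measurable
  \<comment> \<open>Off the exceptional event V k is at most v + \<kappa> \<le> v + 1, so no weight
    has been truncated and Z k differs from the target only through V k in place of v. On it both
    terms are bounded by \<open>?K\<close>.\<close>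
  have pw: "cmod (iexp (?S w) * exp (v / 2) - Z k w) \<le> ?K * (\<kappa> + 2 * indicator ?G w)" if w: "w \<in> space M" for w
  proof (cases "w \<in> ?G")
    case True
    have "cmod (iexp (?S w) * exp (v / 2) - Z k w) \<le> exp (v / 2) + exp (V' k w / 2)"
      using norm_triangle_ineq4[of "iexp (?S w) * exp (v / 2)" "Z k w"] by (simp add: Z_def norm_mult)
    also have "\<dots> \<le> ?K + ?K" using expV by (intro add_mono) auto
    also have "\<dots> \<le> ?K * (\<kappa> + 2 * indicator ?G w)" using True \<kappa> by (simp add: distrib_left)
    finally show ?thesis .
  next
    case False
    then have Vk: "\<bar>V k w - v\<bar> \<le> \<kappa>" using w by simp
    have b'b: "b' j w = b (X (j - 1) w)" if "j \<in> {1..k}" for j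
      using V_mono[of j k w] that Vk \<kappa> by (simp add: b'_def)
    have TS: "T k w = ?S w" unfolding T_def using b'b by (intro sum.cong) auto
    have VV: "V' k w = V k w" unfolding V'_def V_def using b'b by (intro arg_cong2[where f = "(*)"] refl sum.cong) auto
    have "iexp (?S w) * exp (v / 2) - Z k w = iexp (?S w) * complex_of_real (exp (v / 2) - exp (V k w / 2))"
      by (simp add: Z_def TS VV algebra_simps)
    then have "cmod (iexp (?S w) * exp (v / 2) - Z k w) = \<bar>exp (v / 2) - exp (V k w / 2)\<bar>"
      by (simp only: norm_mult norm_exp_i_times norm_of_real mult_1_left)
    also have "\<dots> \<le> ?K * \<bar>v / 2 - V k w / 2\<bar>" using Vk \<kappa> by (intro exp_diff_le) auto
    also have "\<dots> \<le> ?K * (\<kappa> + 2 * indicator ?G w)" using Vk False by (intro mult_left_mono) auto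
    finally show ?thesis .
  qed
  have iG: "integrable M (indicator ?G :: _ \<Rightarrow> real)"
    by (rule integrable_const_bound[of _ 1]) (auto simp: indicator_def)
  have "(\<integral>w. iexp (?S w) \<partial>M) * exp (v / 2) - (\<integral>w. Z k w \<partial>M) = (\<integral>w. iexp (?S w) * exp (v / 2) - Z k w \<partial>M)"
    using Bochner_Integration.integral_diff[OF Si Zi[of k]] by simp
  also have "cmod \<dots> \<le> (\<integral>w. cmod (iexp (?S w) * exp (v / 2) - Z k w) \<partial>M)" by (rule integral_norm_bound)
  also have "\<dots> \<le> (\<integral>w. ?K * (\<kappa> + 2 * indicator ?G w) \<partial>M)"
    by (rule integral_mono) (use Si Zi iG pw in auto)
  also have "\<dots> = ?K * (\<kappa> + 2 * prob ?G)" using iG by (simp add: prob_space)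
  finally have d: "cmod ((\<integral>w. iexp (?S w) \<partial>M) * exp (v / 2) - (\<integral>w. Z k w \<partial>M)) \<le> ?K * (\<kappa> + 2 * prob ?G)" .
  have "cmod ((\<integral>w. iexp (?S w) \<partial>M) * complex_of_real (exp (v / 2)) - 1) \<le>
      cmod ((\<integral>w. iexp (?S w) \<partial>M) * exp (v / 2) - (\<integral>w. Z k w \<partial>M)) + cmod ((\<integral>w. Z k w \<partial>M) - 1)"
    using norm_triangle_ineq[of "(\<integral>w. iexp (?S w) \<partial>M) * exp (v / 2) - (\<integral>w. Z k w \<partial>M)" "(\<integral>w. Z k w \<partial>M) - 1"] by simp
  then show ?thesis using d tele[of k] by (simp add: distrib_left)
qed

end

section \<open>Limit theorems along parameter sequences\<close>

lemma borel_measurable_vecI: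
  fixes f :: "'a \<Rightarrow> ('b::euclidean_space)^'n"
  assumes "\<And>i. (\<lambda>x. f x $ i) \<in> borel_measurable M"
  shows "f \<in> borel_measurable M"
  by (subst borel_measurable_euclidean_space) (use assms in \<open>auto simp: Basis_vec_def inner_axis\<close>)

text \<open>A partial derivative is a pointwise limit of difference quotients; the index is shifted
  by N so that all displaced parameters lie in U, where measurability is available.\<close>

lemma borel_measurable_grad_nth:
  fixes f :: "real^'d \<Rightarrow> 'a \<Rightarrow> real"
  assumes U: "open U" "t \<in> U" and f: "\<And>s. s \<in> U \<Longrightarrow> f s \<in> borel_measurable M"
    and d: "\<And>x. x \<in> space M \<Longrightarrow> (\<lambda>s. f s x) differentiable (at t)"
  shows "(\<lambda>x. grad (\<lambda>s. f s x) t $ i) \<in> borel_measurable M"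
proof -
  let ?s = "\<lambda>n. t + (1 / real (Suc n)) *\<^sub>R axis i (1::real)"
  have "?s \<longlonglongrightarrow> t + 0 *\<^sub>R axis i 1"
    by (intro tendsto_intros LIMSEQ_Suc[OF lim_1_over_n])
  then have "\<forall>\<^sub>F n in sequentially. ?s n \<in> U" using U by (intro topological_tendstoD) auto
  then obtain N where N: "\<And>n. n \<ge> N \<Longrightarrow> ?s n \<in> U" by (auto simp: eventually_sequentially)
  let ?r = "\<lambda>n. 1 / real (Suc (n + N))"
  have m: "(\<lambda>x. (f (?s (n + N)) x - f t x) / ?r n) \<in> borel_measurable M" for n
    using f[OF N[of "n + N"]] f[OF U(2)] by simp
  show ?thesis
  proof (rule borel_measurable_LIMSEQ_real[OF _ m])
    fix x assume x: "x \<in> space M"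
    have "((\<lambda>s. f s x) has_derivative (\<lambda>v. grad (\<lambda>s. f s x) t \<bullet> v)) (at t)"
      by (rule grad_has_derivative[OF d[OF x]])
    then have "((\<lambda>r. f (t + r *\<^sub>R axis i 1) x) has_derivative (\<lambda>r. grad (\<lambda>s. f s x) t \<bullet> (r *\<^sub>R axis i 1))) (at (0::real))"
      by (intro has_derivative_compose[of "\<lambda>r. t + r *\<^sub>R axis i 1" "\<lambda>r. r *\<^sub>R axis i 1" 0 UNIV "\<lambda>s. f s x"])
        (auto intro!: derivative_eq_intros)
    then have "((\<lambda>r. f (t + r *\<^sub>R axis i 1) x) has_real_derivative (grad (\<lambda>s. f s x) t $ i)) (at 0)"
      by (simp add: has_field_derivative_def inner_axis mult_commute_abs)
    then have L: "((\<lambda>r. (f (t + r *\<^sub>R axis i 1) x - f t x) / r) \<longlongrightarrow> grad (\<lambda>s. f s x) t $ i) (at 0)"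
      by (simp add: DERIV_def)
    have "?r \<longlonglongrightarrow> 0"
      using LIMSEQ_ignore_initial_segment[OF LIMSEQ_Suc[OF lim_1_over_n], of N] by simp
    then have "filterlim ?r (at 0) sequentially" by (auto simp: filterlim_at)
    from filterlim_compose[OF L this]
    show "(\<lambda>n. (f (?s (n + N)) x - f t x) / ?r n) \<longlonglongrightarrow> grad (\<lambda>s. f s x) t $ i" by simp
  qed
qed

lemma outer_mult_vec: "outer v *v u = (v \<bullet> u) *\<^sub>R v"
  by (simp add: vec_eq_iff outer_def matrix_vector_mult_def inner_vec_def sum_distrib_left sum_distrib_right mult_ac)

lemma norm_outer_le: "norm (outer v) \<le> (norm v)\<^sup>2"
proof -
  have "norm (outer v) = L2_set (\<lambda>i. \<bar>v $ i\<bar> * norm v) UNIV"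
    unfolding norm_vec_def[of "outer v"]
  proof (rule L2_set_cong[OF refl])
    fix i
    have "outer v $ i = v $ i *\<^sub>R v" by (simp add: outer_def vec_eq_iff)
    then show "norm (outer v $ i) = \<bar>v $ i\<bar> * norm v" by simp
  qed
  also have "\<dots> = (norm v)\<^sup>2"
    by (simp add: L2_set_left_distrib[symmetric] norm_vec_def[of v] power2_eq_square)
  finally show ?thesis by simp
qed

lemma continuous_on_mult_vec: "continuous_on UNIV (\<lambda>A :: real^'n^'m. A *v u)"
proof -
  have "linear (\<lambda>A :: real^'n^'m. A *v u)"
    by (rule linearI) (simp_all add: matrix_vector_mult_add_rdistrib scaleR_matrix_vector_assoc)
  then show ?thesis by (rule linear_continuous_on[OF linear_conv_bounded_linear[THEN iffD1]])
qed

section \<open>The model over the whole parameter set\<close>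

locale ar_model =
  fixes \<Theta> :: "(real^'d) set" and S :: "real^'d \<Rightarrow> real \<Rightarrow> real" and g :: "real \<Rightarrow> real"
    and P :: "real^'d \<Rightarrow> 'w measure" and X :: "nat \<Rightarrow> 'w \<Rightarrow> real"
    and R1 R2 R3 :: "real \<Rightarrow> real \<Rightarrow> real" and C L c :: real
  assumes Theta: "open \<Theta>" "convex \<Theta>"
    and law: "\<And>\<theta>. \<theta> \<in> \<Theta> \<Longrightarrow> ar_law (P \<theta>) X (S \<theta>) g"
    and S_C3: "\<And>x. C3_on \<Theta> (\<lambda>\<theta>. S \<theta> x)"
    and g_pos: "\<And>x. g x > 0" and g_C3: "C3_real g"
    and R_bound: "\<And>x x' \<theta>. \<theta> \<in> \<Theta> \<Longrightarrow> norm (dell S g \<theta> x x') \<le> R1 x x'"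
      "\<And>x x' \<theta>. \<theta> \<in> \<Theta> \<Longrightarrow> norm (ddell S g \<theta> x x') \<le> R2 x x'"
      "\<And>x x' \<theta>. \<theta> \<in> \<Theta> \<Longrightarrow> norm (dddell S g \<theta> x x') \<le> R3 x x'"
    and R_int: "\<And>\<theta> j. \<theta> \<in> \<Theta> \<Longrightarrow> j \<ge> 1 \<Longrightarrow> integrable (P \<theta>) (\<lambda>w. (R1 (X (j - 1) w) (X j w))\<^sup>2)"
      "\<And>\<theta> j. \<theta> \<in> \<Theta> \<Longrightarrow> j \<ge> 1 \<Longrightarrow> integrable (P \<theta>) (\<lambda>w. (R2 (X (j - 1) w) (X j w))\<^sup>2)"
      "\<And>\<theta> j. \<theta> \<in> \<Theta> \<Longrightarrow> j \<ge> 1 \<Longrightarrow> integrable (P \<theta>) (\<lambda>w. (R3 (X (j - 1) w) (X j w))\<^sup>2)"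
    and R_le: "\<And>\<theta> j. \<theta> \<in> \<Theta> \<Longrightarrow> j \<ge> 1 \<Longrightarrow> (\<integral>w. (R1 (X (j - 1) w) (X j w))\<^sup>2 \<partial>P \<theta>) \<le> C"
      "\<And>\<theta> j. \<theta> \<in> \<Theta> \<Longrightarrow> j \<ge> 1 \<Longrightarrow> (\<integral>w. (R2 (X (j - 1) w) (X j w))\<^sup>2 \<partial>P \<theta>) \<le> C"
      "\<And>\<theta> j. \<theta> \<in> \<Theta> \<Longrightarrow> j \<ge> 1 \<Longrightarrow> (\<integral>w. (R3 (X (j - 1) w) (X j w))\<^sup>2 \<partial>P \<theta>) \<le> C"
    and tight_hess: "tight_uc \<Theta> P
           (\<lambda>n \<theta> w. (1 / sqrt (real n)) *\<^sub>R
              (\<Sum>j=1..n. ddell S g \<theta> (X (j - 1) w) (X j w) + fisher S g P X \<theta>))"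
    and Lip: "\<And>\<theta>1 \<theta>2. \<theta>1 \<in> \<Theta> \<Longrightarrow> \<theta>2 \<in> \<Theta> \<Longrightarrow>
           norm (fisher S g P X \<theta>1 - fisher S g P X \<theta>2) \<le> L * norm (\<theta>1 - \<theta>2)"
    and nondeg: "c > 0" "\<And>\<theta> u. \<theta> \<in> \<Theta> \<Longrightarrow> norm u = 1 \<Longrightarrow> c \<le> u \<bullet> (fisher S g P X \<theta> *v u)"
begin

abbreviation "I \<theta> \<equiv> fisher S g P X \<theta>"
definition "h \<theta> x = grad (\<lambda>t. S t x) \<theta>"
definition "H \<theta> x = hess (\<lambda>t. S t x) \<theta>"
abbreviation "e \<theta> \<equiv> ar_law.eps X (S \<theta>)"
abbreviation "\<nu> \<equiv> ar_law.\<nu> g"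
text \<open>The Fisher information of the noise for a location shift.\<close>

definition "J = (\<integral>e. (score g e)\<^sup>2 \<partial>\<nu>)"

lemma prob_P: "\<theta> \<in> \<Theta> \<Longrightarrow> prob_space (P \<theta>)"
  using law ar_law.axioms(1) by blast

lemma X_measurable: "\<theta> \<in> \<Theta> \<Longrightarrow> X j \<in> borel_measurable (P \<theta>)"
  using law ar_law.X_meas by blast

lemma S_measurable: "\<theta> \<in> \<Theta> \<Longrightarrow> S \<theta> \<in> borel_measurable borel"
  using law ar_law.s_meas by blast

lemma h_measurable: "\<theta> \<in> \<Theta> \<Longrightarrow> h \<theta> \<in> borel_measurable borel"
  unfolding h_def[abs_def]
  by (rule borel_measurable_vecI, rule borel_measurable_grad_nth[OF Theta(1)])
    (use S_measurable S_C3 in \<open>auto simp: C3_on_def\<close>)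

lemma H_measurable: "\<theta> \<in> \<Theta> \<Longrightarrow> H \<theta> \<in> borel_measurable borel"
  unfolding H_def[abs_def]
proof (intro borel_measurable_vecI)
  fix i j assume t: "\<theta> \<in> \<Theta>"
  have "(\<lambda>x. grad (\<lambda>s. grad (\<lambda>t. S t x) s $ i) \<theta> $ j) \<in> borel_measurable borel"
  proof (rule borel_measurable_grad_nth[OF Theta(1) t])
    fix s assume "s \<in> \<Theta>"
    note [measurable] = h_measurable[OF this]
    have "(\<lambda>x. h s x \<bullet> axis i 1) \<in> borel_measurable borel" by measurable
    then show "(\<lambda>x. grad (\<lambda>t. S t x) s $ i) \<in> borel_measurable borel"
      by (simp add: inner_axis h_def)
  qed (use S_C3 t in \<open>auto simp: C3_on_def\<close>)
  then show "(\<lambda>x. hess (\<lambda>t. S t x) \<theta> $ i $ j) \<in> borel_measurable borel" by (simp add: hess_nth)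
qed

lemma dell_eq: "\<theta> \<in> \<Theta> \<Longrightarrow> dell S g \<theta> x x' = - score g (x' - S \<theta> x) *\<^sub>R h \<theta> x"
  unfolding h_def by (rule ell_smooth(1)[OF Theta(1) S_C3 g_C3 g_pos])

lemma ddell_eq: "\<theta> \<in> \<Theta> \<Longrightarrow> ddell S g \<theta> x x' = dscore g (x' - S \<theta> x) *\<^sub>R outer (h \<theta> x) - score g (x' - S \<theta> x) *\<^sub>R H \<theta> x"
  unfolding h_def H_def by (rule ell_smooth(2)[OF Theta(1) S_C3 g_C3 g_pos])

lemma dell_measurable:
  assumes t: "\<theta> \<in> \<Theta>" and [measurable]: "Y \<in> borel_measurable N" "Y' \<in> borel_measurable N"
  shows "(\<lambda>w. dell S g \<theta> (Y w) (Y' w)) \<in> borel_measurable N"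
proof -
  note [measurable] = h_measurable[OF t] S_measurable[OF t] score_measurable[OF g_C3 g_pos]
  show ?thesis unfolding dell_eq[OF t] by measurable
qed

lemma outer_measurable: "outer \<in> borel_measurable borel"
  unfolding outer_def[abs_def]
  by (intro borel_measurable_vecI) simp

lemma ddell_measurable:
  assumes t: "\<theta> \<in> \<Theta>" and [measurable]: "Y \<in> borel_measurable N" "Y' \<in> borel_measurable N"
  shows "(\<lambda>w. ddell S g \<theta> (Y w) (Y' w)) \<in> borel_measurable N"
proof -
  note [measurable] = h_measurable[OF t] H_measurable[OF t] S_measurable[OF t] score_measurable[OF g_C3 g_pos] outer_measurable
  show ?thesis unfolding ddell_eq[OF t] by measurable
qed

lemma e_eq: "e \<theta> j w = X j w - S \<theta> (X (j - 1) w)" if "\<theta> \<in> \<Theta>"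
  using ar_law.eps_def[OF law[OF that]] .

lemma inner_dell:
  "\<theta> \<in> \<Theta> \<Longrightarrow> u \<bullet> dell S g \<theta> (X (j - 1) w) (X j w) = score g (e \<theta> j w) * (- (u \<bullet> h \<theta> (X (j - 1) w)))"
  by (simp add: dell_eq e_eq)

lemma inner_ddell:
  "\<theta> \<in> \<Theta> \<Longrightarrow> u \<bullet> (ddell S g \<theta> (X (j - 1) w) (X j w) *v u) =
     dscore g (e \<theta> j w) * (u \<bullet> h \<theta> (X (j - 1) w))\<^sup>2 - score g (e \<theta> j w) * (u \<bullet> (H \<theta> (X (j - 1) w) *v u))"
  by (simp add: ddell_eq e_eq matrix_vector_mult_diff_rdistrib scaleR_matrix_vector_assoc[symmetric]
      outer_mult_vec inner_diff_right power2_eq_square inner_commute)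

lemma inner_dell_sq:
  assumes t: "\<theta> \<in> \<Theta>" and j: "j \<ge> 1"
  shows "integrable (P \<theta>) (\<lambda>w. (u \<bullet> dell S g \<theta> (X (j - 1) w) (X j w))\<^sup>2)"
    "(\<integral>w. (u \<bullet> dell S g \<theta> (X (j - 1) w) (X j w))\<^sup>2 \<partial>P \<theta>) \<le> (norm u)\<^sup>2 * C"
proof -
  note [measurable] = X_measurable[OF t] dell_measurable[OF t]
  have le: "(u \<bullet> dell S g \<theta> x x')\<^sup>2 \<le> (norm u)\<^sup>2 * (R1 x x')\<^sup>2" for x x'
  proof -
    have "\<bar>u \<bullet> dell S g \<theta> x x'\<bar> \<le> norm u * R1 x x'"
      using Cauchy_Schwarz_ineq2[of u "dell S g \<theta> x x'"] R_bound(1)[OF t, of x x']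
      by (meson mult_left_mono norm_ge_zero order_trans)
    from power_mono[OF this abs_ge_zero, of 2] show ?thesis by (simp only: power2_abs power_mult_distrib)
  qed
  show i: "integrable (P \<theta>) (\<lambda>w. (u \<bullet> dell S g \<theta> (X (j - 1) w) (X j w))\<^sup>2)"
    by (rule Bochner_Integration.integrable_bound[of _ "\<lambda>w. (norm u)\<^sup>2 * (R1 (X (j - 1) w) (X j w))\<^sup>2"])
      (use R_int(1)[OF t j] le in auto)
  have "(\<integral>w. (u \<bullet> dell S g \<theta> (X (j - 1) w) (X j w))\<^sup>2 \<partial>P \<theta>) \<le> (\<integral>w. (norm u)\<^sup>2 * (R1 (X (j - 1) w) (X j w))\<^sup>2 \<partial>P \<theta>)"
    by (rule integral_mono[OF i]) (use R_int(1)[OF t j] le in auto)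
  also have "\<dots> \<le> (norm u)\<^sup>2 * C" using R_le(1)[OF t j] by (simp add: mult_left_mono)
  finally show "(\<integral>w. (u \<bullet> dell S g \<theta> (X (j - 1) w) (X j w))\<^sup>2 \<partial>P \<theta>) \<le> (norm u)\<^sup>2 * C" .
qed

lemma inner_ddell_sq:
  assumes t: "\<theta> \<in> \<Theta>" and j: "j \<ge> 1"
  shows "integrable (P \<theta>) (\<lambda>w. (u \<bullet> (ddell S g \<theta> (X (j - 1) w) (X j w) *v u))\<^sup>2)"
    "(\<integral>w. (u \<bullet> (ddell S g \<theta> (X (j - 1) w) (X j w) *v u))\<^sup>2 \<partial>P \<theta>) \<le> (norm u) ^ 4 * C"
proof -
  note [measurable] = X_measurable[OF t] ddell_measurable[OF t] borel_measurable_continuous_onI[OF continuous_on_mult_vec]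
  have le: "(u \<bullet> (ddell S g \<theta> x x' *v u))\<^sup>2 \<le> (norm u) ^ 4 * (R2 x x')\<^sup>2" for x x'
  proof -
    have "\<bar>u \<bullet> (ddell S g \<theta> x x' *v u)\<bar> \<le> norm u * (norm (ddell S g \<theta> x x') * norm u)"
      using Cauchy_Schwarz_ineq2[of u "ddell S g \<theta> x x' *v u"] norm_matrix_vector_mult_le[of "ddell S g \<theta> x x'" u]
      by (meson mult_left_mono norm_ge_zero order_trans)
    also have "\<dots> \<le> norm u * (R2 x x' * norm u)"
      using R_bound(2)[OF t, of x x'] by (intro mult_left_mono mult_right_mono) auto
    finally have "\<bar>u \<bullet> (ddell S g \<theta> x x' *v u)\<bar> \<le> (norm u)\<^sup>2 * R2 x x'" by (simp add: power2_eq_square mult_ac)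
    from power_mono[OF this abs_ge_zero, of 2] show ?thesis
      by (simp only: power2_abs power_mult_distrib power_mult[symmetric]) simp
  qed
  show i: "integrable (P \<theta>) (\<lambda>w. (u \<bullet> (ddell S g \<theta> (X (j - 1) w) (X j w) *v u))\<^sup>2)"
    by (rule Bochner_Integration.integrable_bound[of _ "\<lambda>w. (norm u) ^ 4 * (R2 (X (j - 1) w) (X j w))\<^sup>2"])
      (use R_int(2)[OF t j] le in auto)
  have "(\<integral>w. (u \<bullet> (ddell S g \<theta> (X (j - 1) w) (X j w) *v u))\<^sup>2 \<partial>P \<theta>) \<le> (\<integral>w. (norm u) ^ 4 * (R2 (X (j - 1) w) (X j w))\<^sup>2 \<partial>P \<theta>)"
    by (rule integral_mono[OF i]) (use R_int(2)[OF t j] le in auto)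
  also have "\<dots> \<le> (norm u) ^ 4 * C" using R_le(2)[OF t j] by (simp add: mult_left_mono)
  finally show "(\<integral>w. (u \<bullet> (ddell S g \<theta> (X (j - 1) w) (X j w) *v u))\<^sup>2 \<partial>P \<theta>) \<le> (norm u) ^ 4 * C" .
qed

lemma fisher_inner:
  assumes t: "\<theta> \<in> \<Theta>"
  shows "transpose (I \<theta>) = I \<theta>"
    "u \<bullet> (I \<theta> *v u) = (\<integral>w. (u \<bullet> dell S g \<theta> (X 0 w) (X 1 w))\<^sup>2 \<partial>P \<theta>)"
proof -
  note [measurable] = X_measurable[OF t] dell_measurable[OF t] outer_measurable
  let ?d = "\<lambda>w. dell S g \<theta> (X 0 w) (X 1 w)"
  have i: "integrable (P \<theta>) (\<lambda>w. outer (?d w))"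
  proof (rule Bochner_Integration.integrable_bound)
    show "integrable (P \<theta>) (\<lambda>w. (R1 (X 0 w) (X 1 w))\<^sup>2)" using R_int(1)[OF t, of 1] by simp
    show "AE w in P \<theta>. norm (outer (?d w)) \<le> norm ((R1 (X 0 w) (X 1 w))\<^sup>2)"
    proof (rule AE_I2)
      fix w
      show "norm (outer (?d w)) \<le> norm ((R1 (X 0 w) (X 1 w))\<^sup>2)"
        using norm_outer_le[of "?d w"] power_mono[OF R_bound(1)[OF t, of "X 0 w" "X 1 w"], of 2] by simp
    qed
  qed measurable
  have lin1: "bounded_linear (\<lambda>A :: real^'d^'d. transpose A)"
    by (simp add: linear_conv_bounded_linear[symmetric]) (rule linearI; simp add: transpose_def vec_eq_iff)
  have "transpose (I \<theta>) = (\<integral>w. transpose (outer (?d w)) \<partial>P \<theta>)"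
    unfolding fisher_def by (rule integral_bounded_linear[OF lin1 i, symmetric])
  also have "\<dots> = I \<theta>" unfolding fisher_def by (simp add: transpose_def outer_def mult.commute)
  finally show "transpose (I \<theta>) = I \<theta>" .
  have lin2: "bounded_linear (\<lambda>A :: real^'d^'d. u \<bullet> (A *v u))"
    by (simp add: linear_conv_bounded_linear[symmetric])
      (rule linearI; simp add: matrix_vector_mult_add_rdistrib inner_add_right scaleR_matrix_vector_assoc[symmetric])
  have "u \<bullet> (I \<theta> *v u) = (\<integral>w. u \<bullet> (outer (?d w) *v u) \<partial>P \<theta>)"
    unfolding fisher_def by (rule integral_bounded_linear[OF lin2 i, symmetric])
  then show "u \<bullet> (I \<theta> *v u) = (\<integral>w. (u \<bullet> ?d w)\<^sup>2 \<partial>P \<theta>)"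
    by (simp add: outer_mult_vec inner_commute power2_eq_square)
qed

text \<open>Nondegeneracy in one unit direction makes the second moment of that score component at
  least c > 0, which feeds the factorisation argument. It also shows that the direction's component
  of h is not almost surely zero, as the argument for \<open>dscore\<close> requires.\<close>

lemma noise_moments:
  assumes t: "\<theta> \<in> \<Theta>"
  shows "integrable \<nu> (\<lambda>e. (score g e)\<^sup>2)" "J > 0" "integrable \<nu> (\<lambda>e. (dscore g e)\<^sup>2)"
proof -
  interpret A: ar_law "P \<theta>" X "S \<theta>" g by (rule law[OF t])
  obtain u :: "real^'d" where u: "norm u = 1" using vector_choose_size[of 1] by auto
  note [measurable] = h_measurable[OF t] H_measurable[OF t] borel_measurable_continuous_onI[OF continuous_on_mult_vec]
  have am: "(\<lambda>x. - (u \<bullet> h \<theta> x)) \<in> borel_measurable borel" by measurable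
  have Am: "(\<lambda>x. (u \<bullet> h \<theta> x)\<^sup>2) \<in> borel_measurable borel" "(\<lambda>x. u \<bullet> (H \<theta> x *v u)) \<in> borel_measurable borel"
    by measurable
  have int1: "integrable (P \<theta>) (\<lambda>w. (score g (e \<theta> 1 w) * (- (u \<bullet> h \<theta> (X (1 - 1) w))))\<^sup>2)"
    using inner_dell_sq(1)[OF t, of 1 u] unfolding inner_dell[OF t] by simp
  have "0 < c" by (rule nondeg)
  also have "c \<le> (\<integral>w. (u \<bullet> dell S g \<theta> (X (1 - 1) w) (X 1 w))\<^sup>2 \<partial>P \<theta>)"
    using nondeg(2)[OF t u] by (simp add: fisher_inner(2)[OF t])
  finally have pos: "0 < (\<integral>w. (score g (e \<theta> 1 w) * (- (u \<bullet> h \<theta> (X (1 - 1) w))))\<^sup>2 \<partial>P \<theta>)"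
    unfolding inner_dell[OF t] .
  note R = A.score_square_integrable[OF am order_refl int1 pos]
  show s2: "integrable \<nu> (\<lambda>e. (score g e)\<^sup>2)" by (rule R(1))
  show "J > 0" unfolding J_def by (rule R(2))
  have nz: "\<not> (AE w in P \<theta>. (u \<bullet> h \<theta> (X (1 - 1) w))\<^sup>2 = 0)" using R(3) by simp
  show "integrable \<nu> (\<lambda>e. (dscore g e)\<^sup>2)"
    by (rule A.dscore_square_integrable[OF Am order_refl _ s2 nz])
      (use inner_ddell_sq(1)[OF t, of 1 u] in \<open>simp only: inner_ddell[OF t] order_refl\<close>)
qed

text \<open>The Hessian form in direction u has A = (u \<bullet> h)^2, so the bound on the second
  moment of A is a fourth moment bound. Neither constant depends on the parameter or on j.\<close>

lemma h_fourth_moment: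
  assumes t: "\<theta> \<in> \<Theta>" and j: "j \<ge> 1"
  shows "integrable (P \<theta>) (\<lambda>w. (u \<bullet> h \<theta> (X (j - 1) w)) ^ 4)"
    "integrable (P \<theta>) (\<lambda>w. (u \<bullet> h \<theta> (X (j - 1) w))\<^sup>2)"
    "(\<integral>w. (u \<bullet> h \<theta> (X (j - 1) w)) ^ 4 \<partial>P \<theta>) \<le> (norm u) ^ 4 * C / J\<^sup>2"
    "(\<integral>w. (u \<bullet> h \<theta> (X (j - 1) w))\<^sup>2 \<partial>P \<theta>) \<le> 1 + (norm u) ^ 4 * C / J\<^sup>2"
proof -
  interpret A: ar_law "P \<theta>" X "S \<theta>" g by (rule law[OF t])
  note [measurable] = h_measurable[OF t] H_measurable[OF t] borel_measurable_continuous_onI[OF continuous_on_mult_vec]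
  have Am: "(\<lambda>x. (u \<bullet> h \<theta> x)\<^sup>2) \<in> borel_measurable borel" "(\<lambda>x. u \<bullet> (H \<theta> x *v u)) \<in> borel_measurable borel"
    by measurable
  note N = noise_moments[OF t]
  note B = A.hess_form_bound[OF Am j inner_ddell_sq(1)[OF t j, of u, unfolded inner_ddell[OF t]] N(1,3) J_def N(2)]
  have p4: "((x :: real)\<^sup>2)\<^sup>2 = x ^ 4" for x by simp
  show i4: "integrable (P \<theta>) (\<lambda>w. (u \<bullet> h \<theta> (X (j - 1) w)) ^ 4)" using B(1) by (simp only: p4)
  show i2: "integrable (P \<theta>) (\<lambda>w. (u \<bullet> h \<theta> (X (j - 1) w))\<^sup>2)"
    by (rule square_integrable_imp[OF A.finite_measure_axioms _ B(1)]) measurable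
  have "J\<^sup>2 * (\<integral>w. (u \<bullet> h \<theta> (X (j - 1) w)) ^ 4 \<partial>P \<theta>) \<le> (norm u) ^ 4 * C"
    using B(3) inner_ddell_sq(2)[OF t j, of u] unfolding inner_ddell[OF t] p4 by linarith
  then show m4: "(\<integral>w. (u \<bullet> h \<theta> (X (j - 1) w)) ^ 4 \<partial>P \<theta>) \<le> (norm u) ^ 4 * C / J\<^sup>2"
    using N(2) by (simp add: field_simps)
  have "(\<integral>w. (u \<bullet> h \<theta> (X (j - 1) w))\<^sup>2 \<partial>P \<theta>) \<le> (\<integral>w. 1 + (u \<bullet> h \<theta> (X (j - 1) w)) ^ 4 \<partial>P \<theta>)"
  proof (rule integral_mono[OF i2])
    show "integrable (P \<theta>) (\<lambda>w. 1 + (u \<bullet> h \<theta> (X (j - 1) w)) ^ 4)" using i4 by simp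
    fix w
    from le_one_plus_square[of "(u \<bullet> h \<theta> (X (j - 1) w))\<^sup>2"]
    show "(u \<bullet> h \<theta> (X (j - 1) w))\<^sup>2 \<le> 1 + (u \<bullet> h \<theta> (X (j - 1) w)) ^ 4" by simp
  qed
  also have "\<dots> \<le> 1 + (norm u) ^ 4 * C / J\<^sup>2" using i4 m4 by (simp add: A.prob_space)
  finally show "(\<integral>w. (u \<bullet> h \<theta> (X (j - 1) w))\<^sup>2 \<partial>P \<theta>) \<le> 1 + (norm u) ^ 4 * C / J\<^sup>2" .
qed

lemma dell_sum_square:
  assumes t: "\<theta> \<in> \<Theta>"
  shows "integrable (P \<theta>) (\<lambda>w. (norm (\<Sum>j=1..n. dell S g \<theta> (X (j - 1) w) (X j w)))\<^sup>2)"
    "(\<integral>w. (norm (\<Sum>j=1..n. dell S g \<theta> (X (j - 1) w) (X j w)))\<^sup>2 \<partial>P \<theta>) \<le> real n * (CARD('d) * C)"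
proof -
  interpret A: ar_law "P \<theta>" X "S \<theta>" g by (rule law[OF t])
  note [measurable] = h_measurable[OF t]
  let ?M = "\<lambda>w. \<Sum>j=1..n. dell S g \<theta> (X (j - 1) w) (X j w)"
  note N = noise_moments[OF t]
  have am: "(\<lambda>x. - (axis i 1 \<bullet> h \<theta> x)) \<in> borel_measurable borel" for i by measurable
  note B = A.score_sum_square[OF am N(1) N(2)[unfolded J_def]
      inner_dell_sq(1)[OF t, of _ "axis i 1" for i, unfolded inner_dell[OF t]]
      inner_dell_sq(2)[OF t, of _ "axis i 1" for i, unfolded inner_dell[OF t]], folded inner_dell[OF t] inner_sum_right]
  have e: "(norm v)\<^sup>2 = (\<Sum>i\<in>UNIV. (axis i 1 \<bullet> v)\<^sup>2)" for v :: "real^'d"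
    unfolding power2_norm_eq_inner inner_vec_def[of v v] by (simp add: inner_axis' power2_eq_square)
  show "integrable (P \<theta>) (\<lambda>w. (norm (?M w))\<^sup>2)" unfolding e
    by (intro Bochner_Integration.integrable_sum B(1))
  have "(\<integral>w. (norm (?M w))\<^sup>2 \<partial>P \<theta>) = (\<Sum>i\<in>UNIV. \<integral>w. (axis i 1 \<bullet> ?M w)\<^sup>2 \<partial>P \<theta>)"
    unfolding e by (intro Bochner_Integration.integral_sum B(1))
  also have "\<dots> \<le> (\<Sum>i\<in>(UNIV::'d set). real n * ((norm (axis i (1::real)))\<^sup>2 * C))" by (intro sum_mono B(2))
  also have "\<dots> = real n * (CARD('d) * C)" by simp
  finally show "(\<integral>w. (norm (?M w))\<^sup>2 \<partial>P \<theta>) \<le> real n * (CARD('d) * C)" .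
qed

end

section \<open>Conditional variances and characteristic functions along parameter sequences\<close>

lemma (in prob_space) prob_abs_gt_le:
  fixes Y :: "'a \<Rightarrow> real"
  assumes [measurable]: "Y \<in> borel_measurable M" and i: "integrable M (\<lambda>x. (Y x)\<^sup>2)" and k: "\<kappa> > 0"
  shows "prob {x \<in> space M. \<bar>Y x\<bar> > \<kappa>} \<le> expectation (\<lambda>x. (Y x)\<^sup>2) / \<kappa>\<^sup>2"
proof -
  have "prob {x \<in> space M. \<bar>Y x\<bar> > \<kappa>} \<le> prob {x \<in> space M. (Y x)\<^sup>2 \<ge> \<kappa>\<^sup>2}"
    using k by (intro finite_measure_mono) (auto simp: abs_le_square_iff[symmetric])
  also have "\<dots> \<le> expectation (\<lambda>x. (Y x)\<^sup>2) / \<kappa>\<^sup>2"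
    by (rule integral_Markov_inequality_measure[OF i]) (use k in auto)
  finally show ?thesis .
qed

context ar_model
begin

text \<open>With D the centred Hessian form, the deviation equals the sum of D divided by m, minus u
  \<bullet> (T u) divided by the square root of m. The first part is small by Chebyshev, the second
  because T is tight uniformly on K. This route never appeals to a law of large numbers at a fixed
  parameter.\<close>

lemma lln_seq:
  assumes K: "compact K" "K \<subseteq> \<Theta>" and \<theta>: "\<And>n. \<theta> n \<in> K" and k: "filterlim k at_top sequentially" and \<kappa>: "\<kappa> > 0"
  shows "(\<lambda>n. measure (P (\<theta> n)) {w \<in> space (P (\<theta> n)).
      \<bar>J * (\<Sum>j=1..k n. (u \<bullet> h (\<theta> n) (X (j - 1) w))\<^sup>2) / real (k n) - u \<bullet> (I (\<theta> n) *v u)\<bar> > \<kappa>}) \<longlonglongrightarrow> 0"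
proof (rule LIMSEQ_I)
  fix r :: real assume r: "r > 0"
  define T where "T n t w = (1 / sqrt (real n)) *\<^sub>R (\<Sum>j=1..n. ddell S g t (X (j - 1) w) (X j w) + I t)" for n t w
  obtain c0 where c0: "c0 > 0" "\<And>n t. t \<in> K \<Longrightarrow> measure (P t) {w \<in> space (P t). norm (T n t w) > c0} \<le> r / 2"
    using tight_hess[unfolded tight_uc_def, rule_format, of K "r / 2"] K r unfolding T_def by auto
  define B where "B = (norm u) ^ 4 * C"
  have kr: "filterlim (\<lambda>n. real (k n)) at_top sequentially" by (rule filterlim_compose[OF filterlim_real_sequentially k])
  \<comment> \<open>Chebyshev at level m \<kappa> / 2 with variance at most 4 B m gives 16 B /
    (\<kappa>^2 m).\<close>
  have "(\<lambda>n. 16 * B / \<kappa>\<^sup>2 / real (k n)) \<longlonglongrightarrow> 0"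
    by (rule tendsto_divide_0[OF tendsto_const filterlim_at_top_imp_at_infinity[OF kr]])
  then have ev1: "\<forall>\<^sub>F n in sequentially. 16 * B / \<kappa>\<^sup>2 / real (k n) < r / 2" using r by (intro order_tendstoD) auto
  have "(\<lambda>n. (norm u)\<^sup>2 * c0 / sqrt (real (k n))) \<longlonglongrightarrow> 0"
    by (rule tendsto_divide_0[OF tendsto_const filterlim_at_top_imp_at_infinity[OF filterlim_compose[OF sqrt_at_top kr]]])
  then have ev2: "\<forall>\<^sub>F n in sequentially. (norm u)\<^sup>2 * c0 / sqrt (real (k n)) < \<kappa> / 2" using \<kappa> by (intro order_tendstoD) auto
  have ev3: "\<forall>\<^sub>F n in sequentially. k n \<ge> 1" using k by (simp add: filterlim_at_top)
  have "\<forall>\<^sub>F n in sequentially. measure (P (\<theta> n)) {w \<in> space (P (\<theta> n)).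
      \<bar>J * (\<Sum>j=1..k n. (u \<bullet> h (\<theta> n) (X (j - 1) w))\<^sup>2) / real (k n) - u \<bullet> (I (\<theta> n) *v u)\<bar> > \<kappa>} < r"
    using ev1 ev2 ev3
  proof eventually_elim
    case (elim n)
    define t where "t = \<theta> n"
    define m where "m = k n"
    have m: "m \<ge> 1" using elim by (simp add: m_def)
    have tK: "t \<in> K" and tT: "t \<in> \<Theta>" using \<theta> K by (auto simp: t_def)
    interpret A: ar_law "P t" X "S t" g by (rule law[OF tT])
    note [measurable] = h_measurable[OF tT] H_measurable[OF tT] ddell_measurable[OF tT] borel_measurable_continuous_onI[OF continuous_on_mult_vec]
    have Am: "(\<lambda>x. (u \<bullet> h t x)\<^sup>2) \<in> borel_measurable borel" "(\<lambda>x. u \<bullet> (H t x *v u)) \<in> borel_measurable borel"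
      by measurable
    define D where "D j w = u \<bullet> (ddell S g t (X (j - 1) w) (X j w) *v u) + J * (u \<bullet> h t (X (j - 1) w))\<^sup>2" for j w
    note N = noise_moments[OF tT]
    have DS: "integrable (P t) (\<lambda>w. (\<Sum>j=1..m. D j w)\<^sup>2)" "(\<integral>w. (\<Sum>j=1..m. D j w)\<^sup>2 \<partial>P t) \<le> real m * (4 * B)"
      using A.hess_form_sum_square[OF Am N(1,3) J_def N(2) inner_ddell_sq[OF tT, of _ u, unfolded inner_ddell[OF tT]], of m]
      unfolding D_def B_def inner_ddell[OF tT] by simp_all
    have Dm[measurable]: "D j \<in> borel_measurable (P t)" for j unfolding D_def by measurable
    have Tm[measurable]: "T m t \<in> borel_measurable (P t)" unfolding T_def by measurable
    let ?E = "\<lambda>w. J * (\<Sum>j=1..m. (u \<bullet> h t (X (j - 1) w))\<^sup>2) / real m - u \<bullet> (I t *v u)"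
    \<comment> \<open>Outside both exceptional sets the two parts add up to less than \<kappa>, the
      second one because m is large enough for \<open>ev2\<close>.\<close>
    have sub: "{w \<in> space (P t). \<bar>?E w\<bar> > \<kappa>} \<subseteq>
      {w \<in> space (P t). \<bar>\<Sum>j=1..m. D j w\<bar> > real m * \<kappa> / 2} \<union> {w \<in> space (P t). norm (T m t w) > c0}"
    proof (rule subsetI, rule ccontr)
      fix w assume w: "w \<in> {w \<in> space (P t). \<bar>?E w\<bar> > \<kappa>}"
      assume "w \<notin> {w \<in> space (P t). \<bar>\<Sum>j=1..m. D j w\<bar> > real m * \<kappa> / 2} \<union> {w \<in> space (P t). norm (T m t w) > c0}"
      with w have 1: "\<bar>\<Sum>j=1..m. D j w\<bar> \<le> real m * \<kappa> / 2" and 2: "norm (T m t w) \<le> c0" by auto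
      have sq: "sqrt (real m) * sqrt (real m) = real m" "sqrt (real m) > 0" using m by auto
      have "(\<Sum>j=1..m. u \<bullet> (ddell S g t (X (j - 1) w) (X j w) *v u)) + real m * (u \<bullet> (I t *v u)) =
          u \<bullet> ((\<Sum>j=1..m. ddell S g t (X (j - 1) w) (X j w) + I t) *v u)"
      proof -
        have lin: "linear (\<lambda>A :: real^'d^'d. u \<bullet> (A *v u))"
          by (rule linearI) (simp_all add: matrix_vector_mult_add_rdistrib inner_add_right scaleR_matrix_vector_assoc[symmetric])
        show ?thesis by (simp add: linear_sum[OF lin] matrix_vector_mult_add_rdistrib inner_add_right sum.distrib
              sum_constant_scaleR scaleR_matrix_vector_assoc[symmetric] del: sum_constant)
      qed
      also have "\<dots> = sqrt (real m) * (u \<bullet> (T m t w *v u))"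
        unfolding T_def using sq by (simp add: scaleR_matrix_vector_assoc[symmetric])
      finally have "(\<Sum>j=1..m. u \<bullet> (ddell S g t (X (j - 1) w) (X j w) *v u)) + real m * (u \<bullet> (I t *v u)) =
          sqrt (real m) * (u \<bullet> (T m t w *v u))" .
      moreover have "(\<Sum>j=1..m. D j w) = (\<Sum>j=1..m. u \<bullet> (ddell S g t (X (j - 1) w) (X j w) *v u)) +
          J * (\<Sum>j=1..m. (u \<bullet> h t (X (j - 1) w))\<^sup>2)"
        unfolding D_def by (simp only: sum.distrib sum_distrib_left)
      moreover have "?E w * real m = J * (\<Sum>j=1..m. (u \<bullet> h t (X (j - 1) w))\<^sup>2) - real m * (u \<bullet> (I t *v u))"
        using m by (simp add: left_diff_distrib)
      ultimately have "?E w * real m = (\<Sum>j=1..m. D j w) - sqrt (real m) * (u \<bullet> (T m t w *v u))"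
        by linarith
      then have "\<bar>?E w\<bar> * real m = \<bar>(\<Sum>j=1..m. D j w) - sqrt (real m) * (u \<bullet> (T m t w *v u))\<bar>"
        by (metis abs_mult abs_of_nat)
      also have "\<dots> \<le> real m * \<kappa> / 2 + sqrt (real m) * ((norm u)\<^sup>2 * c0)"
      proof -
        have "\<bar>u \<bullet> (T m t w *v u)\<bar> \<le> norm u * (norm (T m t w) * norm u)"
          by (rule order_trans[OF Cauchy_Schwarz_ineq2 mult_left_mono[OF norm_matrix_vector_mult_le norm_ge_zero]])
        also have "\<dots> \<le> norm u * (c0 * norm u)" using 2 by (intro mult_left_mono mult_right_mono) auto
        finally have "\<bar>u \<bullet> (T m t w *v u)\<bar> \<le> (norm u)\<^sup>2 * c0" by (simp add: power2_eq_square mult_ac)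
        then have "\<bar>sqrt (real m) * (u \<bullet> (T m t w *v u))\<bar> \<le> sqrt (real m) * ((norm u)\<^sup>2 * c0)"
          using sq by (simp add: abs_mult)
        with 1 show ?thesis by linarith
      qed
      also have "\<dots> < real m * \<kappa>"
      proof -
        have "(norm u)\<^sup>2 * c0 < \<kappa> / 2 * sqrt (real m)"
          using elim(2) sq(2) by (simp add: m_def[symmetric] divide_less_eq)
        then have "sqrt (real m) * ((norm u)\<^sup>2 * c0) < sqrt (real m) * (\<kappa> / 2 * sqrt (real m))"
          using sq(2) by simp
        also have "\<dots> = real m * \<kappa> / 2" using sq(1) by (metis (no_types, opaque_lifting) mult.assoc mult.commute times_divide_eq_left)
        finally show ?thesis by simp
      qed
      finally have "\<bar>?E w\<bar> < \<kappa>" using m by simp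
      with w show False by simp
    qed
    have "measure (P t) {w \<in> space (P t). \<bar>?E w\<bar> > \<kappa>} \<le>
        measure (P t) {w \<in> space (P t). \<bar>\<Sum>j=1..m. D j w\<bar> > real m * \<kappa> / 2} + measure (P t) {w \<in> space (P t). norm (T m t w) > c0}"
      by (rule order_trans[OF A.finite_measure_mono[OF sub] measure_Un_le]) measurable
    also have "\<dots> \<le> (real m * (4 * B)) / (real m * \<kappa> / 2)\<^sup>2 + r / 2"
    proof (rule add_mono)
      have "measure (P t) {w \<in> space (P t). \<bar>\<Sum>j=1..m. D j w\<bar> > real m * \<kappa> / 2} \<le> (\<integral>w. (\<Sum>j=1..m. D j w)\<^sup>2 \<partial>P t) / (real m * \<kappa> / 2)\<^sup>2"
        by (rule A.prob_abs_gt_le[OF _ DS(1)]) (use m \<kappa> in auto)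
      also have "\<dots> \<le> (real m * (4 * B)) / (real m * \<kappa> / 2)\<^sup>2" using DS(2) by (rule divide_right_mono) simp
      finally show "measure (P t) {w \<in> space (P t). \<bar>\<Sum>j=1..m. D j w\<bar> > real m * \<kappa> / 2} \<le> (real m * (4 * B)) / (real m * \<kappa> / 2)\<^sup>2" .
    qed (rule c0(2)[OF tK])
    also have "(real m * (4 * B)) / (real m * \<kappa> / 2)\<^sup>2 = 16 * B / \<kappa>\<^sup>2 / real m"
      using m \<kappa> by (simp add: power2_eq_square field_simps)
    also have "16 * B / \<kappa>\<^sup>2 / real m + r / 2 < r" using elim(1) by (simp add: m_def)
    finally show ?case by (simp add: t_def m_def)
  qed
  then show "\<exists>N. \<forall>n\<ge>N. norm (measure (P (\<theta> n)) {w \<in> space (P (\<theta> n)).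
      \<bar>J * (\<Sum>j=1..k n. (u \<bullet> h (\<theta> n) (X (j - 1) w))\<^sup>2) / real (k n) - u \<bullet> (I (\<theta> n) *v u)\<bar> > \<kappa>} - 0) < r"
    by (auto simp: eventually_sequentially)
qed

lemma fisher_form_nonneg: "\<theta> \<in> \<Theta> \<Longrightarrow> 0 \<le> u \<bullet> (I \<theta> *v u)"
  using fisher_inner(2) by simp

lemma fisher_tendsto:
  assumes "\<And>n. \<theta> n \<in> \<Theta>" "\<theta> \<longlonglongrightarrow> \<theta>0" "\<theta>0 \<in> \<Theta>"
  shows "(\<lambda>n. I (\<theta> n)) \<longlonglongrightarrow> I \<theta>0"
proof -
  have "(\<lambda>n. \<theta> n - \<theta>0) \<longlonglongrightarrow> 0" using assms(2) by (simp add: LIM_zero_iff)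
  then have "(\<lambda>n. L * norm (\<theta> n - \<theta>0)) \<longlonglongrightarrow> L * 0"
    by (intro tendsto_mult tendsto_const tendsto_norm_zero)
  then have "(\<lambda>n. L * norm (\<theta> n - \<theta>0)) \<longlonglongrightarrow> 0" by simp
  then have "(\<lambda>n. I (\<theta> n) - I \<theta>0) \<longlonglongrightarrow> 0"
    by (rule Lim_null_comparison[rotated]) (intro always_eventually allI Lip assms)
  then show ?thesis by (simp add: LIM_zero_iff)
qed

text \<open>The martingale bound is used with weights - (u \<bullet> h) / sqrt m. Their second
  moments sum to at most 1 + B, their fourth moments to at most B / m, and J times the sum of their
  squares converges in probability to v.\<close>

lemma clt_seq:
  assumes K: "compact K" "K \<subseteq> \<Theta>" and \<theta>: "\<And>n. \<theta> n \<in> K" "\<theta> \<longlonglongrightarrow> \<theta>0" "\<theta>0 \<in> \<Theta>" and k: "filterlim k at_top sequentially"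
  shows "(\<lambda>n. \<integral>w. iexp (u \<bullet> ((1 / sqrt (real (k n))) *\<^sub>R (\<Sum>j=1..k n. dell S g (\<theta> n) (X (j - 1) w) (X j w)))) \<partial>P (\<theta> n))
    \<longlonglongrightarrow> complex_of_real (exp (- (u \<bullet> (I \<theta>0 *v u)) / 2))"
proof -
  define v where "v = u \<bullet> (I \<theta>0 *v u)"
  have v: "v \<ge> 0" unfolding v_def by (rule fisher_form_nonneg[OF \<theta>(3)])
  define B where "B = (norm u) ^ 4 * C / J\<^sup>2"
  note N = noise_moments[OF \<theta>(3)]
  have B: "B \<ge> 0"
    using order_trans[OF integral_nonneg_AE h_fourth_moment(3)[OF \<theta>(3) order_refl, of u]] by (simp add: B_def)
  interpret \<nu>: prob_space \<nu> by (rule ar_law.prob_space_\<nu>[OF law[OF \<theta>(3)]])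
  have \<nu>s[measurable_cong]: "sets \<nu> = sets borel" by (rule ar_law.sets_\<nu>[OF law[OF \<theta>(3)]])
  have sm: "score g \<in> borel_measurable \<nu>" using score_measurable(1)[OF g_C3 g_pos] by simp
  have smz: "\<nu>.expectation (score g) = 0" by (rule ar_law.score_mean_zero(2)[OF law[OF \<theta>(3)] N(1)])
  let ?Ch = "\<lambda>n. \<integral>w. iexp (u \<bullet> ((1 / sqrt (real (k n))) *\<^sub>R (\<Sum>j=1..k n. dell S g (\<theta> n) (X (j - 1) w) (X j w)))) \<partial>P (\<theta> n)"
  let ?K = "exp ((v + 1) / 2)"
  let ?p = "\<lambda>\<kappa> n. measure (P (\<theta> n)) {w \<in> space (P (\<theta> n)).
      \<bar>J * (\<Sum>j=1..k n. (u \<bullet> h (\<theta> n) (X (j - 1) w))\<^sup>2) / real (k n) - u \<bullet> (I (\<theta> n) *v u)\<bar> > \<kappa>}"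
  have kr: "filterlim (\<lambda>n. real (k n)) at_top sequentially" by (rule filterlim_compose[OF filterlim_real_sequentially k])
  \<comment> \<open>The compensated form is the one that the martingale bound controls; exp (- v /
    2) is restored at the end.\<close>
  have "(\<lambda>n. ?Ch n * complex_of_real (exp (v / 2))) \<longlonglongrightarrow> 1"
  proof (rule LIMSEQ_I)
    fix r :: real assume r: "r > 0"
    \<comment> \<open>The four terms of the bound are each given r / 8: \<eta> for the quadratic
      error, \<kappa> for the variance tolerance, large k for the quartic error and for the
      exceptional event.\<close>
    define \<eta> where "\<eta> = r / (8 * ?K * (1 + B))"
    define \<kappa> where "\<kappa> = min 1 (r / (8 * ?K))"
    have \<eta>: "\<eta> > 0" "?K * (\<eta> * (1 + B)) = r / 8"
    proof -
      have B1: "1 + B > 0" using B by simp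
      show "\<eta> > 0" unfolding \<eta>_def using r B1 by (intro divide_pos_pos mult_pos_pos) auto
      have "\<eta> * (1 + B) = r / (8 * ?K)" using B1 by (simp add: \<eta>_def)
      then show "?K * (\<eta> * (1 + B)) = r / 8" by simp
    qed
    have \<kappa>: "\<kappa> > 0" "\<kappa> \<le> 1" "?K * \<kappa> \<le> r / 8"
    proof -
      show "\<kappa> > 0" "\<kappa> \<le> 1" using r by (auto simp: \<kappa>_def)
      have "?K * \<kappa> \<le> ?K * (r / (8 * ?K))" by (intro mult_left_mono) (auto simp: \<kappa>_def)
      then show "?K * \<kappa> \<le> r / 8" by simp
    qed
    obtain C' where C': "C' \<ge> 0" "\<And>t. cmod ((\<integral>e. iexp (t * score g e) \<partial>\<nu>) - complex_of_real (exp (- (J * t\<^sup>2 / 2)))) \<le> \<eta> * t\<^sup>2 + C' * t ^ 4"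
      using \<nu>.char_gauss_bound[OF sm N(1) smz \<eta>(1)] unfolding J_def by blast
    have "(\<lambda>n. ?K * C' * B / real (k n)) \<longlonglongrightarrow> 0"
      by (rule tendsto_divide_0[OF tendsto_const filterlim_at_top_imp_at_infinity[OF kr]])
    then have ev1: "\<forall>\<^sub>F n in sequentially. ?K * C' * B / real (k n) < r / 8" using r by (intro order_tendstoD) auto
    \<comment> \<open>Half of the tolerance is spent around the information at \<theta> n; the other
      half covers its distance to v.\<close>
    have "?p (\<kappa> / 2) \<longlonglongrightarrow> 0" by (rule lln_seq[OF K \<theta>(1) k]) (use \<kappa> in simp)
    then have ev2: "\<forall>\<^sub>F n in sequentially. ?p (\<kappa> / 2) n < r / (16 * ?K)" using r by (intro order_tendstoD) auto
    have "(\<lambda>n. u \<bullet> (I (\<theta> n) *v u)) \<longlonglongrightarrow> v" unfolding v_def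
    proof (rule tendsto_inner[OF tendsto_const])
      have "(\<lambda>n. I (\<theta> n)) \<longlonglongrightarrow> I \<theta>0" by (rule fisher_tendsto) (use \<theta> K in auto)
      then show "(\<lambda>n. I (\<theta> n) *v u) \<longlonglongrightarrow> I \<theta>0 *v u"
        using continuous_on_tendsto_compose[OF continuous_on_mult_vec] by auto
    qed
    then have ev3: "\<forall>\<^sub>F n in sequentially. dist (u \<bullet> (I (\<theta> n) *v u)) v < \<kappa> / 2" using \<kappa> by (intro tendstoD) auto
    have ev4: "\<forall>\<^sub>F n in sequentially. k n \<ge> 1" using k by (simp add: filterlim_at_top)
    have "\<forall>\<^sub>F n in sequentially. norm (?Ch n * complex_of_real (exp (v / 2)) - 1) < r"
      using ev1 ev2 ev3 ev4
    proof eventually_elim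
      case (elim n)
      define t where "t = \<theta> n"
      define m where "m = k n"
      have m: "real m > 0" using elim by (simp add: m_def)
      have tT: "t \<in> \<Theta>" using \<theta> K by (auto simp: t_def)
      interpret A: ar_law "P t" X "S t" g by (rule law[OF tT])
      note [measurable] = h_measurable[OF tT]
      let ?b = "\<lambda>x. - (u \<bullet> h t x) / sqrt (real m)"
      have sq4: "sqrt (real m) ^ 4 = (real m)\<^sup>2" "(sqrt (real m))\<^sup>2 = real m"
      proof -
        have "sqrt (real m) ^ 4 = ((sqrt (real m))\<^sup>2)\<^sup>2" by (simp only: power_mult[symmetric]) simp
        then show "sqrt (real m) ^ 4 = (real m)\<^sup>2" by simp
      qed simp
      have b2: "(?b x)\<^sup>2 = (u \<bullet> h t x)\<^sup>2 / real m" and b4: "(?b x) ^ 4 = (u \<bullet> h t x) ^ 4 / (real m)\<^sup>2" for x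
        unfolding power_divide sq4 by simp_all
      have bm: "?b \<in> borel_measurable borel" by measurable
      have i2: "integrable (P t) (\<lambda>w. (?b (X (j - 1) w))\<^sup>2)" and i4: "integrable (P t) (\<lambda>w. (?b (X (j - 1) w)) ^ 4)"
        if "j \<ge> 1" for j
        unfolding b2 b4 using h_fourth_moment(1,2)[OF tT that, of u] by simp_all
      have M2: "(\<integral>w. (?b (X (j - 1) w))\<^sup>2 \<partial>P t) \<le> (1 + B) / real m" and M4: "(\<integral>w. (?b (X (j - 1) w)) ^ 4 \<partial>P t) \<le> B / (real m)\<^sup>2"
        if "j \<ge> 1" for j
        unfolding b2 b4 integral_divide_zero
        by (rule divide_right_mono[OF h_fourth_moment(4)[OF tT that, of u, folded B_def]], simp)
          (rule divide_right_mono[OF h_fourth_moment(3)[OF tT that, of u, folded B_def]], simp)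
      have eqS: "(\<Sum>j=1..m. score g (A.eps j w) * ?b (X (j - 1) w)) = u \<bullet> ((1 / sqrt (real m)) *\<^sub>R (\<Sum>j=1..m. dell S g t (X (j - 1) w) (X j w)))" for w
        unfolding inner_scaleR_right inner_sum_right inner_dell[OF tT] sum_distrib_left by (intro sum.cong refl) simp
      have eqV: "J * (\<Sum>j=1..m. (?b (X (j - 1) w))\<^sup>2) = J * (\<Sum>j=1..m. (u \<bullet> h t (X (j - 1) w))\<^sup>2) / real m" for w
        unfolding b2 by (simp add: sum_divide_distrib[symmetric])
      let ?q = "measure (P t) {w \<in> space (P t). \<bar>J * (\<Sum>j=1..m. (u \<bullet> h t (X (j - 1) w))\<^sup>2) / real m - v\<bar> > \<kappa>}"
      note CB = A.char_martingale_bound[OF bm less_imp_le[OF N(2)] v less_imp_le[OF \<kappa>(1)] \<kappa>(2) less_imp_le[OF \<eta>(1)] C'(1) C'(2) i2 i4, of m]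
      have "norm (?Ch n * complex_of_real (exp (v / 2)) - 1) \<le>
          ?K * ((\<Sum>j=1..m. \<eta> * (\<integral>w. (?b (X (j - 1) w))\<^sup>2 \<partial>P t) + C' * (\<integral>w. (?b (X (j - 1) w)) ^ 4 \<partial>P t)) + \<kappa> + 2 * ?q)"
        using CB unfolding eqS eqV unfolding t_def m_def .
      also have "\<dots> \<le> ?K * (\<eta> * (1 + B) + C' * B / real m + \<kappa> + 2 * ?p (\<kappa> / 2) n)"
      proof (intro mult_left_mono add_mono order_refl)
        have "(\<Sum>j=1..m. \<eta> * (\<integral>w. (?b (X (j - 1) w))\<^sup>2 \<partial>P t) + C' * (\<integral>w. (?b (X (j - 1) w)) ^ 4 \<partial>P t)) \<le>
            (\<Sum>j=1..m. \<eta> * ((1 + B) / real m) + C' * (B / (real m)\<^sup>2))"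
          using M2 M4 \<eta>(1) C'(1) by (intro sum_mono add_mono mult_left_mono) auto
        also have "\<dots> = \<eta> * (1 + B) + C' * B / real m"
          using m by (simp add: distrib_left power2_eq_square field_simps)
        finally show "(\<Sum>j=1..m. \<eta> * (\<integral>w. (?b (X (j - 1) w))\<^sup>2 \<partial>P t) + C' * (\<integral>w. (?b (X (j - 1) w)) ^ 4 \<partial>P t)) \<le> \<eta> * (1 + B) + C' * B / real m" .
        show "?q \<le> ?p (\<kappa> / 2) n" unfolding t_def[symmetric] m_def[symmetric]
        proof (rule A.finite_measure_mono)
          show "{w \<in> space (P t). \<bar>J * (\<Sum>j=1..m. (u \<bullet> h t (X (j - 1) w))\<^sup>2) / real m - v\<bar> > \<kappa>} \<subseteq>
            {w \<in> space (P t). \<bar>J * (\<Sum>j=1..m. (u \<bullet> h t (X (j - 1) w))\<^sup>2) / real m - u \<bullet> (I t *v u)\<bar> > \<kappa> / 2}"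
          proof -
            have "\<bar>y - u \<bullet> (I t *v u)\<bar> > \<kappa> / 2" if "\<bar>y - v\<bar> > \<kappa>" for y
              using elim(3) that unfolding t_def[symmetric] dist_real_def by linarith
            then show ?thesis by blast
          qed
        qed measurable
      qed simp_all
      also have "\<dots> = ?K * (\<eta> * (1 + B)) + ?K * C' * B / real m + ?K * \<kappa> + 2 * ?K * ?p (\<kappa> / 2) n"
        by (simp add: distrib_left mult.assoc)
      also have "\<dots> < r"
      proof -
        have "2 * ?K * ?p (\<kappa> / 2) n < 2 * ?K * (r / (16 * ?K))" using elim(2) by (intro mult_strict_left_mono) auto
        then have "2 * ?K * ?p (\<kappa> / 2) n < r / 8" by simp
        then show ?thesis using \<eta>(2) \<kappa>(3) elim(1) r unfolding m_def[symmetric] by linarith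
      qed
      finally show ?case .
    qed
    then show "\<exists>N. \<forall>n\<ge>N. norm (?Ch n * complex_of_real (exp (v / 2)) - 1) < r" by (auto simp: eventually_sequentially)
  qed
  then have "(\<lambda>n. ?Ch n * complex_of_real (exp (v / 2)) * complex_of_real (exp (- v / 2))) \<longlonglongrightarrow> 1 * complex_of_real (exp (- v / 2))"
    by (intro tendsto_mult tendsto_const)
  moreover have "complex_of_real (exp (v / 2)) * complex_of_real (exp (- v / 2)) = 1"
    unfolding of_real_mult[symmetric] exp_add[symmetric] by simp
  ultimately show ?thesis unfolding v_def[symmetric] by (simp only: mult.assoc mult_1_left mult_1_right)
qed

end

section \<open>The one-step estimator\<close>

text \<open>Substituting a random argument into a continuous random function: for simple arguments
  measurability is a countable case distinction, and continuity passes it to the limit.\<close>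

lemma caratheodory_measurable:
  fixes f :: "'t::{metric_space, second_countable_topology} \<Rightarrow> 'w \<Rightarrow> 'b::real_normed_vector"
  assumes U: "open U" and f: "\<And>t. t \<in> U \<Longrightarrow> f t \<in> borel_measurable M"
    and cont: "\<And>w. w \<in> space M \<Longrightarrow> continuous_on U (\<lambda>t. f t w)"
    and T: "T \<in> borel_measurable M" "\<And>w. w \<in> space M \<Longrightarrow> T w \<in> U"
  shows "(\<lambda>w. f (T w) w) \<in> borel_measurable M"
proof -
  obtain F where F: "\<And>i. simple_function M (F i)" "\<And>x. x \<in> space M \<Longrightarrow> (\<lambda>i. F i x) \<longlonglongrightarrow> T x"
    using borel_measurable_implies_sequence_metric[OF T(1)] by blast
  \<comment> \<open>The simple approximations may leave U at first, where neither hypothesis on f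
    speaks; the extension by 0 is measurable there and irrelevant in the limit.\<close>
  define f' where "f' t w = (if t \<in> U then f t w else 0)" for t w
  have f'm: "f' t \<in> borel_measurable M" for t
    unfolding f'_def using f[of t] by (cases "t \<in> U") auto
  have m: "(\<lambda>w. f' (F i w) w) \<in> borel_measurable M" for i
  proof (rule measurable_compose_countable'[of "F i ` space M"])
    have fin: "finite (F i ` space M)" using F(1) by (rule simple_functionD(1))
    then show "countable (F i ` space M)" by (rule countable_finite)
    show "F i \<in> measurable M (count_space (F i ` space M))"
      using simple_functionD(2)[OF F(1)] by (subst measurable_count_space_eq2[OF fin]) auto
  qed (rule f'm)
  show ?thesis
  proof (rule borel_measurable_LIMSEQ_metric[OF m])
    fix w assume w: "w \<in> space M"
    have "\<forall>\<^sub>F i in sequentially. F i w \<in> U"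
      using F(2)[OF w] U T(2)[OF w] by (rule topological_tendstoD)
    then have ev: "\<forall>\<^sub>F i in sequentially. f (F i w) w = f' (F i w) w"
      by eventually_elim (simp add: f'_def)
    have "isCont (\<lambda>t. f t w) (T w)" using cont[OF w] U T(2)[OF w] by (simp add: continuous_on_eq_continuous_at)
    then have "(\<lambda>i. f (F i w) w) \<longlonglongrightarrow> f (T w) w" by (rule isCont_tendsto_compose[OF _ F(2)[OF w]])
    then show "(\<lambda>i. f' (F i w) w) \<longlonglongrightarrow> f (T w) w" using ev by (rule Lim_transform_eventually)
  qed
qed

context ar_model
begin

abbreviation "Iinv t \<equiv> matrix_inv (I t)"

lemma Iinv_bound: "t \<in> \<Theta> \<Longrightarrow> norm (Iinv t *v y) \<le> norm y / c"
  by (rule coercive_matrix(4)[OF nondeg])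

lemma Iinv_diff:
  assumes "t \<in> \<Theta>" "t' \<in> \<Theta>"
  shows "norm (Iinv t *v y - Iinv t' *v y) \<le> L * norm (t - t') * norm y / c\<^sup>2"
proof -
  have "norm (Iinv t *v y - Iinv t' *v y) \<le> norm (I t - I t') * norm y / c\<^sup>2"
    by (rule coercive_matrix_inv_diff[OF nondeg(1) nondeg(2)[OF assms(1)] nondeg(2)[OF assms(2)]])
  also have "\<dots> \<le> L * norm (t - t') * norm y / c\<^sup>2"
    using Lip[OF assms] by (intro divide_right_mono mult_right_mono) auto
  finally show ?thesis .
qed

lemma dell_continuous: "continuous_on \<Theta> (\<lambda>t. dell S g t x x')"
proof (rule continuous_at_imp_continuous_on, rule ballI)
  fix t assume t: "t \<in> \<Theta>"
  have "(grad (\<lambda>\<theta>. ell S g \<theta> x x') has_derivative (\<lambda>v. hess (\<lambda>\<theta>. ell S g \<theta> x x') t *v v)) (at t)"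
    by (rule grad_has_derivative_hess, rule ell_smooth(3)[OF Theta(1) S_C3 g_C3 g_pos t])
  then show "isCont (\<lambda>t. dell S g t x x') t"
    unfolding dell_def by (rule has_derivative_continuous)
qed

lemma Iinv_mult_continuous:
  assumes "continuous_on \<Theta> y"
  shows "continuous_on \<Theta> (\<lambda>t. Iinv t *v y t)"
  unfolding continuous_on_def
proof
  fix t0 assume t0: "t0 \<in> \<Theta>"
  have y: "(y \<longlongrightarrow> y t0) (at t0 within \<Theta>)" using assms t0 by (simp add: continuous_on_def)
  have "((\<lambda>t. norm (y t - y t0) / c + L * norm (t - t0) * norm (y t0) / c\<^sup>2) \<longlongrightarrow>
      norm (y t0 - y t0) / c + L * norm (t0 - t0) * norm (y t0) / c\<^sup>2) (at t0 within \<Theta>)"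
    using nondeg(1) by (intro tendsto_intros y) auto
  then have lim: "((\<lambda>t. norm (y t - y t0) / c + L * norm (t - t0) * norm (y t0) / c\<^sup>2) \<longlongrightarrow> 0) (at t0 within \<Theta>)"
    by simp
  have "((\<lambda>t. Iinv t *v y t - Iinv t0 *v y t0) \<longlongrightarrow> 0) (at t0 within \<Theta>)"
  proof (rule Lim_null_comparison[OF _ lim])
    show "\<forall>\<^sub>F t in at t0 within \<Theta>. norm (Iinv t *v y t - Iinv t0 *v y t0) \<le> norm (y t - y t0) / c + L * norm (t - t0) * norm (y t0) / c\<^sup>2"
      unfolding eventually_at_filter
    proof (intro always_eventually allI impI)
      fix t assume t: "t \<in> \<Theta>"
      have "Iinv t *v y t - Iinv t0 *v y t0 = Iinv t *v (y t - y t0) + (Iinv t *v y t0 - Iinv t0 *v y t0)"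
        by (simp add: matrix_vector_mult_diff_distrib)
      then show "norm (Iinv t *v y t - Iinv t0 *v y t0) \<le> norm (y t - y t0) / c + L * norm (t - t0) * norm (y t0) / c\<^sup>2"
        by (simp only:) (rule norm_triangle_mono[OF Iinv_bound[OF t] Iinv_diff[OF t t0]])
    qed
  qed
  then show "((\<lambda>t. Iinv t *v y t) \<longlongrightarrow> Iinv t0 *v y t0) (at t0 within \<Theta>)" by (simp only: LIM_zero_iff)
qed

lemma norm_fisher_le:
  assumes t: "\<theta> \<in> \<Theta>"
  shows "norm (I \<theta>) \<le> C"
proof -
  note [measurable] = X_measurable[OF t] dell_measurable[OF t] outer_measurable
  have "norm (outer (dell S g \<theta> (X 0 w) (X 1 w))) \<le> (R1 (X 0 w) (X 1 w))\<^sup>2" for w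
    by (rule order_trans[OF norm_outer_le power_mono[OF R_bound(1)[OF t] norm_ge_zero]])
  moreover have "integrable (P \<theta>) (\<lambda>w. (R1 (X 0 w) (X 1 w))\<^sup>2)" using R_int(1)[OF t, of 1] by simp
  moreover from calculation have "integrable (P \<theta>) (\<lambda>w. outer (dell S g \<theta> (X 0 w) (X 1 w)))"
    by (intro Bochner_Integration.integrable_bound[OF \<open>integrable (P \<theta>) (\<lambda>w. (R1 (X 0 w) (X 1 w))\<^sup>2)\<close>]) auto
  ultimately have "norm (I \<theta>) \<le> (\<integral>w. (R1 (X 0 w) (X 1 w))\<^sup>2 \<partial>P \<theta>)"
    unfolding fisher_def by (intro norm_integral_le_integral) auto
  then show ?thesis using R_le(1)[OF t, of 1] by simp
qed

definition "score_sum \<theta> n w = (\<Sum>j=1..n. dell S g \<theta> (X (j - 1) w) (X j w))"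
definition "hess_dev \<theta> n w = (1 / sqrt (real n)) *\<^sub>R (\<Sum>j=1..n. ddell S g \<theta> (X (j - 1) w) (X j w) + I \<theta>)"

text \<open>Here a and b stand for the square roots of k and N, and d for the distance to the limit
  parameter. The term in a / b^2 collects the Taylor remainder and the Lipschitz change of the
  information, b / a the omitted first N summands, and the terms in 1 / b and 1 / a the Hessian
  fluctuations. The last summand is the price of freezing the inverse information at
  \<theta>0.\<close>

definition "rem_bound C0 a b d =
  ((L * C0\<^sup>2 + C0 ^ 3) * (a / b\<^sup>2) + (C * C0 + C0) * (b / a) + C0\<^sup>2 / b + C0\<^sup>2 / a) / c
    + L * (C0 / b + d) * C0 / c\<^sup>2"

text \<open>Deterministic core of the one-step argument, at a single outcome at which all tight
  quantities are bounded by C0. The value t may depend on the whole trajectory, since the estimates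
  use only its distance to \<theta>.\<close>

lemma remainder_bound:
  assumes t: "t \<in> \<Theta>" and \<theta>: "\<theta> \<in> \<Theta>" and \<theta>0: "\<theta>0 \<in> \<Theta>" and L0: "L \<ge> 0"
    and N: "1 \<le> N" "N \<le> k" and C0: "C0 \<ge> 0"
  defines "a \<equiv> sqrt (real k)" and "b \<equiv> sqrt (real N)"
  assumes e1: "norm (b *\<^sub>R (t - \<theta>)) \<le> C0"
    and e2: "norm (hess_dev \<theta> k w) \<le> C0" and e3: "norm (hess_dev \<theta> N w) \<le> C0"
    and e4: "(\<Sum>j=1..k. 1 + (R3 (X (j - 1) w) (X j w))\<^sup>2) \<le> C0 * real k"
    and e5: "norm (score_sum \<theta> k w) \<le> C0 * a" and e6: "norm (score_sum \<theta> N w) \<le> C0 * b"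
  shows "norm (a *\<^sub>R (t - \<theta>) + Iinv t *v Delta S g N k t (\<lambda>j. X j w) - Iinv \<theta>0 *v ((1 / a) *\<^sub>R score_sum \<theta> k w))
    \<le> rem_bound C0 a b (norm (\<theta> - \<theta>0))"
proof -
  define d where "d = t - \<theta>"
  define Dl where "Dl = Delta S g N k t (\<lambda>j. X j w)"
  let ?x = "\<lambda>j. X (j - 1) w" and ?x' = "\<lambda>j. X j w"
  let ?J = "{N+1..k}"
  have ab: "a > 0" "b > 0" "a * a = real k" "b * b = real N" using N by (auto simp: a_def b_def)
  have split: "sum f {1..k} = sum f {1..N} + sum f ?J" for f :: "nat \<Rightarrow> 'x::ab_group_add"
  proof -
    have "{1..k} = {1..N} \<union> ?J" using N by auto
    then show ?thesis by (simp add: sum.union_disjoint)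
  qed
  have nd: "norm d \<le> C0 / b"
  proof -
    have "b * norm d \<le> C0" using e1 ab(2) unfolding d_def norm_scaleR by simp
    then show ?thesis using ab(2) by (simp add: field_simps)
  qed
  \<comment> \<open>The expansion is centred at the true parameter, so that its linear term is the
    Hessian sum whose fluctuations are assumed tight.\<close>
  define \<rho> where "\<rho> j = dell S g t (?x j) (?x' j) - dell S g \<theta> (?x j) (?x' j) - ddell S g \<theta> (?x j) (?x' j) *v d" for j
  \<comment> \<open>R3 is replaced by 1 + R3^2, which is nonnegative and has a controlled
    mean.\<close>
  have \<rho>: "norm (\<rho> j) \<le> (1 + (R3 (?x j) (?x' j))\<^sup>2) * (norm d)\<^sup>2" for j
  proof -
    have "norm (\<rho> j) \<le> R3 (?x j) (?x' j) * (norm d)\<^sup>2" unfolding \<rho>_def d_def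
      by (rule dell_taylor[OF Theta S_C3 g_C3 g_pos R_bound(3) \<theta> t])
    also have "\<dots> \<le> (1 + (R3 (?x j) (?x' j))\<^sup>2) * (norm d)\<^sup>2"
      by (rule mult_right_mono[OF le_one_plus_square]) simp
    finally show ?thesis .
  qed
  have \<rho>s: "norm (\<Sum>j\<in>?J. \<rho> j) \<le> C0 * real k * (norm d)\<^sup>2"
  proof -
    have "norm (\<Sum>j\<in>?J. \<rho> j) \<le> (\<Sum>j\<in>?J. (1 + (R3 (?x j) (?x' j))\<^sup>2) * (norm d)\<^sup>2)"
      by (rule sum_norm_le) (rule \<rho>)
    also have "\<dots> \<le> (\<Sum>j=1..k. (1 + (R3 (?x j) (?x' j))\<^sup>2) * (norm d)\<^sup>2)"
      by (rule sum_mono2) auto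
    also have "\<dots> \<le> C0 * real k * (norm d)\<^sup>2"
      unfolding sum_distrib_right[symmetric] using e4 by (rule mult_right_mono) simp
    finally show ?thesis .
  qed
  have Hs: "(\<Sum>j\<in>?J. ddell S g \<theta> (?x j) (?x' j)) = a *\<^sub>R hess_dev \<theta> k w - b *\<^sub>R hess_dev \<theta> N w - (real k - real N) *\<^sub>R I \<theta>"
  proof -
    have "(\<Sum>j=1..n. ddell S g \<theta> (?x j) (?x' j)) = sqrt (real n) *\<^sub>R hess_dev \<theta> n w - real n *\<^sub>R I \<theta>" if "n \<ge> 1" for n
      using that by (simp add: hess_dev_def sum.distrib sum_constant_scaleR del: sum_constant)
    note F = this
    have "(\<Sum>j\<in>?J. ddell S g \<theta> (?x j) (?x' j)) =
        (\<Sum>j=1..k. ddell S g \<theta> (?x j) (?x' j)) - (\<Sum>j=1..N. ddell S g \<theta> (?x j) (?x' j))"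
      using split[of "\<lambda>j. ddell S g \<theta> (?x j) (?x' j)"] by simp
    also have "\<dots> = (a *\<^sub>R hess_dev \<theta> k w - real k *\<^sub>R I \<theta>) - (b *\<^sub>R hess_dev \<theta> N w - real N *\<^sub>R I \<theta>)"
      using F[of k] F[of N] N unfolding a_def b_def by (simp only: order_trans[OF N])
    also have "\<dots> = a *\<^sub>R hess_dev \<theta> k w - b *\<^sub>R hess_dev \<theta> N w - (real k - real N) *\<^sub>R I \<theta>"
      by (simp add: scaleR_diff_left)
    finally show ?thesis .
  qed
  have Ms: "(\<Sum>j\<in>?J. dell S g \<theta> (?x j) (?x' j)) = score_sum \<theta> k w - score_sum \<theta> N w"
    using split[of "\<lambda>j. dell S g \<theta> (?x j) (?x' j)"] by (simp add: score_sum_def)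
  have lin: "linear (\<lambda>A :: real^'d^'d. A *v d)"
    by (rule linearI) (simp_all add: matrix_vector_mult_add_rdistrib scaleR_matrix_vector_assoc)
  have "(\<Sum>j\<in>?J. dell S g t (?x j) (?x' j)) =
      (\<Sum>j\<in>?J. dell S g \<theta> (?x j) (?x' j)) + (\<Sum>j\<in>?J. ddell S g \<theta> (?x j) (?x' j) *v d) + (\<Sum>j\<in>?J. \<rho> j)"
    unfolding sum.distrib[symmetric] by (simp add: \<rho>_def)
  also have "(\<Sum>j\<in>?J. ddell S g \<theta> (?x j) (?x' j) *v d) = (\<Sum>j\<in>?J. ddell S g \<theta> (?x j) (?x' j)) *v d"
    by (rule linear_sum[OF lin, symmetric])
  finally have Ds: "a *\<^sub>R Dl = (score_sum \<theta> k w - score_sum \<theta> N w) +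
      (a *\<^sub>R hess_dev \<theta> k w - b *\<^sub>R hess_dev \<theta> N w - (real k - real N) *\<^sub>R I \<theta>) *v d + (\<Sum>j\<in>?J. \<rho> j)"
    unfolding Ms Hs Dl_def Delta_def using ab(1) by (simp add: a_def)
  \<comment> \<open>The error before inversion. Multiplied by a, it contains k I(t) d from the
    preliminary estimator and - k I(\<theta>) d from the mean Hessian; their cancellation up to a
    Lipschitz error of order k |d|^2 is what the one-step correction achieves.\<close>
  define E where "E = a *\<^sub>R (I t *v d) + Dl - (1 / a) *\<^sub>R score_sum \<theta> k w"
  have "a *\<^sub>R E = real k *\<^sub>R ((I t - I \<theta>) *v d) + real N *\<^sub>R (I \<theta> *v d) - score_sum \<theta> N w
      + a *\<^sub>R (hess_dev \<theta> k w *v d) - b *\<^sub>R (hess_dev \<theta> N w *v d) + (\<Sum>j\<in>?J. \<rho> j)"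
    unfolding E_def scaleR_add_right scaleR_diff_right Ds
    using ab by (simp add: matrix_vector_mult_diff_rdistrib scaleR_matrix_vector_assoc[symmetric] scaleR_diff_left algebra_simps)
  then have "norm (a *\<^sub>R E) \<le> real k * (L * (norm d * norm d)) + real N * (C * norm d) + C0 * b
      + a * (C0 * norm d) + b * (C0 * norm d) + C0 * real k * (norm d)\<^sup>2"
  proof (simp only:, intro norm_triangle_mono norm_triangle_le_diff[OF add_mono])
    show "norm (real k *\<^sub>R ((I t - I \<theta>) *v d)) \<le> real k * (L * (norm d * norm d))"
    proof -
      have "norm ((I t - I \<theta>) *v d) \<le> (L * norm d) * norm d"
        using norm_matrix_vector_mult_le[of "I t - I \<theta>" d] mult_right_mono[OF Lip[OF t \<theta>] norm_ge_zero[of d]]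
        unfolding d_def by linarith
      then show ?thesis by (simp add: mult_left_mono mult.assoc)
    qed
    show "norm (real N *\<^sub>R (I \<theta> *v d)) \<le> real N * (C * norm d)"
      using norm_matrix_vector_mult_le[of "I \<theta>" d] mult_right_mono[OF norm_fisher_le[OF \<theta>] norm_ge_zero[of d]]
      by (simp add: mult_left_mono)
    show "norm (a *\<^sub>R (hess_dev \<theta> k w *v d)) \<le> a * (C0 * norm d)"
      using norm_matrix_vector_mult_le[of "hess_dev \<theta> k w" d] mult_right_mono[OF e2 norm_ge_zero[of d]] ab(1)
      by (simp add: mult_left_mono)
    show "norm (b *\<^sub>R (hess_dev \<theta> N w *v d)) \<le> b * (C0 * norm d)"
      using norm_matrix_vector_mult_le[of "hess_dev \<theta> N w" d] mult_right_mono[OF e3 norm_ge_zero[of d]] ab(2)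
      by (simp add: mult_left_mono)
  qed (use e6 \<rho>s in auto)
  also have "\<dots> \<le> real k * (L * (C0 / b * (C0 / b))) + real N * (C * (C0 / b)) + C0 * b
      + a * (C0 * (C0 / b)) + b * (C0 * (C0 / b)) + C0 * real k * (C0 / b)\<^sup>2"
    using nd L0 C0 ab order_trans[OF norm_ge_zero norm_fisher_le[OF \<theta>]]
    by (intro add_mono mult_left_mono mult_mono power_mono) auto
  also have "\<dots> = a * ((L * C0\<^sup>2 + C0 ^ 3) * (a / b\<^sup>2) + (C * C0 + C0) * (b / a) + C0\<^sup>2 / b + C0\<^sup>2 / a)"
    unfolding ab(3,4)[symmetric] using ab(1,2) by (simp add: field_simps power2_eq_square power3_eq_cube)
  finally have nE: "norm E \<le> (L * C0\<^sup>2 + C0 ^ 3) * (a / b\<^sup>2) + (C * C0 + C0) * (b / a) + C0\<^sup>2 / b + C0\<^sup>2 / a"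
    using ab(1) by simp
  define M where "M = (1 / a) *\<^sub>R score_sum \<theta> k w"
  have nM: "norm M \<le> C0" using e5 ab(1) by (simp add: M_def field_simps)
  have inv: "Iinv t *v (I t *v y) = y" for y
    using coercive_matrix(2)[OF nondeg(1) nondeg(2)[OF t]] by (simp add: matrix_vector_mul_assoc)
  have "Iinv t *v E = a *\<^sub>R d + Iinv t *v Dl - Iinv t *v M"
    unfolding E_def M_def[symmetric]
    by (simp only: matrix_vector_mult_diff_distrib matrix_vector_right_distrib matrix_vector_mult_scaleR inv)
  then have "a *\<^sub>R d + Iinv t *v Dl - Iinv \<theta>0 *v M = Iinv t *v E + (Iinv t *v M - Iinv \<theta>0 *v M)"
    by simp
  also have "norm \<dots> \<le> norm E / c + L * norm (t - \<theta>0) * norm M / c\<^sup>2"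
    by (rule norm_triangle_mono[OF Iinv_bound[OF t] Iinv_diff[OF t \<theta>0]])
  also have "\<dots> \<le> rem_bound C0 a b (norm (\<theta> - \<theta>0))"
    unfolding rem_bound_def
  proof (rule add_mono)
    show "norm E / c \<le> ((L * C0\<^sup>2 + C0 ^ 3) * (a / b\<^sup>2) + (C * C0 + C0) * (b / a) + C0\<^sup>2 / b + C0\<^sup>2 / a) / c"
      using nE nondeg(1) by (intro divide_right_mono) auto
    have "norm (t - \<theta>0) \<le> C0 / b + norm (\<theta> - \<theta>0)"
      using norm_triangle_ineq[of d "\<theta> - \<theta>0"] nd by (simp add: d_def)
    then show "L * norm (t - \<theta>0) * norm M / c\<^sup>2 \<le> L * (C0 / b + norm (\<theta> - \<theta>0)) * C0 / c\<^sup>2"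
      using nM L0 C0 ab(2) by (intro divide_right_mono mult_mono mult_left_mono mult_nonneg_nonneg) auto
  qed
  finally show ?thesis unfolding d_def Dl_def M_def .
qed

end

text \<open>Once the sample size M is large the integer parts cost at most a factor 2: k \<ge> s M /
  2 and N is at least half of M to the power \<delta>. The two ratios are then governed by M to the
  powers \<delta> - 1 and 1/2 - \<delta>, both negative exponents.\<close>

lemma size_limits:
  fixes m :: "nat \<Rightarrow> nat"
  assumes \<delta>: "1 / 2 < \<delta>" "\<delta> < 1" and s: "0 < s" and s1: "s \<le> 1" and m: "filterlim m at_top sequentially"
  shows "filterlim (\<lambda>n. ksz s (m n)) at_top sequentially" "filterlim (\<lambda>n. Nsz \<delta> (m n)) at_top sequentially"
    "(\<lambda>n. sqrt (real (Nsz \<delta> (m n))) / sqrt (real (ksz s (m n)))) \<longlonglongrightarrow> 0"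
    "(\<lambda>n. sqrt (real (ksz s (m n))) / (sqrt (real (Nsz \<delta> (m n))))\<^sup>2) \<longlonglongrightarrow> 0"
proof -
  let ?M = "\<lambda>n. real (m n)" and ?k = "\<lambda>n. real (ksz s (m n))" and ?N = "\<lambda>n. real (Nsz \<delta> (m n))"
  have M: "filterlim ?M at_top sequentially" by (rule filterlim_compose[OF filterlim_real_sequentially m])
  have Md: "filterlim (\<lambda>n. ?M n powr \<delta>) at_top sequentially"
    using \<delta> by (intro filterlim_compose[OF _ M] real_powr_at_top) auto
  have k: "s * ?M n - 1 \<le> ?k n" "?k n \<le> s * ?M n" for n
  proof -
    have "0 \<le> s * ?M n" using s by simp
    then have "?k n = of_int \<lfloor>s * ?M n\<rfloor>" by (simp add: ksz_def)
    then show "s * ?M n - 1 \<le> ?k n" "?k n \<le> s * ?M n" by linarith+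
  qed
  have N: "?M n powr \<delta> - 1 \<le> ?N n" "?N n \<le> ?M n powr \<delta>" for n
  proof -
    have "?N n = of_int \<lfloor>?M n powr \<delta>\<rfloor>" by (simp add: Nsz_def)
    then show "?M n powr \<delta> - 1 \<le> ?N n" "?N n \<le> ?M n powr \<delta>" by linarith+
  qed
  have sM: "filterlim (\<lambda>n. s * ?M n - 1) at_top sequentially"
    using filterlim_tendsto_add_at_top[OF tendsto_const[of "-1"] filterlim_tendsto_pos_mult_at_top[OF tendsto_const s M]]
    by simp
  have kr: "filterlim ?k at_top sequentially"
    by (rule filterlim_at_top_mono[OF sM]) (use k in auto)
  have dM: "filterlim (\<lambda>n. ?M n powr \<delta> - 1) at_top sequentially"
    using filterlim_tendsto_add_at_top[OF tendsto_const[of "-1"] Md] by simp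
  have Nr: "filterlim ?N at_top sequentially"
    by (rule filterlim_at_top_mono[OF dM]) (use N in auto)
  have toN: "filterlim f at_top sequentially" if "filterlim (\<lambda>n. real (f n)) at_top sequentially" for f :: "nat \<Rightarrow> nat"
    unfolding filterlim_at_top
  proof
    fix Z :: nat
    have "\<forall>\<^sub>F n in sequentially. real Z \<le> real (f n)" using that unfolding filterlim_at_top by blast
    then show "\<forall>\<^sub>F n in sequentially. Z \<le> f n" by simp
  qed
  show "filterlim (\<lambda>n. ksz s (m n)) at_top sequentially" "filterlim (\<lambda>n. Nsz \<delta> (m n)) at_top sequentially"
    by (rule toN[OF kr], rule toN[OF Nr])
  have ev1: "\<forall>\<^sub>F n in sequentially. ?M n \<ge> 2 / s" "\<forall>\<^sub>F n in sequentially. ?M n \<ge> 1" using M unfolding filterlim_at_top by blast+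
  have ev2: "\<forall>\<^sub>F n in sequentially. ?M n powr \<delta> \<ge> 2" using Md unfolding filterlim_at_top by blast
  have "(\<lambda>n. 2 / s * ?M n powr (\<delta> - 1)) \<longlonglongrightarrow> 2 / s * 0"
    using \<delta> by (intro tendsto_mult tendsto_const tendsto_neg_powr M) auto
  then have l1: "(\<lambda>n. 2 / s * ?M n powr (\<delta> - 1)) \<longlonglongrightarrow> 0" by simp
  have "(\<lambda>n. ?N n / ?k n) \<longlonglongrightarrow> 0"
  proof (rule Lim_null_comparison[OF _ l1])
    show "\<forall>\<^sub>F n in sequentially. norm (?N n / ?k n) \<le> 2 / s * ?M n powr (\<delta> - 1)"
      using ev1
    proof eventually_elim
      case (elim n)
      have "s * ?M n / 2 \<le> ?k n" using elim(1) k(1)[of n] s by (simp add: field_simps)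
      moreover have "s * ?M n / 2 > 0" using elim(2) s by simp
      ultimately have "?N n / ?k n \<le> ?M n powr \<delta> / (s * ?M n / 2)" using N(2)[of n] by (intro frac_le) auto
      also have "\<dots> = 2 / s * ?M n powr (\<delta> - 1)" using elim(2) s by (simp add: powr_diff)
      finally show ?case by simp
    qed
  qed
  from tendsto_real_sqrt[OF this]
  show "(\<lambda>n. sqrt (?N n) / sqrt (?k n)) \<longlonglongrightarrow> 0" by (simp add: real_sqrt_divide)
  have "(\<lambda>n. 2 * ?M n powr (1 / 2 - \<delta>)) \<longlonglongrightarrow> 2 * 0"
    using \<delta> by (intro tendsto_mult tendsto_const tendsto_neg_powr M) auto
  then have l2: "(\<lambda>n. 2 * ?M n powr (1 / 2 - \<delta>)) \<longlonglongrightarrow> 0" by simp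
  show "(\<lambda>n. sqrt (?k n) / (sqrt (?N n))\<^sup>2) \<longlonglongrightarrow> 0"
  proof (rule Lim_null_comparison[OF _ l2])
    show "\<forall>\<^sub>F n in sequentially. norm (sqrt (?k n) / (sqrt (?N n))\<^sup>2) \<le> 2 * ?M n powr (1 / 2 - \<delta>)"
      using ev1(2) ev2
    proof eventually_elim
      case (elim n)
      have N2: "?M n powr \<delta> / 2 \<le> ?N n" using elim(2) N(1)[of n] by simp
      have "?k n \<le> ?M n" using k(2)[of n] mult_right_mono[OF s1, of "?M n"] by simp
      then have "sqrt (?k n) \<le> sqrt (?M n)" by simp
      then have "sqrt (?k n) \<le> ?M n powr (1 / 2)" by (simp only: powr_half_sqrt[OF of_nat_0_le_iff])
      then have "sqrt (?k n) / ?N n \<le> ?M n powr (1 / 2) / (?M n powr \<delta> / 2)"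
        using N2 elim by (intro frac_le) auto
      also have "\<dots> = 2 * ?M n powr (1 / 2 - \<delta>)" using elim(1) by (simp add: powr_diff)
      finally show ?case by simp
    qed
  qed
qed

text \<open>Uses |exp (i x) - 1| \<le> |x| off B and the trivial bound 2 on B, so closeness outside
  a set of small probability transfers to characteristic functions.\<close>

lemma (in prob_space) char_diff_le:
  fixes Y Z :: "'a \<Rightarrow> real^'d"
  assumes [measurable]: "Y \<in> borel_measurable M" "Z \<in> borel_measurable M" "B \<in> sets M"
    and close: "\<And>x. x \<in> space M \<Longrightarrow> x \<notin> B \<Longrightarrow> norm (Y x - Z x) \<le> \<rho>" and \<rho>: "\<rho> \<ge> 0"
  shows "cmod ((\<integral>x. iexp (u \<bullet> Y x) \<partial>M) - (\<integral>x. iexp (u \<bullet> Z x) \<partial>M)) \<le> norm u * \<rho> + 2 * prob B"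
proof -
  have i: "integrable M (\<lambda>x. iexp (u \<bullet> Y x))" "integrable M (\<lambda>x. iexp (u \<bullet> Z x))"
    by (rule integrable_iexp_inner[OF finite_measure_axioms], measurable)+
  have iB: "integrable M (indicator B :: _ \<Rightarrow> real)"
    by (rule integrable_const_bound[of _ 1]) (auto simp: indicator_def)
  have "cmod (\<integral>x. iexp (u \<bullet> Y x) - iexp (u \<bullet> Z x) \<partial>M) \<le> (\<integral>x. norm u * \<rho> + 2 * indicator B x \<partial>M)"
  proof (rule norm_integral_le_integral)
    fix x assume x: "x \<in> space M"
    show "cmod (iexp (u \<bullet> Y x) - iexp (u \<bullet> Z x)) \<le> norm u * \<rho> + 2 * indicator B x"
    proof (cases "x \<in> B")
      case True
      have "cmod (iexp (u \<bullet> Y x) - iexp (u \<bullet> Z x)) \<le> 1 + 1"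
        by (rule order_trans[OF norm_triangle_ineq4]) simp
      then show ?thesis using True \<rho> by (simp add: add_increasing)
    next
      case False
      have "iexp (u \<bullet> Y x) - iexp (u \<bullet> Z x) = iexp (u \<bullet> Z x) * (iexp (u \<bullet> (Y x - Z x)) - 1)"
        unfolding right_diff_distrib exp_add[symmetric] by (simp add: inner_diff_right algebra_simps)
      then have "cmod (iexp (u \<bullet> Y x) - iexp (u \<bullet> Z x)) = cmod (iexp (u \<bullet> (Y x - Z x)) - 1)"
        by (simp only: norm_mult norm_exp_i_times mult_1_left)
      also have "\<dots> \<le> \<bar>u \<bullet> (Y x - Z x)\<bar>" using iexp_approx1[of "u \<bullet> (Y x - Z x)" 0] by simp
      also have "\<dots> \<le> norm u * norm (Y x - Z x)" by (rule Cauchy_Schwarz_ineq2)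
      also have "\<dots> \<le> norm u * \<rho>" by (rule mult_left_mono[OF close[OF x False]]) simp
      finally show ?thesis using False by simp
    qed
  qed (use i iB in auto)
  then show ?thesis using i iB by (simp add: prob_space)
qed

section \<open>The good event and the weak limit of the one-step estimator\<close>

locale one_step = ar_model \<Theta> S g P X R1 R2 R3 C L c
  for \<Theta> :: "(real^'d) set" and S g and P :: "real^'d \<Rightarrow> 'w measure" and X R1 R2 R3 C L c +
  fixes est :: "nat \<Rightarrow> (nat \<Rightarrow> real) \<Rightarrow> real^'d" and \<delta> :: real
  assumes L_nonneg: "L \<ge> 0"
    and est_meas: "\<And>N. est N \<in> borel_measurable (PiM UNIV (\<lambda>_. borel))"
    and est_val: "\<And>N \<xi>. est N \<xi> \<in> \<Theta>"
    and est_tight: "tight_uc \<Theta> P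
           (\<lambda>n \<theta> w. sqrt (real (Nsz \<delta> n)) *\<^sub>R (est (Nsz \<delta> n) (\<lambda>j. X j w) - \<theta>))"
    and delta: "1 / 2 < \<delta>" "\<delta> < 1"
begin

lemma est_X_measurable: "\<theta> \<in> \<Theta> \<Longrightarrow> (\<lambda>w. est N (\<lambda>j. X j w)) \<in> borel_measurable (P \<theta>)"
  by (rule measurable_compose[OF _ est_meas]) (auto intro!: measurable_PiM_single' X_measurable)

text \<open>The estimator is substituted for the parameter both in the inverse information and in
  the score sum, so measurability is not compositional; it comes from continuity of these in the
  parameter.\<close>

lemma onestep_measurable:
  assumes t: "\<theta> \<in> \<Theta>"
  shows "(\<lambda>w. onestep S g P X est \<delta> s n w) \<in> borel_measurable (P \<theta>)"
proof -
  define N k where "N = Nsz \<delta> n" and "k = ksz s n"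
  let ?f = "\<lambda>t w. t + (1 / sqrt (real k)) *\<^sub>R (Iinv t *v Delta S g N k t (\<lambda>j. X j w))"
  have "(\<lambda>w. ?f (est N (\<lambda>j. X j w)) w) \<in> borel_measurable (P \<theta>)"
  proof (rule caratheodory_measurable[OF Theta(1), where f = ?f and T = "\<lambda>w. est N (\<lambda>j. X j w)"])
    fix t assume t': "t \<in> \<Theta>"
    have "(\<lambda>w. Delta S g N k t (\<lambda>j. X j w)) \<in> borel_measurable (P \<theta>)"
      unfolding Delta_def by (intro borel_measurable_scaleR borel_measurable_const borel_measurable_sum
          dell_measurable[OF t'] X_measurable[OF t])
    then have "(\<lambda>w. Iinv t *v Delta S g N k t (\<lambda>j. X j w)) \<in> borel_measurable (P \<theta>)"
      by (rule measurable_compose[OF _ matrix_vector_mult_measurable])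
    then show "?f t \<in> borel_measurable (P \<theta>)" by simp
  next
    fix w
    show "continuous_on \<Theta> (\<lambda>t. ?f t w)"
      unfolding Delta_def by (intro continuous_intros Iinv_mult_continuous dell_continuous)
  qed (use est_X_measurable[OF t] est_val in auto)
  then show ?thesis by (simp add: onestep_def Let_def N_def k_def)
qed

text \<open>The outcomes at which one of the probabilistic inputs of \<open>remainder_bound\<close>
  fails.\<close>

definition "bad C0 t m k N =
  {w \<in> space (P t). norm (sqrt (real (Nsz \<delta> m)) *\<^sub>R (est (Nsz \<delta> m) (\<lambda>j. X j w) - t)) > C0} \<union>
  {w \<in> space (P t). norm (hess_dev t k w) > C0} \<union> {w \<in> space (P t). norm (hess_dev t N w) > C0} \<union>
  {w \<in> space (P t). (\<Sum>j=1..k. 1 + (R3 (X (j - 1) w) (X j w))\<^sup>2) > C0 * real k} \<union>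
  {w \<in> space (P t). norm (score_sum t k w) > C0 * sqrt (real k)} \<union>
  {w \<in> space (P t). norm (score_sum t N w) > C0 * sqrt (real N)}"

lemma score_sum_measurable: "t \<in> \<Theta> \<Longrightarrow> score_sum t n \<in> borel_measurable (P t)"
  unfolding score_sum_def[abs_def] by (intro borel_measurable_sum dell_measurable X_measurable)

lemma hess_dev_measurable: "t \<in> \<Theta> \<Longrightarrow> hess_dev t n \<in> borel_measurable (P t)"
  unfolding hess_dev_def[abs_def]
  by (intro borel_measurable_sum borel_measurable_scaleR borel_measurable_const borel_measurable_add ddell_measurable X_measurable)

lemma bad_sets: "t \<in> \<Theta> \<Longrightarrow> bad C0 t m k N \<in> sets (P t)"
proof -
  assume t: "t \<in> \<Theta>"
  note [measurable] = est_X_measurable[OF t] score_sum_measurable[OF t] hess_dev_measurable[OF t]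
  have [measurable]: "(\<lambda>w. \<Sum>j=1..k. 1 + (R3 (X (j - 1) w) (X j w))\<^sup>2) \<in> borel_measurable (P t)"
    by (intro borel_measurable_sum borel_measurable_add borel_measurable_const borel_measurable_integrable R_int(3)[OF t]) auto
  show ?thesis unfolding bad_def by measurable
qed

text \<open>Six events receive \<epsilon> / 6 each. The estimator and the two Hessian deviations are
  tight by assumption, the third-derivative sum is handled by Markov, the two score sums by
  Chebyshev. All constants hold for the whole compact set and for all sizes.\<close>

lemma good_event:
  assumes K: "compact K" "K \<subseteq> \<Theta>" and \<epsilon>: "\<epsilon> > 0"
  obtains C0 where "C0 > 0" "\<And>t m k N. t \<in> K \<Longrightarrow> k \<ge> 1 \<Longrightarrow> N \<ge> 1 \<Longrightarrow> measure (P t) (bad C0 t m k N) \<le> \<epsilon>"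
proof -
  have e6: "\<epsilon> / 6 > 0" using \<epsilon> by simp
  obtain c1 where c1: "c1 > 0" "\<And>m t. t \<in> K \<Longrightarrow> measure (P t) {w \<in> space (P t). norm (sqrt (real (Nsz \<delta> m)) *\<^sub>R (est (Nsz \<delta> m) (\<lambda>j. X j w) - t)) > c1} \<le> \<epsilon> / 6"
    using est_tight[unfolded tight_uc_def, rule_format, of K "\<epsilon> / 6"] K e6 by auto
  obtain c2 where c2: "c2 > 0" "\<And>n t. t \<in> K \<Longrightarrow> measure (P t) {w \<in> space (P t). norm (hess_dev t n w) > c2} \<le> \<epsilon> / 6"
    using tight_hess[unfolded tight_uc_def, rule_format, of K "\<epsilon> / 6"] K e6 unfolding hess_dev_def by auto
  \<comment> \<open>A nonnegative version of C. Then c4 is the level at which Markov with mean 1 +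
    C' per summand yields \<epsilon> / 6, and c5 the corresponding Chebyshev level; the 1 added in
    c5 keeps it positive even when C' = 0.\<close>
  define C' where "C' = max C 0"
  define c4 where "c4 = 6 * (1 + C') / \<epsilon>"
  define c5 where "c5 = sqrt (6 * (CARD('d) * C' + 1) / \<epsilon>)"
  have C'0: "C' \<ge> 0" "C \<le> C'" by (auto simp: C'_def)
  have c4: "c4 > 0" using \<epsilon> C'0 by (simp add: c4_def)
  have c5: "c5 > 0" "c5\<^sup>2 = 6 * (CARD('d) * C' + 1) / \<epsilon>"
  proof -
    have "6 * (CARD('d) * C' + 1) / \<epsilon> > 0" using \<epsilon> C'0 by (intro divide_pos_pos mult_pos_pos add_nonneg_pos) auto
    then show "c5 > 0" "c5\<^sup>2 = 6 * (CARD('d) * C' + 1) / \<epsilon>" by (auto simp: c5_def)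
  qed
  define C0 where "C0 = max (max c1 c2) (max c4 c5)"
  have C0: "c1 \<le> C0" "c2 \<le> C0" "c4 \<le> C0" "c5 \<le> C0" "C0 > 0" using c1(1) by (auto simp: C0_def)
  show ?thesis
  proof (rule that[OF C0(5)])
    fix t m and k N :: nat assume tK: "t \<in> K" and k: "k \<ge> 1" and N: "N \<ge> 1"
    have t: "t \<in> \<Theta>" using K tK by auto
    interpret A: prob_space "P t" by (rule prob_P[OF t])
    note [measurable] = est_X_measurable[OF t] score_sum_measurable[OF t] hess_dev_measurable[OF t]
    let ?R = "\<lambda>w. \<Sum>j=1..k. 1 + (R3 (X (j - 1) w) (X j w))\<^sup>2"
    have Ri: "integrable (P t) ?R"
      by (intro Bochner_Integration.integrable_sum Bochner_Integration.integrable_add R_int(3)[OF t]) auto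
    then have [measurable]: "?R \<in> borel_measurable (P t)" by (rule borel_measurable_integrable)
    have b1: "measure (P t) {w \<in> space (P t). norm (sqrt (real (Nsz \<delta> m)) *\<^sub>R (est (Nsz \<delta> m) (\<lambda>j. X j w) - t)) > C0} \<le> \<epsilon> / 6"
      by (rule order_trans[OF A.finite_measure_mono c1(2)[OF tK, of m]]) (use C0(1) in auto)
    have b2: "measure (P t) {w \<in> space (P t). norm (hess_dev t n w) > C0} \<le> \<epsilon> / 6" for n
      by (rule order_trans[OF A.finite_measure_mono c2(2)[OF tK, of n]]) (use C0(2) in auto)
    have b4: "measure (P t) {w \<in> space (P t). ?R w > C0 * real k} \<le> \<epsilon> / 6"
    proof -
      have "measure (P t) {w \<in> space (P t). ?R w > C0 * real k} \<le> measure (P t) {w \<in> space (P t). ?R w \<ge> c4 * real k}"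
      proof (rule A.finite_measure_mono)
        have "c4 * real k \<le> C0 * real k" using C0(3) by (simp add: mult_right_mono)
        then show "{w \<in> space (P t). ?R w > C0 * real k} \<subseteq> {w \<in> space (P t). ?R w \<ge> c4 * real k}" by auto
      qed measurable
      also have "\<dots> \<le> (\<integral>w. ?R w \<partial>P t) / (c4 * real k)"
        by (rule integral_Markov_inequality_measure[OF Ri sets.empty_sets])
          (use c4 k in \<open>auto intro!: AE_I2 sum_nonneg\<close>)
      also have "\<dots> \<le> (real k * (1 + C')) / (c4 * real k)"
      proof (rule divide_right_mono)
        have "(\<integral>w. ?R w \<partial>P t) = (\<Sum>j=1..k. 1 + (\<integral>w. (R3 (X (j - 1) w) (X j w))\<^sup>2 \<partial>P t))"
          using R_int(3)[OF t] by (subst Bochner_Integration.integral_sum) (auto simp: A.prob_space)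
        also have "\<dots> \<le> (\<Sum>j=1..k. 1 + C')" using R_le(3)[OF t] C'0 by (intro sum_mono add_mono) (auto intro: order_trans)
        finally show "(\<integral>w. ?R w \<partial>P t) \<le> real k * (1 + C')" by simp
      qed (use c4 in auto)
      also have "\<dots> = \<epsilon> / 6" using k \<epsilon> C'0 by (simp add: c4_def field_simps add_nonneg_eq_0_iff)
      finally show ?thesis .
    qed
    have b5: "measure (P t) {w \<in> space (P t). norm (score_sum t n w) > C0 * sqrt (real n)} \<le> \<epsilon> / 6" if n: "n \<ge> 1" for n
    proof -
      have "measure (P t) {w \<in> space (P t). norm (score_sum t n w) > C0 * sqrt (real n)} \<le>
          measure (P t) {w \<in> space (P t). \<bar>norm (score_sum t n w)\<bar> > c5 * sqrt (real n)}"
      proof (rule A.finite_measure_mono)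
        have "c5 * sqrt (real n) \<le> C0 * sqrt (real n)" using C0(4) by (simp add: mult_right_mono)
        then show "{w \<in> space (P t). norm (score_sum t n w) > C0 * sqrt (real n)} \<subseteq> {w \<in> space (P t). \<bar>norm (score_sum t n w)\<bar> > c5 * sqrt (real n)}" by auto
      qed measurable
      also have "\<dots> \<le> (\<integral>w. (norm (score_sum t n w))\<^sup>2 \<partial>P t) / (c5 * sqrt (real n))\<^sup>2"
        by (rule A.prob_abs_gt_le[OF measurable_compose[OF score_sum_measurable[OF t] borel_measurable_norm] dell_sum_square(1)[OF t, folded score_sum_def]])
          (use c5(1) n in auto)
      also have "\<dots> \<le> (real n * (CARD('d) * C' + 1)) / (c5 * sqrt (real n))\<^sup>2"
      proof (rule divide_right_mono)
        have "(\<integral>w. (norm (score_sum t n w))\<^sup>2 \<partial>P t) \<le> real n * (CARD('d) * C)"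
          unfolding score_sum_def by (rule dell_sum_square(2)[OF t])
        also have "\<dots> \<le> real n * (CARD('d) * C' + 1)" using C'0
          by (intro mult_left_mono add_increasing2) auto
        finally show "(\<integral>w. (norm (score_sum t n w))\<^sup>2 \<partial>P t) \<le> real n * (CARD('d) * C' + 1)" .
      qed simp
      also have "\<dots> = (CARD('d) * C' + 1) / c5\<^sup>2" using n by (simp add: power_mult_distrib)
      also have "\<dots> = \<epsilon> / 6"
      proof -
        have "real CARD('d) * C' + 1 > 0" using C'0 by (intro add_nonneg_pos) auto
        moreover have "y / (6 * y / \<epsilon>) = \<epsilon> / 6" if "y > 0" for y :: real
          using that \<epsilon> by (simp add: field_simps)
        ultimately show ?thesis unfolding c5(2) by blast
      qed
      finally show ?thesis .
    qed
    have U: "measure (P t) (A \<union> B) \<le> a + b" if "measure (P t) A \<le> a" "measure (P t) B \<le> b" "A \<in> sets (P t)" "B \<in> sets (P t)" for A B a b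
      using measure_Un_le[OF that(3,4)] that(1,2) by linarith
    have "measure (P t) (bad C0 t m k N) \<le> \<epsilon> / 6 + \<epsilon> / 6 + \<epsilon> / 6 + \<epsilon> / 6 + \<epsilon> / 6 + \<epsilon> / 6"
      unfolding bad_def by (intro U b1 b2 b4 b5 k N) measurable
    then show "measure (P t) (bad C0 t m k N) \<le> \<epsilon>" by simp
  qed
qed

text \<open>Characteristic functions of the normalised estimator are compared with those of its
  linear part Z, for which the central limit theorem along the sequence is available. Moving
  parameters are allowed because every constant involved depends on K alone.\<close>

theorem weak_conv_along_sequences:
  assumes K: "compact K" "K \<subseteq> \<Theta>" and \<theta>: "\<And>n. \<theta> n \<in> K" "\<theta> \<longlonglongrightarrow> \<theta>0" "\<theta>0 \<in> \<Theta>"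
    and m: "filterlim m at_top sequentially" and s: "0 < s" "s \<le> 1"
  shows "weak_conv_vec
      (\<lambda>n. distr (P (\<theta> n)) borel (\<lambda>w. sqrt (real (ksz s (m n))) *\<^sub>R (onestep S g P X est \<delta> s (m n) w - \<theta> n)))
      (normal_vec (Iinv \<theta>0))"
proof (rule levy_continuity_vec)
  let ?Y = "\<lambda>n w. sqrt (real (ksz s (m n))) *\<^sub>R (onestep S g P X est \<delta> s (m n) w - \<theta> n)"
  have \<theta>T: "\<theta> n \<in> \<Theta>" for n using \<theta>(1) K by auto
  have Ym: "?Y n \<in> borel_measurable (P (\<theta> n))" for n
    using onestep_measurable[OF \<theta>T[of n]] by simp
  show "prob_space (distr (P (\<theta> n)) borel (?Y n))" for n
    by (rule prob_space.prob_space_distr[OF prob_P[OF \<theta>T] Ym])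
  fix u :: "real^'d"
  have psd: "transpose (Iinv \<theta>0) = Iinv \<theta>0" "\<And>x. 0 \<le> x \<bullet> (Iinv \<theta>0 *v x)"
    "(Iinv \<theta>0 *v u) \<bullet> (I \<theta>0 *v (Iinv \<theta>0 *v u)) = u \<bullet> (Iinv \<theta>0 *v u)"
    by (rule coercive_matrix_inv_psd[OF nondeg(1) nondeg(2)[OF \<theta>(3)] fisher_inner(1)[OF \<theta>(3)]]; assumption)+
  define k N where "k n = ksz s (m n)" and "N n = Nsz \<delta> (m n)" for n
  note lims = size_limits[OF delta s m, folded k_def N_def]
  let ?Z = "\<lambda>n w. Iinv \<theta>0 *v ((1 / sqrt (real (k n))) *\<^sub>R score_sum (\<theta> n) (k n) w)"
  have Zm: "?Z n \<in> borel_measurable (P (\<theta> n))" for n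
    by (rule measurable_compose[OF _ matrix_vector_mult_measurable]) (use score_sum_measurable[OF \<theta>T[of n]] in simp)
  have chZ: "(\<lambda>n. \<integral>w. iexp (u \<bullet> ?Z n w) \<partial>P (\<theta> n)) \<longlonglongrightarrow> (\<integral>y. iexp (u \<bullet> y) \<partial>normal_vec (Iinv \<theta>0))"
  proof -
    \<comment> \<open>Symmetry moves the inverse information onto u, so that the central limit
      theorem is used in that fixed direction.\<close>
    have Z: "u \<bullet> ?Z n w = (Iinv \<theta>0 *v u) \<bullet> ((1 / sqrt (real (k n))) *\<^sub>R score_sum (\<theta> n) (k n) w)" for n w
      by (rule symmetric_inner[OF psd(1)])
    show ?thesis
      unfolding char_normal_vec[OF psd(1,2)] Z psd(3)[symmetric] unfolding score_sum_def
      by (rule clt_seq[OF K \<theta> lims(1)])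
  qed
  have diff: "(\<lambda>n. (\<integral>w. iexp (u \<bullet> ?Y n w) \<partial>P (\<theta> n)) - (\<integral>w. iexp (u \<bullet> ?Z n w) \<partial>P (\<theta> n))) \<longlonglongrightarrow> 0"
  proof (rule LIMSEQ_I)
    fix r :: real assume r: "r > 0"
    obtain C0 where C0: "C0 > 0" "\<And>t m k N. t \<in> K \<Longrightarrow> k \<ge> 1 \<Longrightarrow> N \<ge> 1 \<Longrightarrow> measure (P t) (bad C0 t m k N) \<le> r / 4"
      using good_event[OF K, of "r / 4"] r by auto
    define \<rho> where "\<rho> n = rem_bound C0 (sqrt (real (k n))) (sqrt (real (N n))) (norm (\<theta> n - \<theta>0))" for n
    have kr: "filterlim (\<lambda>n. sqrt (real (k n))) at_infinity sequentially" "filterlim (\<lambda>n. sqrt (real (N n))) at_infinity sequentially"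
      using lims(1,2) by (auto intro!: filterlim_at_top_imp_at_infinity filterlim_compose[OF sqrt_at_top] filterlim_compose[OF filterlim_real_sequentially])
    have "(\<lambda>n. norm (\<theta> n - \<theta>0)) \<longlonglongrightarrow> 0"
      using \<theta>(2) by (intro tendsto_norm_zero) (simp add: LIM_zero_iff)
    then have "\<rho> \<longlonglongrightarrow> ((L * C0\<^sup>2 + C0 ^ 3) * 0 + (C * C0 + C0) * 0 + 0 + 0) / c + L * (0 + 0) * C0 / c\<^sup>2"
      unfolding \<rho>_def rem_bound_def using nondeg(1)
      by (intro tendsto_intros lims(3,4) tendsto_divide_0[OF tendsto_const] kr) auto
    then have "(\<lambda>n. norm u * \<rho> n) \<longlonglongrightarrow> norm u * 0" by (intro tendsto_intros) simp
    then have ev1: "\<forall>\<^sub>F n in sequentially. norm u * \<rho> n < r / 2" using r by (intro order_tendstoD) auto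
    have ev2: "\<forall>\<^sub>F n in sequentially. k n \<ge> 1" "\<forall>\<^sub>F n in sequentially. N n \<ge> 1"
      using lims(1,2) by (auto simp: filterlim_at_top)
    \<comment> \<open>Guarantees N \<le> k eventually, so that the summation from N + 1 to k splits
      off as in \<open>remainder_bound\<close>.\<close>
    have ev3: "\<forall>\<^sub>F n in sequentially. sqrt (real (N n)) / sqrt (real (k n)) < 1"
      using lims(3) by (intro order_tendstoD) auto
    have "\<forall>\<^sub>F n in sequentially. norm ((\<integral>w. iexp (u \<bullet> ?Y n w) \<partial>P (\<theta> n)) - (\<integral>w. iexp (u \<bullet> ?Z n w) \<partial>P (\<theta> n)) - 0) < r"
      using ev1 ev2 ev3
    proof eventually_elim
      case (elim n)
      interpret A: prob_space "P (\<theta> n)" by (rule prob_P[OF \<theta>T])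
      have Nk: "N n \<le> k n" using elim(2,4) by (simp add: divide_less_eq)
      have cl: "norm (?Y n w - ?Z n w) \<le> \<rho> n" if w: "w \<in> space (P (\<theta> n))" "w \<notin> bad C0 (\<theta> n) (m n) (k n) (N n)" for w
      proof -
        let ?t = "est (N n) (\<lambda>j. X j w)"
        have "?Y n w = sqrt (real (k n)) *\<^sub>R (?t - \<theta> n) + Iinv ?t *v Delta S g (N n) (k n) ?t (\<lambda>j. X j w)"
          using elim(2) by (simp add: onestep_def Let_def k_def N_def scaleR_add_right scaleR_diff_right)
        then show ?thesis unfolding \<rho>_def
          by (simp only:) (rule remainder_bound[OF est_val \<theta>T \<theta>(3) L_nonneg elim(3) Nk less_imp_le[OF C0(1)]];
            use w in \<open>auto simp: bad_def N_def not_less\<close>)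
      qed
      have \<rho>0: "\<rho> n \<ge> 0"
        unfolding \<rho>_def rem_bound_def using L_nonneg C0(1) nondeg(1) order_trans[OF norm_ge_zero norm_fisher_le[OF \<theta>(3)]]
        by (intro add_nonneg_nonneg divide_nonneg_nonneg mult_nonneg_nonneg) auto
      have "cmod ((\<integral>w. iexp (u \<bullet> ?Y n w) \<partial>P (\<theta> n)) - (\<integral>w. iexp (u \<bullet> ?Z n w) \<partial>P (\<theta> n))) \<le>
          norm u * \<rho> n + 2 * measure (P (\<theta> n)) (bad C0 (\<theta> n) (m n) (k n) (N n))"
        by (rule A.char_diff_le[OF Ym Zm bad_sets[OF \<theta>T] cl \<rho>0])
      then show ?case using C0(2)[OF \<theta>(1) elim(2,3), of n "m n"] elim(1) by simp
    qed
    then show "\<exists>no. \<forall>n\<ge>no. norm ((\<integral>w. iexp (u \<bullet> ?Y n w) \<partial>P (\<theta> n)) - (\<integral>w. iexp (u \<bullet> ?Z n w) \<partial>P (\<theta> n)) - 0) < r"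
      by (auto simp: eventually_sequentially)
  qed
  have "(\<lambda>n. \<integral>w. iexp (u \<bullet> ?Y n w) \<partial>P (\<theta> n)) \<longlonglongrightarrow> (\<integral>y. iexp (u \<bullet> y) \<partial>normal_vec (Iinv \<theta>0))"
    using tendsto_add[OF diff chZ] by simp
  moreover have "(\<integral>y. iexp (u \<bullet> y) \<partial>distr (P (\<theta> n)) borel (?Y n)) = (\<integral>w. iexp (u \<bullet> ?Y n w) \<partial>P (\<theta> n))" for n
    by (rule integral_distr[OF Ym]) measurable
  ultimately show "(\<lambda>n. \<integral>y. iexp (u \<bullet> y) \<partial>distr (P (\<theta> n)) borel (?Y n)) \<longlonglongrightarrow> (\<integral>y. iexp (u \<bullet> y) \<partial>normal_vec (Iinv \<theta>0))"
    by (simp only:)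
qed (use prob_space_normal_vec in auto)

end

section \<open>From convergence along sequences to suprema over balls\<close>

text \<open>Continuous convergence on a compact set. Index sequences m that merely tend to infinity
  are needed, because the indices found by diagonal choice and by contradiction need not be n
  itself.\<close>

lemma continuous_convergence_imp_uniform:
  fixes F :: "nat \<Rightarrow> 'a::metric_space \<Rightarrow> real"
  assumes K: "compact K"
    and conv: "\<And>\<theta> \<theta>0 m. (\<And>n. \<theta> n \<in> K) \<Longrightarrow> \<theta> \<longlonglongrightarrow> \<theta>0 \<Longrightarrow> \<theta>0 \<in> K \<Longrightarrow>
      filterlim m at_top sequentially \<Longrightarrow> (\<lambda>n. F (m n) (\<theta> n)) \<longlonglongrightarrow> w \<theta>0"
  shows "continuous_on K w" "\<And>e. e > 0 \<Longrightarrow> \<exists>N. \<forall>n\<ge>N. \<forall>\<theta>\<in>K. \<bar>F n \<theta> - w \<theta>\<bar> < e"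
proof -
  show cont: "continuous_on K w"
    unfolding continuous_on_sequentially
  proof (intro allI ballI impI, elim conjE)
    fix \<theta> \<theta>0 assume \<theta>0: "\<theta>0 \<in> K" and \<theta>: "\<forall>n. \<theta> n \<in> K" "\<theta> \<longlonglongrightarrow> \<theta>0"
    \<comment> \<open>Diagonal choice: a constant sequence gives pointwise convergence, so m n can
      be taken at least n with F (m n) within 1 / (n + 1) of w at \<theta> n. The limit of w along
      \<theta> then equals that of F.\<close>
    have "\<exists>m\<ge>n. \<bar>F m (\<theta> n) - w (\<theta> n)\<bar> < 1 / real (Suc n)" for n
    proof -
      have "(\<lambda>i. F i (\<theta> n)) \<longlonglongrightarrow> w (\<theta> n)"
        using conv[of "\<lambda>_. \<theta> n" "\<theta> n" "\<lambda>i. i"] \<theta>(1) by (simp add: filterlim_ident)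
      then have "\<forall>\<^sub>F i in sequentially. dist (F i (\<theta> n)) (w (\<theta> n)) < 1 / real (Suc n)" by (rule tendstoD) simp
      then obtain N where "\<forall>i\<ge>N. dist (F i (\<theta> n)) (w (\<theta> n)) < 1 / real (Suc n)" by (auto simp: eventually_sequentially)
      then show ?thesis by (intro exI[of _ "max n N"]) (auto simp: dist_real_def)
    qed
    then obtain m where m: "\<And>n. m n \<ge> n" "\<And>n. \<bar>F (m n) (\<theta> n) - w (\<theta> n)\<bar> < 1 / real (Suc n)" by metis
    have "filterlim m at_top sequentially"
      by (rule filterlim_at_top_mono[OF filterlim_ident]) (use m(1) in auto)
    then have l: "(\<lambda>n. F (m n) (\<theta> n)) \<longlonglongrightarrow> w \<theta>0" by (intro conv \<theta> \<theta>0) (use \<theta> in auto)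
    have "(\<lambda>n. F (m n) (\<theta> n) - w (\<theta> n)) \<longlonglongrightarrow> 0"
      by (rule Lim_null_comparison[OF _ LIMSEQ_Suc[OF lim_1_over_n]]) (use m(2) in \<open>auto intro!: always_eventually less_imp_le\<close>)
    from tendsto_diff[OF l this] show "(w \<circ> \<theta>) \<longlonglongrightarrow> w \<theta>0" by (simp add: o_def)
  qed
  fix e :: real assume e: "e > 0"
  show "\<exists>N. \<forall>n\<ge>N. \<forall>\<theta>\<in>K. \<bar>F n \<theta> - w \<theta>\<bar> < e"
  proof (rule ccontr)
    assume "\<not> ?thesis"
    then have "\<forall>N. \<exists>n \<theta>. n \<ge> N \<and> \<theta> \<in> K \<and> \<bar>F n \<theta> - w \<theta>\<bar> \<ge> e" by (meson not_less)
    then obtain n \<theta> where n: "\<And>N. n N \<ge> N" "\<And>N. \<theta> N \<in> K" "\<And>N. \<bar>F (n N) (\<theta> N) - w (\<theta> N)\<bar> \<ge> e" by metis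
    \<comment> \<open>Failure of uniformity yields points at distance at least e; along a convergent
      subsequence F and w have the same limit, a contradiction.\<close>
    obtain \<theta>0 r where r: "\<theta>0 \<in> K" "strict_mono r" "(\<theta> \<circ> r) \<longlonglongrightarrow> \<theta>0"
      using K n(2) unfolding compact_def by metis
    have "filterlim (\<lambda>i. n (r i)) at_top sequentially"
    proof (rule filterlim_at_top_mono[OF filterlim_ident])
      show "\<forall>\<^sub>F i in sequentially. i \<le> n (r i)"
        using order_trans[OF seq_suble[OF r(2)] n(1)] by simp
    qed
    then have "(\<lambda>i. F (n (r i)) ((\<theta> \<circ> r) i)) \<longlonglongrightarrow> w \<theta>0" by (intro conv r) (use n(2) in auto)
    moreover have "(\<lambda>i. w ((\<theta> \<circ> r) i)) \<longlonglongrightarrow> w \<theta>0"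
      by (rule continuous_on_tendsto_compose[OF cont r(3,1)]) (use n(2) in auto)
    ultimately have "(\<lambda>i. F (n (r i)) (\<theta> (r i)) - w (\<theta> (r i))) \<longlonglongrightarrow> 0"
      using tendsto_diff by fastforce
    from LIMSEQ_D[OF this e] obtain i where "\<bar>F (n (r i)) (\<theta> (r i)) - w (\<theta> (r i))\<bar> < e" by auto
    with n(3)[of "r i"] show False by simp
  qed
qed

lemma SUP_diff_le:
  fixes f h :: "'a \<Rightarrow> real"
  assumes "A \<noteq> {}" and b: "\<And>x. x \<in> A \<Longrightarrow> f x \<le> b" "\<And>x. x \<in> A \<Longrightarrow> h x \<le> b"
    and d: "\<And>x. x \<in> A \<Longrightarrow> \<bar>f x - h x\<bar> \<le> e"
  shows "\<bar>(SUP x\<in>A. f x) - (SUP x\<in>A. h x)\<bar> \<le> e"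
proof -
  have bdd: "bdd_above (f ` A)" "bdd_above (h ` A)" using b by (auto simp: bdd_above_def)
  have "(SUP x\<in>A. f x) \<le> (SUP x\<in>A. h x) + e"
  proof (rule cSUP_least[OF assms(1)])
    fix x assume x: "x \<in> A"
    have "f x \<le> h x + e" using d[OF x] by linarith
    then show "f x \<le> (SUP x\<in>A. h x) + e" using cSUP_upper[OF x bdd(2)] by simp
  qed
  moreover have "(SUP x\<in>A. h x) \<le> (SUP x\<in>A. f x) + e"
  proof (rule cSUP_least[OF assms(1)])
    fix x assume x: "x \<in> A"
    have "h x \<le> f x + e" using d[OF x] by linarith
    then show "h x \<le> (SUP x\<in>A. f x) + e" using cSUP_upper[OF x bdd(1)] by simp
  qed
  ultimately show ?thesis by linarith
qed

text \<open>For \<rho> < R the inner limit is the supremum of w over the ball, by uniform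
  convergence; continuity at the centre gives the outer limit. Convergence is stated separately
  since \<open>lim\<close> is meaningful only then, and the bound b keeps the real suprema well
  defined.\<close>

lemma SUP_ball_limits:
  fixes F :: "nat \<Rightarrow> 'a::metric_space \<Rightarrow> real"
  assumes R: "R > 0" and cont: "continuous_on (cball x0 R) w"
    and unif: "\<And>e. e > 0 \<Longrightarrow> \<exists>N. \<forall>n\<ge>N. \<forall>x\<in>cball x0 R. \<bar>F n x - w x\<bar> < e"
    and b: "\<And>n x. x \<in> cball x0 R \<Longrightarrow> F n x \<le> b" "\<And>x. x \<in> cball x0 R \<Longrightarrow> w x \<le> b"
  shows "\<forall>\<^sub>F \<rho> in at_right 0. convergent (\<lambda>n. SUP x\<in>ball x0 \<rho>. F n x)"
    "((\<lambda>\<rho>. lim (\<lambda>n. SUP x\<in>ball x0 \<rho>. F n x)) \<longlongrightarrow> w x0) (at_right 0)"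
proof -
  have L: "(\<lambda>n. SUP x\<in>ball x0 \<rho>. F n x) \<longlonglongrightarrow> (SUP x\<in>ball x0 \<rho>. w x)" if \<rho>: "0 < \<rho>" "\<rho> < R" for \<rho>
  proof (rule LIMSEQ_I)
    fix e :: real assume e: "e > 0"
    have "e / 2 > 0" using e by simp
    from unif[OF this] obtain N where N: "\<And>n x. n \<ge> N \<Longrightarrow> x \<in> cball x0 R \<Longrightarrow> \<bar>F n x - w x\<bar> < e / 2" by blast
    have "norm ((SUP x\<in>ball x0 \<rho>. F n x) - (SUP x\<in>ball x0 \<rho>. w x)) < e" if "n \<ge> N" for n
    proof -
      have "\<bar>(SUP x\<in>ball x0 \<rho>. F n x) - (SUP x\<in>ball x0 \<rho>. w x)\<bar> \<le> e / 2"
        by (rule SUP_diff_le[of _ _ b]) (use \<rho> b N[OF that] in \<open>auto intro: less_imp_le\<close>)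
      then show ?thesis using e by simp
    qed
    then show "\<exists>N. \<forall>n\<ge>N. norm ((SUP x\<in>ball x0 \<rho>. F n x) - (SUP x\<in>ball x0 \<rho>. w x)) < e" by blast
  qed
  have ev: "\<forall>\<^sub>F \<rho> in at_right 0. 0 < \<rho> \<and> \<rho> < R"
    using R by (auto simp: eventually_at_right_field)
  show "\<forall>\<^sub>F \<rho> in at_right 0. convergent (\<lambda>n. SUP x\<in>ball x0 \<rho>. F n x)"
    using ev by eventually_elim (use L convergentI in blast)
  have "((\<lambda>\<rho>. SUP x\<in>ball x0 \<rho>. w x) \<longlongrightarrow> w x0) (at_right 0)"
  proof (rule tendstoI)
    fix e :: real assume e: "e > 0"
    obtain d where d: "d > 0" "\<And>x. x \<in> cball x0 R \<Longrightarrow> dist x x0 < d \<Longrightarrow> dist (w x) (w x0) < e / 2"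
      using cont[unfolded continuous_on_iff, rule_format, of x0 "e / 2"] R e by auto
    have "\<forall>\<^sub>F \<rho> in at_right 0. 0 < \<rho> \<and> \<rho> < min d R"
      using R d(1) by (subst eventually_at_right_field) (auto intro!: exI[of _ "min d R"])
    then show "\<forall>\<^sub>F \<rho> in at_right 0. dist (SUP x\<in>ball x0 \<rho>. w x) (w x0) < e"
    proof eventually_elim
      case (elim \<rho>)
      have "\<bar>(SUP x\<in>ball x0 \<rho>. w x) - (SUP x\<in>ball x0 \<rho>. w x0)\<bar> \<le> e / 2"
      proof (rule SUP_diff_le[of _ _ b])
        fix x assume x: "x \<in> ball x0 \<rho>"
        then have "x \<in> cball x0 R" "dist x x0 < d" using elim by (auto simp: dist_commute)
        then show "\<bar>w x - w x0\<bar> \<le> e / 2" "w x \<le> b" using d(2)[of x] b(2) by (auto simp: dist_real_def intro: less_imp_le)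
      qed (use elim R b(2) in auto)
      then show ?case using e elim by (simp add: dist_real_def)
    qed
  qed
  moreover have "\<forall>\<^sub>F \<rho> in at_right 0. (SUP x\<in>ball x0 \<rho>. w x) = lim (\<lambda>n. SUP x\<in>ball x0 \<rho>. F n x)"
    using ev by eventually_elim (use L limI in metis)
  ultimately show "((\<lambda>\<rho>. lim (\<lambda>n. SUP x\<in>ball x0 \<rho>. F n x)) \<longlongrightarrow> w x0) (at_right 0)"
    by (rule Lim_transform_eventually)
qed

text \<open>Covers a nonintegrable f as well: its integral is 0 by convention, and b is
  nonnegative.\<close>

lemma (in prob_space) integral_le_bound:
  fixes f :: "'a \<Rightarrow> real"
  assumes "\<And>x. \<bar>f x\<bar> \<le> b"
  shows "(\<integral>x. f x \<partial>M) \<le> b"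
proof (cases "integrable M f")
  case True
  have "(\<integral>x. f x \<partial>M) \<le> (\<integral>x. b \<partial>M)"
    by (rule integral_mono[OF True]) (use assms abs_le_D1 in auto)
  then show ?thesis by (simp add: prob_space)
next
  case False
  have "0 \<le> b" using assms abs_ge_zero order_trans by blast
  then show ?thesis using False by (simp add: not_integrable_integral_eq)
qed

context one_step
begin

theorem asymptotic_normality:
  assumes "\<theta> \<in> \<Theta>" "0 < s" "s \<le> 1"
  shows "weak_conv_vec
      (\<lambda>n. distr (P \<theta>) borel (\<lambda>w. sqrt (real (ksz s n)) *\<^sub>R (onestep S g P X est \<delta> s n w - \<theta>)))
      (normal_vec (matrix_inv (fisher S g P X \<theta>)))"
  by (rule weak_conv_along_sequences[of "{\<theta>}" "\<lambda>_. \<theta>" \<theta> "\<lambda>n. n"]) (use assms filterlim_ident in auto)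

text \<open>The loss is a bounded continuous test function, so weak convergence along sequences is
  continuous convergence of the risks on a closed ball. The radius R places that ball inside
  \<Theta>, which makes it an admissible compact set.\<close>

theorem asymptotic_efficiency:
  assumes \<theta>0: "\<theta>0 \<in> \<Theta>" and W: "bounded_loss W" and s: "0 < s" "s \<le> 1"
  defines "F \<equiv> \<lambda>n \<theta>. \<integral>w. W (sqrt (real (ksz s n)) *\<^sub>R (onestep S g P X est \<delta> s n w - \<theta>)) \<partial>P \<theta>"
  shows "\<forall>\<^sub>F \<rho> in at_right 0. convergent (\<lambda>n. SUP \<theta>\<in>ball \<theta>0 \<rho>. F n \<theta>)"
    "((\<lambda>\<rho>. lim (\<lambda>n. SUP \<theta>\<in>ball \<theta>0 \<rho>. F n \<theta>)) \<longlongrightarrow>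
      (\<integral>z. W (z v* matrix_sqrt (matrix_inv (fisher S g P X \<theta>0))) \<partial>std_gauss)) (at_right 0)"
proof -
  have Wc: "continuous_on UNIV W" and Wb: "bounded (range W)" using W by (auto simp: bounded_loss_def)
  have Wm: "W \<in> borel_measurable borel" using Wc by (rule borel_measurable_continuous_onI)
  obtain b where b: "\<And>x. \<bar>W x\<bar> \<le> b" using Wb unfolding bounded_iff by auto
  obtain R where R: "R > 0" "cball \<theta>0 R \<subseteq> \<Theta>" using Theta(1) \<theta>0 open_contains_cball by blast
  define w where "w \<theta> = (\<integral>y. W y \<partial>normal_vec (Iinv \<theta>))" for \<theta>
  have conv: "(\<lambda>n. F (m n) (\<theta> n)) \<longlonglongrightarrow> w \<theta>'"
    if \<theta>: "\<And>n. \<theta> n \<in> cball \<theta>0 R" "\<theta> \<longlonglongrightarrow> \<theta>'" "\<theta>' \<in> cball \<theta>0 R" and m: "filterlim m at_top sequentially" for \<theta> \<theta>' m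
  proof -
    have "\<theta>' \<in> \<Theta>" and \<theta>n: "\<theta> n \<in> \<Theta>" for n using \<theta> R by auto
    note wc = weak_conv_along_sequences[OF compact_cball R(2) \<theta>(1,2) \<open>\<theta>' \<in> \<Theta>\<close> m s, unfolded weak_conv_vec_def, rule_format, OF conjI[OF Wc Wb]]
    have "(\<integral>x. W x \<partial>distr (P (\<theta> n)) borel (\<lambda>w. sqrt (real (ksz s (m n))) *\<^sub>R (onestep S g P X est \<delta> s (m n) w - \<theta> n))) = F (m n) (\<theta> n)" for n
      unfolding F_def by (rule integral_distr[OF _ Wm]) (use onestep_measurable[OF \<theta>n] in simp)
    with wc show ?thesis unfolding w_def by simp
  qed
  have F_le: "F n \<theta> \<le> b" if "\<theta> \<in> cball \<theta>0 R" for n \<theta>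
    unfolding F_def by (rule prob_space.integral_le_bound[OF prob_P]) (use that R b in auto)
  have w_le: "w \<theta> \<le> b" for \<theta>
    unfolding w_def by (rule prob_space.integral_le_bound[OF prob_space_normal_vec(1)]) (rule b)
  note U = continuous_convergence_imp_uniform[OF compact_cball, of \<theta>0 R F w, OF conv]
  have psd: "transpose (Iinv \<theta>0) = Iinv \<theta>0" "\<And>x. 0 \<le> x \<bullet> (Iinv \<theta>0 *v x)"
    by (rule coercive_matrix_inv_psd[OF nondeg(1) nondeg(2)[OF \<theta>0] fisher_inner(1)[OF \<theta>0]]; assumption)+
  \<comment> \<open>The claim multiplies a row vector from the left, \<open>normal_vec\<close> a
    column vector from the right; symmetry of the root reconciles them.\<close>
  have w0: "w \<theta>0 = (\<integral>z. W (z v* matrix_sqrt (Iinv \<theta>0)) \<partial>std_gauss)"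
    unfolding w_def integral_normal_vec[OF Wm] transpose_matrix_vector[symmetric] matrix_sqrt_props(1)[OF psd] ..
  show "\<forall>\<^sub>F \<rho> in at_right 0. convergent (\<lambda>n. SUP \<theta>\<in>ball \<theta>0 \<rho>. F n \<theta>)"
    by (rule SUP_ball_limits(1)[OF R(1) U(1) U(2) F_le w_le])
  show "((\<lambda>\<rho>. lim (\<lambda>n. SUP \<theta>\<in>ball \<theta>0 \<rho>. F n \<theta>)) \<longlongrightarrow>
      (\<integral>z. W (z v* matrix_sqrt (matrix_inv (fisher S g P X \<theta>0))) \<partial>std_gauss)) (at_right 0)"
    unfolding w0[symmetric] by (rule SUP_ball_limits(2)[OF R(1) U(1) U(2) F_le w_le])
qed

end

theorem theorem1:
  fixes \<Theta> :: "(real^'d) set"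
    and S :: "real^'d \<Rightarrow> real \<Rightarrow> real"
    and g :: "real \<Rightarrow> real"
    and P :: "real^'d \<Rightarrow> 'w measure"
    and X :: "nat \<Rightarrow> 'w \<Rightarrow> real"
    and est :: "nat \<Rightarrow> (nat \<Rightarrow> real) \<Rightarrow> real^'d"
    and \<delta> :: real
  assumes Theta: "open \<Theta>" "convex \<Theta>" "bounded \<Theta>"
    and model_prob: "\<forall>\<theta>\<in>\<Theta>. prob_space (P \<theta>)"
    and model_meas: "\<forall>\<theta>\<in>\<Theta>. \<forall>j. X j \<in> borel_measurable (P \<theta>)"
    and S_meas: "\<forall>\<theta>\<in>\<Theta>. S \<theta> \<in> borel_measurable borel"
    and model_indep: "\<forall>\<theta>\<in>\<Theta>. prob_space.indep_vars (P \<theta>) (\<lambda>_. borel)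
           (\<lambda>j \<omega>. if j = 0 then X 0 \<omega> else X j \<omega> - S \<theta> (X (j - 1) \<omega>)) UNIV"
    and model_noise: "\<forall>\<theta>\<in>\<Theta>. \<forall>j\<ge>1. distributed (P \<theta>) lborel
           (\<lambda>\<omega>. X j \<omega> - S \<theta> (X (j - 1) \<omega>)) (\<lambda>e. ennreal (g e))"
    and R1_stationary: "\<forall>\<theta>\<in>\<Theta>. \<forall>m. distr (P \<theta>) (PiM UNIV (\<lambda>_. borel)) (\<lambda>\<omega> j. X (m + j) \<omega>)
           = distr (P \<theta>) (PiM UNIV (\<lambda>_. borel)) (\<lambda>\<omega> j. X j \<omega>)"
    and R1_invariant: "\<forall>\<theta>\<in>\<Theta>. \<exists>\<pi> :: real \<Rightarrow> real.
           invariant_distr S g \<theta> (density lborel (\<lambda>x. ennreal (\<pi> x))) \<and>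
           (\<forall>\<mu>. invariant_distr S g \<theta> \<mu> \<longrightarrow> \<mu> = density lborel (\<lambda>x. ennreal (\<pi> x)))"
    and R2_depends: "\<forall>N \<xi> \<eta>. (\<forall>j\<le>N. \<xi> j = \<eta> j) \<longrightarrow> est N \<xi> = est N \<eta>"
    and R2_meas: "\<forall>N. est N \<in> borel_measurable (PiM UNIV (\<lambda>_. borel))"
    and R2_values: "\<forall>N \<xi>. est N \<xi> \<in> \<Theta>"
    and R2_tight: "tight_uc \<Theta> P
           (\<lambda>n \<theta> \<omega>. sqrt (real (Nsz \<delta> n)) *\<^sub>R (est (Nsz \<delta> n) (\<lambda>j. X j \<omega>) - \<theta>))"
    and R3_S: "\<forall>x. C3_on \<Theta> (\<lambda>\<theta>. S \<theta> x)"
    and R3_g: "\<forall>x. g x > 0" "C3_real g"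
    and R3_bounds: "\<exists>R1 R2 R3 C.
           (\<forall>x x'. \<forall>\<theta>\<in>\<Theta>. norm (dell S g \<theta> x x') \<le> R1 x x' \<and>
                           norm (ddell S g \<theta> x x') \<le> R2 x x' \<and>
                           norm (dddell S g \<theta> x x') \<le> R3 x x') \<and>
           (\<forall>\<theta>\<in>\<Theta>. \<forall>j\<ge>1.
              integrable (P \<theta>) (\<lambda>\<omega>. (R1 (X (j - 1) \<omega>) (X j \<omega>))\<^sup>2) \<and>
              (\<integral>\<omega>. (R1 (X (j - 1) \<omega>) (X j \<omega>))\<^sup>2 \<partial>P \<theta>) < C \<and>
              integrable (P \<theta>) (\<lambda>\<omega>. (R2 (X (j - 1) \<omega>) (X j \<omega>))\<^sup>2) \<and>
              (\<integral>\<omega>. (R2 (X (j - 1) \<omega>) (X j \<omega>))\<^sup>2 \<partial>P \<theta>) < C \<and>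
              integrable (P \<theta>) (\<lambda>\<omega>. (R3 (X (j - 1) \<omega>) (X j \<omega>))\<^sup>2) \<and>
              (\<integral>\<omega>. (R3 (X (j - 1) \<omega>) (X j \<omega>))\<^sup>2 \<partial>P \<theta>) < C)"
    and R4_LLN: "\<forall>\<theta>\<in>\<Theta>. conv_in_prob (P \<theta>)
           (\<lambda>n \<omega>. (1 / real n) *\<^sub>R (\<Sum>j=1..n. outer (dell S g \<theta> (X (j - 1) \<omega>) (X j \<omega>))))
           (fisher S g P X \<theta>)"
    and R4_CLT: "\<forall>\<theta>\<in>\<Theta>. weak_conv_vec
           (\<lambda>n. distr (P \<theta>) borel
              (\<lambda>\<omega>. (1 / sqrt (real n)) *\<^sub>R (\<Sum>j=1..n. dell S g \<theta> (X (j - 1) \<omega>) (X j \<omega>))))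
           (normal_vec (fisher S g P X \<theta>))"
    and R4_tight: "tight_uc \<Theta> P
           (\<lambda>n \<theta> \<omega>. (1 / sqrt (real n)) *\<^sub>R
              (\<Sum>j=1..n. ddell S g \<theta> (X (j - 1) \<omega>) (X j \<omega>) + fisher S g P X \<theta>))"
    and R5_Lipschitz: "\<exists>L. \<forall>\<theta>1\<in>\<Theta>. \<forall>\<theta>2\<in>\<Theta>.
           norm (fisher S g P X \<theta>1 - fisher S g P X \<theta>2) \<le> L * norm (\<theta>1 - \<theta>2)"
    and R5_nondeg: "\<exists>c>0. \<forall>\<theta>\<in>\<Theta>. \<forall>u. norm u = 1 \<longrightarrow> c \<le> u \<bullet> (fisher S g P X \<theta> *v u)"
    and R5_bounded: "\<exists>C. \<forall>\<theta>\<in>\<Theta>. \<forall>u. norm u = 1 \<longrightarrow> u \<bullet> (fisher S g P X \<theta> *v u) \<le> C"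
    and delta: "1 / 2 < \<delta>" "\<delta> < 1"
  shows "(\<forall>\<theta>\<in>\<Theta>. \<forall>s\<in>{0<..1}.
            weak_conv_vec
              (\<lambda>n. distr (P \<theta>) borel
                 (\<lambda>\<omega>. sqrt (real (ksz s n)) *\<^sub>R (onestep S g P X est \<delta> s n \<omega> - \<theta>)))
              (normal_vec (matrix_inv (fisher S g P X \<theta>))))
       \<and> (\<forall>\<theta>0\<in>\<Theta>. \<forall>W. bounded_loss W \<longrightarrow> (\<forall>s\<in>{0<..1}.
            (\<forall>\<^sub>F \<rho> in at_right 0. convergent (\<lambda>n. SUP \<theta>\<in>ball \<theta>0 \<rho>.
                \<integral>\<omega>. W (sqrt (real (ksz s n)) *\<^sub>R (onestep S g P X est \<delta> s n \<omega> - \<theta>)) \<partial>P \<theta>)) \<and>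
            ((\<lambda>\<rho>. lim (\<lambda>n. SUP \<theta>\<in>ball \<theta>0 \<rho>.
                \<integral>\<omega>. W (sqrt (real (ksz s n)) *\<^sub>R (onestep S g P X est \<delta> s n \<omega> - \<theta>)) \<partial>P \<theta>))
              \<longlongrightarrow> (\<integral>z. W (z v* matrix_sqrt (matrix_inv (fisher S g P X \<theta>0))) \<partial>std_gauss))
              (at_right 0)))"
proof -
  obtain R1 R2 R3 C where R: "\<And>x x' \<theta>. \<theta> \<in> \<Theta> \<Longrightarrow> norm (dell S g \<theta> x x') \<le> R1 x x' \<and>
      norm (ddell S g \<theta> x x') \<le> R2 x x' \<and> norm (dddell S g \<theta> x x') \<le> R3 x x'"
    "\<And>\<theta> j. \<theta> \<in> \<Theta> \<Longrightarrow> j \<ge> 1 \<Longrightarrow>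
      integrable (P \<theta>) (\<lambda>w. (R1 (X (j - 1) w) (X j w))\<^sup>2) \<and>
      (\<integral>w. (R1 (X (j - 1) w) (X j w))\<^sup>2 \<partial>P \<theta>) < C \<and>
      integrable (P \<theta>) (\<lambda>w. (R2 (X (j - 1) w) (X j w))\<^sup>2) \<and>
      (\<integral>w. (R2 (X (j - 1) w) (X j w))\<^sup>2 \<partial>P \<theta>) < C \<and>
      integrable (P \<theta>) (\<lambda>w. (R3 (X (j - 1) w) (X j w))\<^sup>2) \<and>
      (\<integral>w. (R3 (X (j - 1) w) (X j w))\<^sup>2 \<partial>P \<theta>) < C"
    using R3_bounds by (elim exE conjE) blast
  obtain L where L: "\<And>\<theta>1 \<theta>2. \<theta>1 \<in> \<Theta> \<Longrightarrow> \<theta>2 \<in> \<Theta> \<Longrightarrow>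
      norm (fisher S g P X \<theta>1 - fisher S g P X \<theta>2) \<le> L * norm (\<theta>1 - \<theta>2)"
    using R5_Lipschitz by blast
  obtain c where c: "c > 0" "\<And>\<theta> u. \<theta> \<in> \<Theta> \<Longrightarrow> norm u = 1 \<Longrightarrow> c \<le> u \<bullet> (fisher S g P X \<theta> *v u)"
    using R5_nondeg by blast
  have law: "ar_law (P \<theta>) X (S \<theta>) g" if "\<theta> \<in> \<Theta>" for \<theta>
    using that model_prob model_meas S_meas model_indep model_noise R3_g
    by (simp add: ar_law_def ar_law_axioms_def)
  note bound = R(1)[THEN conjunct1] R(1)[THEN conjunct2, THEN conjunct1] R(1)[THEN conjunct2, THEN conjunct2]
  have moment: "integrable (P \<theta>) (\<lambda>w. (R1 (X (j - 1) w) (X j w))\<^sup>2)"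
    "integrable (P \<theta>) (\<lambda>w. (R2 (X (j - 1) w) (X j w))\<^sup>2)"
    "integrable (P \<theta>) (\<lambda>w. (R3 (X (j - 1) w) (X j w))\<^sup>2)"
    "(\<integral>w. (R1 (X (j - 1) w) (X j w))\<^sup>2 \<partial>P \<theta>) \<le> C"
    "(\<integral>w. (R2 (X (j - 1) w) (X j w))\<^sup>2 \<partial>P \<theta>) \<le> C"
    "(\<integral>w. (R3 (X (j - 1) w) (X j w))\<^sup>2 \<partial>P \<theta>) \<le> C"
    if "\<theta> \<in> \<Theta>" "j \<ge> 1" for \<theta> j
    using R(2)[OF that] by (elim conjE, simp only: less_imp_le)+
  \<comment> \<open>A Lipschitz constant may be given with either sign; the remainder estimates
    multiply by it and need it nonnegative.\<close>
  have L': "norm (fisher S g P X \<theta>1 - fisher S g P X \<theta>2) \<le> max L 0 * norm (\<theta>1 - \<theta>2)"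
    if "\<theta>1 \<in> \<Theta>" "\<theta>2 \<in> \<Theta>" for \<theta>1 \<theta>2
    by (rule order_trans[OF L[OF that] mult_right_mono]) auto
  have "ar_model \<Theta> S g P X R1 R2 R3 C (max L 0) c"
    by (rule ar_model.intro[OF Theta(1,2) law R3_S[rule_format] R3_g(1)[rule_format] R3_g(2)
          bound moment R4_tight L' c])
  then interpret one_step \<Theta> S g P X R1 R2 R3 C "max L 0" c est \<delta>
    by (rule one_step.intro[OF _ one_step_axioms.intro[OF max.cobounded2 R2_meas[rule_format]
          R2_values[rule_format] R2_tight delta]])
  show ?thesis
    by (intro conjI ballI allI impI asymptotic_normality asymptotic_efficiency) auto
qed

end
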